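(* Suppose that the algebra $A=P_n/I$ is regular. Then the left $A$-module $\mathrm{Der}_K(A)$ of $K$-derivations of $A$ is generated by the derivations $\partial_{\mathbf{i},\mathbf{j}}$, $\mathbf{i}\in\mathbf{I}_r$, $\mathbf{j}\in\mathbf{J}_{r+1}$, and these generators satisfy the following defining relations (as a left $A$-module): $$\Delta(\mathbf{i},\mathbf{j})\,\partial_{\mathbf{i}',\mathbf{j}'}=\sum_{l=1}^{s}(-1)^{r+1+\nu_l}\,\Delta(\mathbf{i}';j_1',\ldots,\widehat{j_{\nu_l}'},\ldots,j_{r+1}')\,\partial_{\mathbf{i};\mathbf{j},j_{\nu_l}'}$$ for all $\mathbf{i},\mathbf{i}'\in\mathbf{I}_r$, $\mathbf{j}=(j_1,\ldots,j_r)\in\mathbf{J}_r$ and $\mathbf{j}'=(j_1',\ldots,j_{r+1}')\in\mathbf{J}_{r+1}$, where $\{j_{\nu_1}',\ldots,j_{\nu_s}'\}=\{j_1',\ldots,j_{r+1}'\}\setminus\{j_1,\ldots,j_r\}$. (That is, $\mathrm{Der}_K(A)$ is the quotient of the free left $A$-module on the symbols $\partial_{\mathbf{i},\mathbf{j}}$, $\mathbf{i}\in\mathbf{I}_r$, $\mathbf{j}\in\mathbf{J}_{r+1}$, by the submodule generated by these relations.)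
   Context: $K$ is a field of characteristic zero (not necessarily algebraically closed), $P_n=K[x_1,\ldots,x_n]$, $I=\sum_{i=1}^m P_nf_i$ is a prime but not maximal ideal of $P_n$ with generators $f_1,\ldots,f_m$, and $A=P_n/I$, a domain with field of fractions $Q$. The image of $p\in P_n$ in $A$ is written $\overline{p}$ (and the image of $x_i$ is also written $x_i$). $\overline{J}=\left(\overline{\partial f_i/\partial x_j}\right)\in M_{m,n}(A)$ is the Jacobi matrix and $r$ is its rank over $Q$. For tuples $\mathbf{i}=(i_1,\ldots,i_r)$ of indices in $\{1,\ldots,m\}$ and $\mathbf{j}=(j_1,\ldots,j_r)$ of indices in $\{1,\ldots,n\}$, $\Delta(\mathbf{i},\mathbf{j})=\Delta(\mathbf{i};j_1,\ldots,j_r)$ is the determinant of the $r\times r$ matrix $(\overline{J}_{i_\nu,j_\mu})_{\nu,\mu=1,\ldots,r}$ (columns in the listed order). A strictly increasing tuple $\mathbf{i}$ (resp. $\mathbf{j}$) is non-singular if $\Delta(\mathbf{i},\mathbf{j}')\ne0$ for some $\mathbf{j}'$ (resp. $\Delta(\mathbf{i}',\mathbf{j})\neq0$ for some $\mathbf{i}'$). $\mathbf{I}_r$ (resp. $\mathbf{J}_r$) is the set of all non-singular strictly increasing $r$-tuples $\mathbf{i}$ (resp. $\mathbf{j}$). $\mathbf{J}_{r+1}$ is the set of all tuples $(j_1,\ldots,j_{r+1})$ with $1\le j_1<\cdots<j_{r+1}\le n$ such that deleting some element $j_\nu$ leaves an element of $\mathbf{J}_r$. A hat over a symbol means it is omitted.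 For $\mathbf{i}=(i_1,\ldots,i_r)$ and $\mathbf{j}=(j_1,\ldots,j_{r+1})$ (not necessarily increasing), $$\partial_{\mathbf{i},\mathbf{j}}=\det\begin{pmatrix}\overline{\frac{\partial f_{i_1}}{\partial x_{j_1}}}&\cdots&\overline{\frac{\partial f_{i_1}}{\partial x_{j_{r+1}}}}\\ \vdots&&\vdots\\ \overline{\frac{\partial f_{i_r}}{\partial x_{j_1}}}&\cdots&\overline{\frac{\partial f_{i_r}}{\partial x_{j_{r+1}}}}\\ \partial_{j_1}&\cdots&\partial_{j_{r+1}}\end{pmatrix}:=\sum_{k=1}^{r+1}(-1)^{r+1+k}\Delta(\mathbf{i};j_1,\ldots,\widehat{j_k},\ldots,j_{r+1})\,\partial_{j_k},$$ where $\partial_j=\partial/\partial x_j$; i.e. $\partial_{\mathbf{i},\mathbf{j}}$ is the (well-defined) $K$-derivation of $A$ with $x_{j_k}\mapsto(-1)^{r+1+k}\Delta(\mathbf{i};j_1,\ldots,\widehat{j_k},\ldots,j_{r+1})$ and $x_l\mapsto0$ for $l\notin\{j_1,\ldots,j_{r+1}\}$. For $\mathbf{j}=(j_1,\ldots,j_r)$ and an index $k$, $\partial_{\mathbf{i};\mathbf{j},k}$ means $\partial_{\mathbf{i};j_1,\ldots,j_r,k}$; permuting the last $r+1$ indices multiplies the derivation by the sign of the permutation, so $\partial_{\mathbf{i};\mathbf{j},k}$ is $\pm$ one of the generators, and is read this way as an element of the free module. *)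

theory Defs
  imports
    "HOL-Algebra.Ring_Divisibility"
    "HOL-Library.Poly_Mapping"
    "HOL-Library.Extended_Nat"
    "HOL-Combinatorics.Permutations"
    "Jordan_Normal_Form.VS_Connect"
begin

hide_const (open) Multiset.mult

section \<open>Localizations and regular rings\<close>

text \<open>
  The class of \<open>r / s\<close> in \<open>S\<^sup>-\<^sup>1 R\<close>, where \<open>r / s = r' / s'\<close> iff
  \<open>t (s' r - s r') = 0\<close> for some \<open>t\<close> in \<open>S\<close>.
\<close>
definition frac_class :: "('a, 'b) ring_scheme \<Rightarrow> 'a set \<Rightarrow> 'a \<Rightarrow> 'a \<Rightarrow> ('a \<times> 'a) set" where
  "frac_class R S r s = {(r', s'). r' \<in> carrier R \<and> s' \<in> S \<and>
     (\<exists>t\<in>S. t \<otimes>\<^bsub>R\<^esub> (s' \<otimes>\<^bsub>R\<^esub> r \<ominus>\<^bsub>R\<^esub> s \<otimes>\<^bsub>R\<^esub> r') = \<zero>\<^bsub>R\<^esub>)}"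

text \<open>
  As in \<open>FactRing\<close>, the operations on classes are unions over all representatives.
\<close>
definition localization :: "('a, 'b) ring_scheme \<Rightarrow> 'a set \<Rightarrow> ('a \<times> 'a) set ring" where
  "localization R S = \<lparr>
     carrier = {frac_class R S r s | r s. r \<in> carrier R \<and> s \<in> S},
     mult = (\<lambda>U V. \<Union>(r, s)\<in>U. \<Union>(r', s')\<in>V. frac_class R S (r \<otimes>\<^bsub>R\<^esub> r') (s \<otimes>\<^bsub>R\<^esub> s')),
     one = frac_class R S \<one>\<^bsub>R\<^esub> \<one>\<^bsub>R\<^esub>,
     zero = frac_class R S \<zero>\<^bsub>R\<^esub> \<one>\<^bsub>R\<^esub>,
     add = (\<lambda>U V. \<Union>(r, s)\<in>U. \<Union>(r', s')\<in>V.
              frac_class R S (s' \<otimes>\<^bsub>R\<^esub> r \<oplus>\<^bsub>R\<^esub> s \<otimes>\<^bsub>R\<^esub> r') (s \<otimes>\<^bsub>R\<^esub> s')) \<rparr>"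

definition frac_field :: "('a, 'b) ring_scheme \<Rightarrow> ('a \<times> 'a) set ring" where
  "frac_field R = localization R (carrier R - {\<zero>\<^bsub>R\<^esub>})"

text \<open>
  The supremum of the lengths of chains \<open>p 0 \<subset> \<dots> \<subset> p k\<close> of prime ideals
  (with value \<open>0\<close> for the zero ring).
\<close>
definition krull_dim :: "('a, 'b) ring_scheme \<Rightarrow> enat" where
  "krull_dim R = Sup {enat k | k. \<exists>p :: nat \<Rightarrow> 'a set.
     (\<forall>i\<le>k. primeideal (p i) R) \<and> (\<forall>i<k. p i \<subset> p (Suc i))}"

text \<open>
  A Noetherian local ring whose maximal ideal can be generated by as many elements as its
  Krull dimension.
\<close>
definition regular_local_ring :: "('a, 'b) ring_scheme \<Rightarrow> bool" where
  "regular_local_ring R \<longleftrightarrow> cring R \<and> noetherian_ring R \<and>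
     (\<exists>M. (\<forall>M'. maximalideal M' R \<longleftrightarrow> M' = M) \<and>
          (\<exists>B\<subseteq>carrier R. finite B \<and> Idl\<^bsub>R\<^esub> B = M \<and> enat (card B) = krull_dim R))"

definition regular_ring :: "('a, 'b) ring_scheme \<Rightarrow> bool" where
  "regular_ring R \<longleftrightarrow> cring R \<and> noetherian_ring R \<and>
     (\<forall>p. primeideal p R \<longrightarrow> regular_local_ring (localization R (carrier R - p)))"


section \<open>Determinants, derivations and presentations of modules\<close>

text \<open>The determinant of \<open>(M i j)\<close>, \<open>0 \<le> i, j < r\<close>, over an arbitrary commutative ring.\<close>
definition ring_det :: "('a, 'b) ring_scheme \<Rightarrow> nat \<Rightarrow> (nat \<Rightarrow> nat \<Rightarrow> 'a) \<Rightarrow> 'a" where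
  "ring_det R r M = (\<Oplus>\<^bsub>R\<^esub>\<sigma>\<in>{\<sigma>. \<sigma> permutes {..<r}}.
     (if evenperm \<sigma> then \<one>\<^bsub>R\<^esub> else \<ominus>\<^bsub>R\<^esub> \<one>\<^bsub>R\<^esub>) \<otimes>\<^bsub>R\<^esub> (\<Otimes>\<^bsub>R\<^esub>i\<in>{..<r}. M i (\<sigma> i)))"

definition ring_sign :: "('a, 'b) ring_scheme \<Rightarrow> nat \<Rightarrow> 'a" where
  "ring_sign R k = (\<ominus>\<^bsub>R\<^esub> \<one>\<^bsub>R\<^esub>) [^]\<^bsub>R\<^esub> k"

text \<open>
  The derivations of \<open>R\<close> that are linear over the subset \<open>C\<close> (the image of the
  coefficient field), as extensional functions on \<open>carrier R\<close>.
\<close>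
definition derivations :: "('a, 'b) ring_scheme \<Rightarrow> 'a set \<Rightarrow> ('a \<Rightarrow> 'a) set" where
  "derivations R C = {d \<in> carrier R \<rightarrow>\<^sub>E carrier R.
     (\<forall>a\<in>carrier R. \<forall>b\<in>carrier R. d (a \<oplus>\<^bsub>R\<^esub> b) = d a \<oplus>\<^bsub>R\<^esub> d b) \<and>
     (\<forall>a\<in>carrier R. \<forall>b\<in>carrier R. d (a \<otimes>\<^bsub>R\<^esub> b) = d a \<otimes>\<^bsub>R\<^esub> b \<oplus>\<^bsub>R\<^esub> a \<otimes>\<^bsub>R\<^esub> d b) \<and>
     (\<forall>c\<in>C. \<forall>a\<in>carrier R. d (c \<otimes>\<^bsub>R\<^esub> a) = c \<otimes>\<^bsub>R\<^esub> d a)}"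

definition derivation_module :: "('a, 'b) ring_scheme \<Rightarrow> 'a set \<Rightarrow> ('a, 'a \<Rightarrow> 'a) module" where
  "derivation_module R C = (ring.func_space R (carrier R))\<lparr>carrier := derivations R C\<rparr>"

text \<open>
  For finite \<open>S\<close>, \<open>ring.func_space R S\<close> is the free \<open>R\<close>-module on \<open>S\<close>, and this is its
  basis element belonging to \<open>s\<close>.
\<close>
definition free_gen :: "('a, 'b) ring_scheme \<Rightarrow> 's set \<Rightarrow> 's \<Rightarrow> 's \<Rightarrow> 'a" where
  "free_gen R S s = (\<lambda>x\<in>S. if x = s then \<one>\<^bsub>R\<^esub> else \<zero>\<^bsub>R\<^esub>)"

text \<open>
  \<open>M\<close> is generated by the finite family \<open>(g s)\<close>, \<open>s \<in> S\<close>, with defining relations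
  \<open>Rel\<close>: the homomorphism from the free module on \<open>S\<close> to \<open>M\<close> with \<open>s \<mapsto> g s\<close> is onto,
  and its kernel is the submodule generated by \<open>Rel\<close>.
\<close>
definition module_presentation ::
  "('a, 'b) ring_scheme \<Rightarrow> ('a, 'm, 'c) module_scheme \<Rightarrow> 's set \<Rightarrow> ('s \<Rightarrow> 'm) \<Rightarrow> ('s \<Rightarrow> 'a) set \<Rightarrow> bool"
where
  "module_presentation R M S g Rel \<longleftrightarrow>
     (let F = ring.func_space R S in
        finite S \<and> g \<in> S \<rightarrow> carrier M \<and> Rel \<subseteq> carrier F \<and>
        (\<lambda>c. \<Oplus>\<^bsub>M\<^esub>s\<in>S. c s \<odot>\<^bsub>M\<^esub> g s) ` carrier F = carrier M \<and>
        {c \<in> carrier F. (\<Oplus>\<^bsub>M\<^esub>s\<in>S. c s \<odot>\<^bsub>M\<^esub> g s) = \<zero>\<^bsub>M\<^esub>} = module.span R F Rel)"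


section \<open>Affine algebras and their Jacobi matrices\<close>

text \<open>
  The monomial \<open>x\<^sub>1^t\<^sub>1 \<dots> x\<^sub>n^t\<^sub>n\<close> is the finitely supported function \<open>t\<close>, and a polynomial
  is a finitely supported function from monomials to coefficients.
\<close>
type_synonym 'k mpol = "(nat \<Rightarrow>\<^sub>0 nat) \<Rightarrow>\<^sub>0 'k"

definition poly_ring_n :: "nat \<Rightarrow> 'k::field mpol ring" where
  "poly_ring_n n = class_ring\<lparr>carrier := {p. \<forall>t\<in>Poly_Mapping.keys p. Poly_Mapping.keys t \<subseteq> {1..n}}\<rparr>"

definition mpol_const :: "'k::field \<Rightarrow> 'k mpol" where
  "mpol_const c = Poly_Mapping.single 0 c"

definition mpol_diff :: "nat \<Rightarrow> 'k::field mpol \<Rightarrow> 'k mpol" where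
  "mpol_diff j p = (\<Sum>t\<in>Poly_Mapping.keys p.
     Poly_Mapping.single (t - Poly_Mapping.single j 1)
       (of_nat (Poly_Mapping.lookup t j) * Poly_Mapping.lookup p t))"

text \<open>
  From here on, \<open>n\<close> is the number of variables and \<open>f 1, \<dots>, f m\<close> are the generators of
  the ideal.
\<close>
definition gen_ideal :: "nat \<Rightarrow> nat \<Rightarrow> (nat \<Rightarrow> 'k::field mpol) \<Rightarrow> 'k mpol set" where
  "gen_ideal n m f = Idl\<^bsub>poly_ring_n n\<^esub> (f ` {1..m})"

definition aff_alg :: "nat \<Rightarrow> nat \<Rightarrow> (nat \<Rightarrow> 'k::field mpol) \<Rightarrow> 'k mpol set ring" where
  "aff_alg n m f = poly_ring_n n Quot gen_ideal n m f"

definition residue_class :: "nat \<Rightarrow> nat \<Rightarrow> (nat \<Rightarrow> 'k::field mpol) \<Rightarrow> 'k mpol \<Rightarrow> 'k mpol set" where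
  "residue_class n m f p = gen_ideal n m f +>\<^bsub>poly_ring_n n\<^esub> p"

definition jacobi :: "nat \<Rightarrow> nat \<Rightarrow> (nat \<Rightarrow> 'k::field mpol) \<Rightarrow> nat \<Rightarrow> nat \<Rightarrow> 'k mpol set" where
  "jacobi n m f i j = residue_class n m f (mpol_diff j (f i))"

text \<open>
  The rank of the Jacobi matrix over the field of fractions \<open>Q\<close> of the algebra: the dimension
  of the subspace of \<open>Q^n\<close> that is spanned by the rows.
\<close>
definition jacobi_rank :: "nat \<Rightarrow> nat \<Rightarrow> (nat \<Rightarrow> 'k::field mpol) \<Rightarrow> nat" where
  "jacobi_rank n m f =
     (let A = aff_alg n m f;
          Q = frac_field A;
          V = ring.func_space Q {1..n};
          rows = (\<lambda>i. \<lambda>j\<in>{1..n}. frac_class A (carrier A - {\<zero>\<^bsub>A\<^esub>}) (jacobi n m f i j) \<one>\<^bsub>A\<^esub>) ` {1..m}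
      in vectorspace.dim Q (V\<lparr>carrier := module.span Q V rows\<rparr>))"

text \<open>Index tuples are lists; their entries are numbered from \<open>0\<close>.\<close>

definition omit :: "nat \<Rightarrow> 'a list \<Rightarrow> 'a list" where
  "omit k xs = take k xs @ drop (Suc k) xs"

definition minor :: "nat \<Rightarrow> nat \<Rightarrow> (nat \<Rightarrow> 'k::field mpol) \<Rightarrow> nat list \<Rightarrow> nat list \<Rightarrow> 'k mpol set" where
  "minor n m f is js =
     ring_det (aff_alg n m f) (length is) (\<lambda>\<nu> \<mu>. jacobi n m f (is ! \<nu>) (js ! \<mu>))"

definition nonsing_rows :: "nat \<Rightarrow> nat \<Rightarrow> (nat \<Rightarrow> 'k::field mpol) \<Rightarrow> nat \<Rightarrow> nat list set" where
  "nonsing_rows n m f r = {is. length is = r \<and> sorted_wrt (<) is \<and> set is \<subseteq> {1..m} \<and>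
     (\<exists>js. length js = r \<and> set js \<subseteq> {1..n} \<and> minor n m f is js \<noteq> \<zero>\<^bsub>aff_alg n m f\<^esub>)}"

definition nonsing_cols :: "nat \<Rightarrow> nat \<Rightarrow> (nat \<Rightarrow> 'k::field mpol) \<Rightarrow> nat \<Rightarrow> nat list set" where
  "nonsing_cols n m f r = {js. length js = r \<and> sorted_wrt (<) js \<and> set js \<subseteq> {1..n} \<and>
     (\<exists>is. length is = r \<and> set is \<subseteq> {1..m} \<and> minor n m f is js \<noteq> \<zero>\<^bsub>aff_alg n m f\<^esub>)}"

text \<open>For \<open>r\<close> the rank, this is the set \<open>\<^bold>J\<close> with index \<open>r + 1\<close>.\<close>
definition ext_cols :: "nat \<Rightarrow> nat \<Rightarrow> (nat \<Rightarrow> 'k::field mpol) \<Rightarrow> nat \<Rightarrow> nat list set" where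
  "ext_cols n m f r = {js. length js = r + 1 \<and> sorted_wrt (<) js \<and> set js \<subseteq> {1..n} \<and>
     (\<exists>k<r + 1. omit k js \<in> nonsing_cols n m f r)}"

text \<open>
  The map \<open>\<partial>\<^sub>i\<^sub>,\<^sub>j\<close> that the operator \<open>\<Sum>k. (-1)^(r+1+k) \<Delta>(i; j\<^sub>1, \<dots>, omit j\<^sub>k, \<dots>) \<partial>/\<partial>x\<^bsub>j\<^sub>k\<^esub>\<close> induces on residue
  classes.  As \<open>k\<close> starts from \<open>0\<close> here, the exponent \<open>r + 1 + k\<close> becomes \<open>r + k\<close> (up to
  an even number); the same holds below.
\<close>
definition jacobi_derivation ::
  "nat \<Rightarrow> nat \<Rightarrow> (nat \<Rightarrow> 'k::field mpol) \<Rightarrow> nat list \<Rightarrow> nat list \<Rightarrow> 'k mpol set \<Rightarrow> 'k mpol set" where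
  "jacobi_derivation n m f is js =
     (let A = aff_alg n m f; r = length is in
      THE d. d \<in> carrier A \<rightarrow>\<^sub>E carrier A \<and>
        (\<forall>p\<in>carrier (poly_ring_n n). d (residue_class n m f p) =
           (\<Oplus>\<^bsub>A\<^esub>k\<in>{0..r}. ring_sign A (r + k) \<otimes>\<^bsub>A\<^esub> minor n m f is (omit k js) \<otimes>\<^bsub>A\<^esub>
              residue_class n m f (mpol_diff (js ! k) p))))"

definition jacobi_index :: "nat \<Rightarrow> nat \<Rightarrow> (nat \<Rightarrow> 'k::field mpol) \<Rightarrow> nat \<Rightarrow> (nat list \<times> nat list) set" where
  "jacobi_index n m f r = nonsing_rows n m f r \<times> ext_cols n m f r"

text \<open>
  The element of the free module that is denoted by \<open>\<partial>\<^sub>i\<^sub>,\<^sub>j\<close> when the tuple \<open>j\<close> of distinct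
  indices is not necessarily increasing: the generator for the sorted tuple, multiplied by the sign
  of the permutation that sorts \<open>j\<close>.
\<close>
definition jacobi_symbol ::
  "nat \<Rightarrow> nat \<Rightarrow> (nat \<Rightarrow> 'k::field mpol) \<Rightarrow> nat \<Rightarrow> nat list \<Rightarrow> nat list \<Rightarrow> nat list \<times> nat list \<Rightarrow> 'k mpol set" where
  "jacobi_symbol n m f r is js =
     (let A = aff_alg n m f;
          F = ring.func_space A (jacobi_index n m f r);
          e = free_gen A (jacobi_index n m f r) (is, sort js);
          \<sigma> = (THE \<sigma>. \<sigma> permutes {..<length js} \<and> permute_list \<sigma> js = sort js)
      in if evenperm \<sigma> then e else \<ominus>\<^bsub>F\<^esub> e)"

text \<open>
  Left side minus right side of the relation
  \<open>\<Delta>(i,j) \<partial>\<^sub>i\<^sub>'\<^sub>,\<^sub>j\<^sub>' = \<Sum>\<nu>. (-1)^(r+1+\<nu>) \<Delta>(i'; j'\<^sub>1, \<dots>, omit j'\<^sub>\<nu>, \<dots>) \<partial>\<^sub>i\<^sub>;\<^sub>j\<^sub>,\<^sub>j\<^sub>'\<^sub>\<nu>\<close>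
  with the sum over all \<open>\<nu>\<close> such that \<open>j'\<^sub>\<nu>\<close> does not occur in \<open>j\<close>.
\<close>
definition jacobi_relation ::
  "nat \<Rightarrow> nat \<Rightarrow> (nat \<Rightarrow> 'k::field mpol) \<Rightarrow> nat \<Rightarrow> nat list \<Rightarrow> nat list \<Rightarrow> nat list \<Rightarrow> nat list \<Rightarrow>
   nat list \<times> nat list \<Rightarrow> 'k mpol set" where
  "jacobi_relation n m f r is is' js js' =
     (let A = aff_alg n m f; F = ring.func_space A (jacobi_index n m f r) in
      minor n m f is js \<odot>\<^bsub>F\<^esub> jacobi_symbol n m f r is' js' \<ominus>\<^bsub>F\<^esub>
      (\<Oplus>\<^bsub>F\<^esub>\<nu>\<in>{\<nu>\<in>{0..r}. js' ! \<nu> \<notin> set js}.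
         (ring_sign A (r + \<nu>) \<otimes>\<^bsub>A\<^esub> minor n m f is' (omit \<nu> js')) \<odot>\<^bsub>F\<^esub>
           jacobi_symbol n m f r is (js @ [js' ! \<nu>])))"

definition Der :: "nat \<Rightarrow> nat \<Rightarrow> (nat \<Rightarrow> 'k::field mpol) \<Rightarrow> ('k mpol set, 'k mpol set \<Rightarrow> 'k mpol set) module" where
  "Der n m f = derivation_module (aff_alg n m f) (range (\<lambda>c. residue_class n m f (mpol_const c)))"

end

theory Submission
  imports Defs "HOL-Computational_Algebra.Polynomial"
begin

text \<open>
  The heart of the matter is that the \<open>r \<times> r\<close> minors of the Jacobi matrix generate the unit ideal of a
  regular \<open>A\<close>. For a prime \<open>P\<close> of the polynomial ring let \<open>\<rho>(P)\<close> be the rank of the gradients of the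
  elements of \<open>P\<close> over the residue field of \<open>P\<close>. If \<open>U\<close> is a set of variables with \<open>P \<inter> K[x\<^sub>U] = 0\<close>, then
  \<open>\<rho>(P) \<le> n - |U|\<close>, with equality for maximal \<open>U\<close> (characteristic zero), and \<open>U\<close> can be enlarged when \<open>P\<close>
  is replaced by a smaller prime; so \<open>\<rho>\<close> grows strictly along chains of primes, and the local ring of \<open>A\<close> at
  \<open>P\<close> has dimension at most \<open>\<rho>(P) - r\<close>. By regularity \<open>P\<close> is, locally, generated by \<open>I\<close> and at most \<open>\<rho>(P) - r\<close>
  further elements, so the gradients of \<open>f\<^sub>1, \<dots>, f\<^sub>m\<close> still have rank at least \<open>r\<close> modulo \<open>P\<close>.

  For a derivation \<open>d\<close>, the difference of \<open>\<Delta>(i,j) d\<close> and \<open>\<Sum>k. d(x\<^sub>k) \<partial>\<^sub>i\<^sub>;\<^sub>j\<^sub>,\<^sub>k\<close> (\<open>k\<close> not in \<open>j\<close>) is a derivation that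
  vanishes on all \<open>x\<^sub>l\<close> with \<open>l\<close> not in \<open>j\<close>, hence it is zero by Cramer's rule. This shows that the relations
  hold. It also shows that \<open>\<Delta>(i,j)\<close> moves every \<open>d\<close> into the span of the generators and, applied formally in the
  free module, moves every syzygy into the span of the relations; as the \<open>\<Delta>(i,j)\<close> generate the unit ideal, the
  generators and the relations suffice.
\<close>

section \<open>Polynomials and partial derivatives\<close>

text \<open>Residue fields are never formed. A prime ideal is a bare set of polynomials
  (\<open>prime_set\<close>), linear dependence over its residue field is a congruence with a
  multiplier outside the set (\<open>vspan\<close>), and ranks enter only through minors and numbers
  of spanning vectors. Independent sets of variables take the place of transcendence degrees, so
  only inequalities have to be proved: regularity supplies a chain of primes whose length is the
  number of generators, and the chain is turned into independent variables modulo \<open>I\<close>.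
  The field of fractions of \<open>A\<close> appears in one place, to translate
  \<open>jacobi_rank\<close> into this language.

  The module theory is lifted in the same way. An element of \<open>A\<close> is the class of a
  polynomial, a derivation is a family of polynomials indexed by variables, an element of the free
  module is a family indexed by symbols. Every identity then becomes a congruence modulo the prime
  set \<open>Iext\<close>, and it is computed with the sums and determinants of a type-class
  ring.\<close>

lemma finite_support_induct [case_names zero monomial]:
  fixes p :: "'k::field mpol"
  assumes "P 0" and "\<And>t c q. P q \<Longrightarrow> P (Poly_Mapping.single t c + q)"
  shows "P p"
proof (induction p rule: update_induct)
  case const
  show ?case by (rule assms(1))
next
  case (update g a b)
  have "Poly_Mapping.update a b g = Poly_Mapping.single a b + g"
    using update(1) by (intro poly_mapping_eqI)
      (auto simp: lookup_update lookup_add lookup_single when_def not_in_keys_iff_lookup_eq_zero)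
  with assms(2)[OF update(3)] show ?case by simp
qed

definition mpol_var :: "nat \<Rightarrow> 'k::field mpol" where
  "mpol_var i = Poly_Mapping.single (Poly_Mapping.single i 1) 1"

text \<open>A larger finite set of monomials only adds zero terms. With a common index set for
  \<open>p\<close> and \<open>q\<close>, additivity becomes termwise.\<close>

lemma mpol_diff_superset:
  assumes "finite T" "Poly_Mapping.keys p \<subseteq> T"
  shows "mpol_diff j p = (\<Sum>t\<in>T. Poly_Mapping.single (t - Poly_Mapping.single j 1)
           (of_nat (Poly_Mapping.lookup t j) * Poly_Mapping.lookup p t))"
  unfolding mpol_diff_def using assms
  by (intro sum.mono_neutral_left) (auto simp: in_keys_iff)

lemma mpol_diff_single:
  "mpol_diff j (Poly_Mapping.single t c) =
     Poly_Mapping.single (t - Poly_Mapping.single j 1) (of_nat (Poly_Mapping.lookup t j) * c)"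
  by (subst mpol_diff_superset[of "{t}"]) (auto split: if_splits)

lemma mpol_diff_0 [simp]: "mpol_diff j 0 = 0"
  by (simp add: mpol_diff_def)

lemma mpol_diff_add: "mpol_diff j (p + q) = mpol_diff j p + mpol_diff j q"
proof -
  let ?T = "Poly_Mapping.keys p \<union> Poly_Mapping.keys q"
  have "Poly_Mapping.keys (p + q) \<subseteq> ?T" by (rule Poly_Mapping.keys_add)
  then show ?thesis
    by (simp add: mpol_diff_superset[of ?T] lookup_add distrib_left single_add sum.distrib)
qed

text \<open>Exponents are subtracted with truncation at zero, so \<open>(t + u) - e\<close> is
  \<open>(t - e) + u\<close> only if \<open>j\<close> occurs in \<open>t\<close>. Otherwise the
  coefficient \<open>of_nat 0\<close> removes the term.\<close>

lemma mpol_diff_single_mult: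
  "mpol_diff j (Poly_Mapping.single t a * q) =
     mpol_diff j (Poly_Mapping.single t a) * q + Poly_Mapping.single t a * mpol_diff j q"
proof (induction q rule: finite_support_induct)
  case (monomial u b q)
  let ?e = "Poly_Mapping.single j (1::nat)"
  have *: "(t + u) - ?e = (t - ?e) + u" if "Poly_Mapping.lookup t j \<noteq> 0"
    using that by (intro poly_mapping_eqI) (auto simp: lookup_add lookup_minus lookup_single when_def)
  have **: "(t + u) - ?e = t + (u - ?e)" if "Poly_Mapping.lookup u j \<noteq> 0"
    using that by (intro poly_mapping_eqI) (auto simp: lookup_add lookup_minus lookup_single when_def)
  have "Poly_Mapping.single ((t + u) - ?e) (of_nat (Poly_Mapping.lookup t j) * (a * b)) =
        Poly_Mapping.single ((t - ?e) + u) (of_nat (Poly_Mapping.lookup t j) * a * b)"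
    by (cases "Poly_Mapping.lookup t j = 0") (simp_all add: * mult.assoc del: One_nat_def)
  moreover have "Poly_Mapping.single ((t + u) - ?e) (of_nat (Poly_Mapping.lookup u j) * (a * b)) =
        Poly_Mapping.single (t + (u - ?e)) (a * (of_nat (Poly_Mapping.lookup u j) * b))"
    by (cases "Poly_Mapping.lookup u j = 0") (simp_all add: ** mult.left_commute del: One_nat_def)
  ultimately have "Poly_Mapping.single ((t + u) - ?e)
          (of_nat (Poly_Mapping.lookup t j + Poly_Mapping.lookup u j) * (a * b)) =
        Poly_Mapping.single ((t - ?e) + u) (of_nat (Poly_Mapping.lookup t j) * a * b) +
        Poly_Mapping.single (t + (u - ?e)) (a * (of_nat (Poly_Mapping.lookup u j) * b))"
    by (simp only: of_nat_add distrib_right single_add)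
  with monomial show ?case
    by (simp add: distrib_left mpol_diff_add mpol_diff_single mult_single lookup_add)
qed simp

lemma mpol_diff_mult: "mpol_diff j (p * q) = mpol_diff j p * q + p * mpol_diff j q"
proof (induction p rule: finite_support_induct)
  case (monomial t c p)
  then show ?case
    by (simp only: distrib_right mpol_diff_add mpol_diff_single_mult) (simp add: algebra_simps)
qed simp

lemma mpol_diff_uminus: "mpol_diff j (- p) = - mpol_diff j p"
  using mpol_diff_add[of j p "- p"] by (simp add: eq_neg_iff_add_eq_0 add.commute)

lemma mpol_diff_diff: "mpol_diff j (p - q) = mpol_diff j p - mpol_diff j q"
  using mpol_diff_add[of j p "- q"] by (simp add: mpol_diff_uminus)

lemma mpol_diff_sum: "mpol_diff j (sum g A) = (\<Sum>a\<in>A. mpol_diff j (g a))"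
  by (induction A rule: infinite_finite_induct) (simp_all add: mpol_diff_add)

lemma mpol_diff_const [simp]: "mpol_diff j (mpol_const c) = 0"
  by (simp add: mpol_const_def mpol_diff_single)

lemma mpol_diff_var: "mpol_diff j (mpol_var i) = (if i = j then 1 else 0)"
  by (simp add: mpol_var_def mpol_diff_single lookup_single)

section \<open>Polynomials in a given set of variables, and one variable split off\<close>

definition mpol_in :: "nat set \<Rightarrow> 'k::field mpol set" where
  "mpol_in V = {p. \<forall>t\<in>Poly_Mapping.keys p. Poly_Mapping.keys t \<subseteq> V}"

lemma carrier_poly_ring_n: "carrier (poly_ring_n n) = mpol_in {1..n}"
  by (simp add: poly_ring_n_def mpol_in_def)

lemma mpol_in_0 [simp]: "0 \<in> mpol_in V"
  and mpol_in_1 [simp]: "1 \<in> mpol_in V"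
  and mpol_in_const [simp]: "mpol_const c \<in> mpol_in V"
  by (auto simp: mpol_in_def mpol_const_def)

lemma mpol_in_single: "Poly_Mapping.single t c \<in> mpol_in V \<longleftrightarrow> c = 0 \<or> Poly_Mapping.keys t \<subseteq> V"
  by (auto simp: mpol_in_def)

lemma mpol_in_var: "i \<in> V \<Longrightarrow> mpol_var i \<in> mpol_in V"
  by (simp add: mpol_var_def mpol_in_single)

lemma mpol_in_add: "p \<in> mpol_in V \<Longrightarrow> q \<in> mpol_in V \<Longrightarrow> p + q \<in> mpol_in V"
  using Poly_Mapping.keys_add[of p q] by (auto simp: mpol_in_def)

lemma mpol_in_uminus: "p \<in> mpol_in V \<Longrightarrow> - p \<in> mpol_in V"
  by (auto simp: mpol_in_def in_keys_iff)

lemma mpol_in_diff: "p \<in> mpol_in V \<Longrightarrow> q \<in> mpol_in V \<Longrightarrow> p - q \<in> mpol_in V"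
  using mpol_in_add[of p V "- q"] mpol_in_uminus[of q V] by simp

lemma mpol_in_mult:
  assumes "p \<in> mpol_in V" "q \<in> mpol_in V"
  shows "p * q \<in> mpol_in V"
proof -
  have "Poly_Mapping.keys t \<subseteq> V" if t: "t \<in> Poly_Mapping.keys (p * q)" for t
  proof -
    obtain a b where "t = a + b" "a \<in> Poly_Mapping.keys p" "b \<in> Poly_Mapping.keys q"
      using subsetD[OF keys_mult t] by blast
    then show ?thesis using assms Poly_Mapping.keys_add[of a b] by (fastforce simp: mpol_in_def)
  qed
  then show ?thesis by (simp add: mpol_in_def)
qed

lemma mpol_in_sum: "(\<And>a. a \<in> A \<Longrightarrow> g a \<in> mpol_in V) \<Longrightarrow> sum g A \<in> mpol_in V"
  by (induction A rule: infinite_finite_induct) (simp_all add: mpol_in_add)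

lemma mpol_in_power: "p \<in> mpol_in V \<Longrightarrow> p ^ k \<in> mpol_in V"
  by (induction k) (simp_all add: mpol_in_mult)

lemma mpol_in_mono: "V \<subseteq> W \<Longrightarrow> p \<in> mpol_in V \<Longrightarrow> p \<in> mpol_in W"
  by (auto simp: mpol_in_def)

lemma mpol_in_empty:
  assumes "p \<in> mpol_in {}"
  obtains c where "p = mpol_const c"
proof -
  have "p = mpol_const (Poly_Mapping.lookup p 0)"
    using assms by (intro poly_mapping_eqI)
      (auto simp: mpol_in_def mpol_const_def lookup_single when_def in_keys_iff keys_eq_empty)
  then show ?thesis using that by blast
qed

lemma mpol_in_diff_mpol: "p \<in> mpol_in V \<Longrightarrow> mpol_diff j p \<in> mpol_in V"
  unfolding mpol_diff_def
proof (rule mpol_in_sum)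
  fix t assume "p \<in> mpol_in V" "t \<in> Poly_Mapping.keys p"
  then have "Poly_Mapping.keys (t - Poly_Mapping.single j 1) \<subseteq> V"
    by (force simp: mpol_in_def in_keys_iff lookup_minus)
  then show "Poly_Mapping.single (t - Poly_Mapping.single j 1)
               (of_nat (Poly_Mapping.lookup t j) * Poly_Mapping.lookup p t) \<in> mpol_in V"
    by (simp add: mpol_in_single)
qed

lemma mpol_diff_notin: "p \<in> mpol_in V \<Longrightarrow> j \<notin> V \<Longrightarrow> mpol_diff j p = 0"
  unfolding mpol_diff_def
proof (rule sum.neutral, rule ballI)
  fix t assume "p \<in> mpol_in V" "j \<notin> V" "t \<in> Poly_Mapping.keys p"
  then have "j \<notin> Poly_Mapping.keys t" by (auto simp: mpol_in_def)
  then show "Poly_Mapping.single (t - Poly_Mapping.single j 1)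
               (of_nat (Poly_Mapping.lookup t j) * Poly_Mapping.lookup p t) = 0"
    by (simp add: in_keys_iff)
qed

text \<open>The variable \<open>i\<close> becomes the unknown of a univariate polynomial. The
  coefficients keep the full polynomial type and membership in \<open>mpol_in V\<close> is a side
  condition, so that degree, leading coefficient and formal derivative of \<open>poly\<close> are
  available over every subring.\<close>

lemma mpol_in_insert:
  assumes "p \<in> mpol_in (insert i V)"
  obtains q where "\<And>k. coeff q k \<in> mpol_in V" "p = poly q (mpol_var i)"
proof -
  have "\<exists>q. (\<forall>k. coeff q k \<in> mpol_in V) \<and> Poly_Mapping.single t c = poly q (mpol_var i)"
    if t: "Poly_Mapping.keys t \<subseteq> insert i V" for t and c :: 'a
  proof -
    \<comment> \<open>The monomial without its power of variable \<open>i\<close>; it becomes the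
      coefficient.\<close>
    define u where "u = Poly_Mapping.update i 0 t"
    have u: "Poly_Mapping.keys u \<subseteq> V" using t by (auto simp: u_def keys_update)
    have *: "mpol_var i ^ k = (Poly_Mapping.single (Poly_Mapping.single i k) 1 :: 'a mpol)" for k
      by (induction k) (simp_all add: mpol_var_def mult_single single_add [symmetric])
    have "t = u + Poly_Mapping.single i (Poly_Mapping.lookup t i)"
      by (intro poly_mapping_eqI) (auto simp: u_def lookup_add lookup_update lookup_single when_def)
    then have "Poly_Mapping.single t c =
        poly (monom (Poly_Mapping.single u c) (Poly_Mapping.lookup t i)) (mpol_var i)"
      by (simp add: poly_monom * mult_single)
    moreover have "coeff (monom (Poly_Mapping.single u c) (Poly_Mapping.lookup t i)) k \<in> mpol_in V" for k
      using u by (simp add: mpol_in_single)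
    ultimately show ?thesis by blast
  qed
  then have "\<forall>t. \<forall>c. \<exists>q. Poly_Mapping.keys t \<subseteq> insert i V \<longrightarrow>
      (\<forall>k. coeff q k \<in> mpol_in V) \<and> Poly_Mapping.single t (c :: 'a) = poly q (mpol_var i)"
    by blast
  then obtain Q where Q: "\<And>t c. Poly_Mapping.keys t \<subseteq> insert i V \<Longrightarrow>
      (\<forall>k. coeff (Q t c) k \<in> mpol_in V) \<and> Poly_Mapping.single t (c :: 'a) = poly (Q t c) (mpol_var i)"
    unfolding choice_iff by blast
  define q where "q = (\<Sum>t\<in>Poly_Mapping.keys p. Q t (Poly_Mapping.lookup p t))"
  have "p = (\<Sum>t\<in>Poly_Mapping.keys p. Poly_Mapping.single t (Poly_Mapping.lookup p t))"
    by (intro poly_mapping_eqI) (auto simp: lookup_sum lookup_single when_def in_keys_iff)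
  also have "\<dots> = poly q (mpol_var i)"
    unfolding q_def poly_sum using assms Q by (intro sum.cong) (auto simp: mpol_in_def)
  finally have "p = poly q (mpol_var i)" .
  moreover have "coeff q k \<in> mpol_in V" for k
    unfolding q_def coeff_sum
  proof (rule mpol_in_sum)
    fix t assume "t \<in> Poly_Mapping.keys p"
    then have "Poly_Mapping.keys t \<subseteq> insert i V" using assms by (auto simp: mpol_in_def)
    then show "coeff (Q t (Poly_Mapping.lookup p t)) k \<in> mpol_in V" using Q by blast
  qed
  ultimately show ?thesis using that by blast
qed

lemma poly_var_in:
  "(\<And>k. coeff q k \<in> mpol_in V) \<Longrightarrow> poly q (mpol_var i) \<in> mpol_in (insert i V)"
  unfolding poly_altdef
  by (intro mpol_in_sum mpol_in_mult mpol_in_power mpol_in_var) (auto intro: mpol_in_mono[of V])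

text \<open>The sum differentiates the coefficients, the last term the argument. Two cases matter
  later: if all coefficients of \<open>q\<close> lie in a prime set, so does the last term; if
  \<open>x\<close> is the variable \<open>j\<close> and the coefficients are free of it, only the
  formal derivative remains.\<close>

lemma mpol_diff_poly:
  "mpol_diff j (poly q x) = (\<Sum>k\<le>degree q. mpol_diff j (coeff q k) * x ^ k) + poly (pderiv q) x * mpol_diff j x"
proof (induction q rule: pCons_induct)
  case (pCons a q)
  have "mpol_diff j (poly (pCons a q) x) = mpol_diff j a + x * mpol_diff j (poly q x)
           + poly q x * mpol_diff j x"
    by (simp add: mpol_diff_add mpol_diff_mult algebra_simps)
  moreover have "(\<Sum>k\<le>degree (pCons a q). mpol_diff j (coeff (pCons a q) k) * x ^ k) =
       mpol_diff j a + x * (\<Sum>k\<le>degree q. mpol_diff j (coeff q k) * x ^ k)"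
    by (simp add: sum.atMost_Suc_shift sum_distrib_left mult_ac del: sum.atMost_Suc)
  ultimately show ?case
    by (simp only: pCons.IH pderiv_pCons poly_add poly_pCons) (simp add: ring_distribs mult_ac add_ac)
qed simp

text \<open>Substitution of zero for the variables outside \<open>V\<close>: a retraction onto
  \<open>mpol_in V\<close> that keeps or drops each monomial as a whole.\<close>

definition mpol_restrict :: "nat set \<Rightarrow> 'k::field mpol \<Rightarrow> 'k mpol" where
  "mpol_restrict V p = (\<Sum>t\<in>{t \<in> Poly_Mapping.keys p. Poly_Mapping.keys t \<subseteq> V}.
     Poly_Mapping.single t (Poly_Mapping.lookup p t))"

lemma lookup_mpol_restrict:
  "Poly_Mapping.lookup (mpol_restrict V p) t = (if Poly_Mapping.keys t \<subseteq> V then Poly_Mapping.lookup p t else 0)"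
  by (auto simp: mpol_restrict_def lookup_sum lookup_single when_def in_keys_iff)

lemma mpol_restrict_in [simp]: "mpol_restrict V p \<in> mpol_in V"
  unfolding mpol_in_def
proof (rule CollectI, rule ballI)
  fix t assume "t \<in> Poly_Mapping.keys (mpol_restrict V p)"
  then have "Poly_Mapping.lookup (mpol_restrict V p) t \<noteq> 0" by (simp add: in_keys_iff)
  then show "Poly_Mapping.keys t \<subseteq> V" by (simp add: lookup_mpol_restrict split: if_splits)
qed

lemma mpol_restrict_id: "p \<in> mpol_in V \<Longrightarrow> mpol_restrict V p = p"
  by (intro poly_mapping_eqI) (auto simp: lookup_mpol_restrict mpol_in_def in_keys_iff)

lemma mpol_restrict_add: "mpol_restrict V (p + q) = mpol_restrict V p + mpol_restrict V q"
  by (intro poly_mapping_eqI) (auto simp: lookup_mpol_restrict lookup_add)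

lemma mpol_restrict_single:
  "mpol_restrict V (Poly_Mapping.single t c) = (if Poly_Mapping.keys t \<subseteq> V then Poly_Mapping.single t c else 0)"
  by (intro poly_mapping_eqI) (auto simp: lookup_mpol_restrict lookup_single when_def)

lemma mpol_restrict_0 [simp]: "mpol_restrict V 0 = 0"
  by (intro poly_mapping_eqI) (auto simp: lookup_mpol_restrict)

lemma mpol_restrict_1 [simp]: "mpol_restrict V 1 = 1"
  by (rule mpol_restrict_id) simp

lemma keys_nat_add: "Poly_Mapping.keys (t + u) = Poly_Mapping.keys t \<union> Poly_Mapping.keys (u :: nat \<Rightarrow>\<^sub>0 nat)"
  by (auto simp: in_keys_iff lookup_add)

text \<open>Exponents are natural numbers and cannot cancel, so a product of two monomials lives on
  \<open>V\<close> exactly when both factors do.\<close>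

lemma mpol_restrict_mult: "mpol_restrict V (p * q) = mpol_restrict V p * mpol_restrict V q"
proof (induction p rule: finite_support_induct)
  case (monomial t c p)
  have "mpol_restrict V (Poly_Mapping.single t c * q) =
        mpol_restrict V (Poly_Mapping.single t c) * mpol_restrict V q"
    by (induction q rule: finite_support_induct)
      (simp_all add: distrib_left mpol_restrict_add mpol_restrict_single mult_single keys_nat_add)
  with monomial show ?case by (simp add: distrib_right mpol_restrict_add)
qed simp

section \<open>Linear algebra modulo a prime ideal\<close>

text \<open>A prime ideal of a whole type, without a carrier. Congruence modulo \<open>P\<close>
  replaces equality in the residue ring, and elements outside \<open>P\<close> serve as
  denominators.\<close>

locale prime_set =
  fixes P :: "'a::comm_ring_1 set"
  assumes zero: "0 \<in> P"
    and add: "a \<in> P \<Longrightarrow> b \<in> P \<Longrightarrow> a + b \<in> P"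
    and mult: "b \<in> P \<Longrightarrow> a * b \<in> P"
    and one: "1 \<notin> P"
    and prime: "a * b \<in> P \<Longrightarrow> a \<in> P \<or> b \<in> P"
begin

lemma mult_right: "a \<in> P \<Longrightarrow> a * b \<in> P"
  using mult[of a b] by (simp add: mult.commute)

lemma uminus: "a \<in> P \<Longrightarrow> - a \<in> P"
  using mult[of a "- 1"] by simp

lemma diff: "a \<in> P \<Longrightarrow> b \<in> P \<Longrightarrow> a - b \<in> P"
  using add[of a "- b"] uminus[of b] by simp

lemma sum: "(\<And>x. x \<in> A \<Longrightarrow> g x \<in> P) \<Longrightarrow> sum g A \<in> P"
  by (induction A rule: infinite_finite_induct) (simp_all add: zero add)

lemma prod_notin: "(\<And>x. x \<in> A \<Longrightarrow> g x \<notin> P) \<Longrightarrow> prod g A \<notin> P"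
  by (induction A rule: infinite_finite_induct) (use prime one in auto)

lemma cong_mult:
  assumes "a - b \<in> P" "c - d \<in> P"
  shows "a * c - b * d \<in> P"
proof -
  have "a * c - b * d = (a - b) * c + b * (c - d)" by (simp add: algebra_simps)
  then show ?thesis using assms add mult mult_right by simp
qed

lemma cong_mem: "a - b \<in> P \<Longrightarrow> a \<in> P \<longleftrightarrow> b \<in> P"
  using add[of "a - b" b] diff[of a "a - b"] by auto

lemma cong_sum: "(\<And>x. x \<in> A \<Longrightarrow> g x - h x \<in> P) \<Longrightarrow> sum g A - sum h A \<in> P"
  using sum[of A "\<lambda>x. g x - h x"] by (simp add: sum_subtractf)

lemma cong_prod: "(\<And>x. x \<in> A \<Longrightarrow> g x - h x \<in> P) \<Longrightarrow> prod g A - prod h A \<in> P"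
  by (induction A rule: infinite_finite_induct) (simp_all add: zero cong_mult)

lemma cong_det:
  assumes "\<And>i j. i < k \<Longrightarrow> j < k \<Longrightarrow> A i j - B i j \<in> P"
  shows "det (mat k k (\<lambda>(i, j). A i j)) - det (mat k k (\<lambda>(i, j). B i j)) \<in> P"
proof -
  have lt: "p i < k" if "p permutes {0..<k}" "i < k" for p i
    using permutes_in_image[OF that(1), of i] that(2) by simp
  have "(\<Sum>p\<in>{p. p permutes {0..<k}}. signof p * (\<Prod>i = 0..<k. A i (p i)))
      - (\<Sum>p\<in>{p. p permutes {0..<k}}. signof p * (\<Prod>i = 0..<k. B i (p i))) \<in> P"
    using assms by (intro cong_sum cong_mult cong_prod)
      (auto simp: zero lt)
  moreover have "det (mat k k (\<lambda>(i, j). C i j)) =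
      (\<Sum>p\<in>{p. p permutes {0..<k}}. signof p * (\<Prod>i = 0..<k. C i (p i)))" for C :: "nat \<Rightarrow> nat \<Rightarrow> 'a"
    by (subst det_def'[of _ k]) (auto intro!: sum.cong prod.cong simp: lt)
  ultimately show ?thesis by simp
qed

text \<open>
  Over the field of fractions of the residue ring of \<open>P\<close>, the vector \<open>(v j)\<close>, \<open>j \<in> N\<close>, is a
  linear combination of \<open>w 0, \<dots>, w (s - 1)\<close>.
\<close>
definition vspan :: "'j set \<Rightarrow> (nat \<Rightarrow> 'j \<Rightarrow> 'a) \<Rightarrow> nat \<Rightarrow> ('j \<Rightarrow> 'a) \<Rightarrow> bool" where
  "vspan N w s v \<longleftrightarrow> (\<exists>a c. a \<notin> P \<and> (\<forall>j\<in>N. a * v j - (\<Sum>i<s. c i * w i j) \<in> P))"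

lemma vspanI: "a \<notin> P \<Longrightarrow> (\<And>j. j \<in> N \<Longrightarrow> a * v j - (\<Sum>i<s. c i * w i j) \<in> P) \<Longrightarrow> vspan N w s v"
  unfolding vspan_def by blast

lemma vspan_zero: "(\<And>j. j \<in> N \<Longrightarrow> v j \<in> P) \<Longrightarrow> vspan N w s v"
  by (rule vspanI[where a = 1 and c = "\<lambda>_. 0"]) (simp_all add: one)

lemma vspan_base: "k < s \<Longrightarrow> vspan N w s (w k)"
  by (rule vspanI[where a = 1 and c = "\<lambda>i. if i = k then 1 else 0"])
    (simp_all add: one zero if_distrib[of "\<lambda>x. x * _"] cong: if_cong)

lemma vspan_add:
  assumes "vspan N w s u" "vspan N w s v"
  shows "vspan N w s (\<lambda>j. u j + v j)"
proof -
  obtain a c where a: "a \<notin> P" "\<And>j. j \<in> N \<Longrightarrow> a * u j - (\<Sum>i<s. c i * w i j) \<in> P"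
    using assms(1) unfolding vspan_def by blast
  obtain b d where b: "b \<notin> P" "\<And>j. j \<in> N \<Longrightarrow> b * v j - (\<Sum>i<s. d i * w i j) \<in> P"
    using assms(2) unfolding vspan_def by blast
  show ?thesis
  proof (rule vspanI)
    show "a * b \<notin> P" using a(1) b(1) prime by blast
    fix j assume "j \<in> N"
    then have "b * (a * u j - (\<Sum>i<s. c i * w i j)) + a * (b * v j - (\<Sum>i<s. d i * w i j)) \<in> P"
      using a(2) b(2) add mult by blast
    then show "a * b * (u j + v j) - (\<Sum>i<s. (b * c i + a * d i) * w i j) \<in> P"
      by (simp add: algebra_simps sum.distrib sum_distrib_left)
  qed
qed

lemma vspan_smult:
  assumes "vspan N w s v"
  shows "vspan N w s (\<lambda>j. b * v j)"
proof -
  obtain a c where a: "a \<notin> P" "\<And>j. j \<in> N \<Longrightarrow> a * v j - (\<Sum>i<s. c i * w i j) \<in> P"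
    using assms unfolding vspan_def by blast
  show ?thesis
  proof (rule vspanI[OF a(1)])
    fix j assume "j \<in> N"
    then have "b * (a * v j - (\<Sum>i<s. c i * w i j)) \<in> P" using a(2) mult by blast
    then show "a * (b * v j) - (\<Sum>i<s. (b * c i) * w i j) \<in> P"
      by (simp add: algebra_simps sum_distrib_left)
  qed
qed

lemma vspan_cong:
  assumes "vspan N w s u" "\<And>j. j \<in> N \<Longrightarrow> u j - v j \<in> P"
  shows "vspan N w s v"
proof -
  obtain a c where a: "a \<notin> P" "\<And>j. j \<in> N \<Longrightarrow> a * u j - (\<Sum>i<s. c i * w i j) \<in> P"
    using assms unfolding vspan_def by blast
  show ?thesis
  proof (rule vspanI[OF a(1)])
    fix j assume "j \<in> N"
    then have "(a * u j - (\<Sum>i<s. c i * w i j)) - a * (u j - v j) \<in> P"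
      using a(2) mult diff assms(2) by blast
    then show "a * v j - (\<Sum>i<s. c i * w i j) \<in> P" by (simp add: algebra_simps)
  qed
qed

lemma vspan_sum:
  "(\<And>x. x \<in> A \<Longrightarrow> vspan N w s (v x)) \<Longrightarrow> vspan N w s (\<lambda>j. \<Sum>x\<in>A. v x j)"
  by (induction A rule: infinite_finite_induct) (auto intro: vspan_zero vspan_add simp: zero)

lemma vspan_cancel:
  assumes "b \<notin> P" "vspan N w s (\<lambda>j. b * v j)"
  shows "vspan N w s v"
proof -
  obtain a c where a: "a \<notin> P" "\<And>j. j \<in> N \<Longrightarrow> a * (b * v j) - (\<Sum>i<s. c i * w i j) \<in> P"
    using assms unfolding vspan_def by blast
  show ?thesis
    by (rule vspanI[of "a * b"]) (use a assms(1) prime in \<open>auto simp: mult.assoc\<close>)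
qed

lemma vspan_trans:
  assumes "vspan N w s v" "\<And>i. i < s \<Longrightarrow> vspan N w' s' (w i)"
  shows "vspan N w' s' v"
proof -
  obtain a c where a: "a \<notin> P" "\<And>j. j \<in> N \<Longrightarrow> a * v j - (\<Sum>i<s. c i * w i j) \<in> P"
    using assms unfolding vspan_def by blast
  have "vspan N w' s' (\<lambda>j. \<Sum>i<s. c i * w i j)"
    by (intro vspan_sum vspan_smult assms(2)) simp
  then have "vspan N w' s' (\<lambda>j. a * v j)"
    by (rule vspan_cong) (use a(2) uminus in force)
  then show ?thesis using a(1) vspan_cancel by blast
qed

text \<open>More vectors than spanning vectors are dependent. After multiplication by their
  denominators, the rows are congruent to those of \<open>C * W\<close>, where the coefficient
  matrix \<open>C\<close> has been made square by a zero column and so has determinant zero. The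
  denominators leave the determinant as a factor outside \<open>P\<close> and are cancelled by
  primality.\<close>

lemma vspan_minor:
  assumes v: "\<And>i. i \<le> s \<Longrightarrow> vspan N w s (v i)" and js: "\<And>j. j \<le> s \<Longrightarrow> js j \<in> N"
  shows "det (mat (Suc s) (Suc s) (\<lambda>(i, j). v i (js j))) \<in> P"
proof -
  have "\<forall>i\<in>{..s}. \<exists>ac. fst ac \<notin> P \<and> (\<forall>j\<in>N. fst ac * v i j - (\<Sum>k<s. snd ac k * w k j) \<in> P)"
    using v unfolding vspan_def by fastforce
  then obtain ac where ac: "\<And>i. i \<le> s \<Longrightarrow> fst (ac i) \<notin> P"
      "\<And>i j. i \<le> s \<Longrightarrow> j \<in> N \<Longrightarrow> fst (ac i) * v i j - (\<Sum>k<s. snd (ac i) k * w k j) \<in> P"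
    by (metis atMost_iff)
  define a where "a i = fst (ac i)" for i
  define C where "C = mat (Suc s) (Suc s) (\<lambda>(i, k). if k < s then snd (ac i) k else 0)"
  define W where "W = mat (Suc s) (Suc s) (\<lambda>(k, j). w k (js j))"
  define M where "M = mat (Suc s) (Suc s) (\<lambda>(i, j). a i * v i (js j))"
  have "C * W = mat (Suc s) (Suc s) (\<lambda>(i, j). \<Sum>k<s. snd (ac i) k * w k (js j))"
    by (rule eq_matI) (simp_all add: C_def W_def scalar_prod_def lessThan_atLeast0)
  moreover have "det (C * W) = det C * det W"
    by (rule det_mult[of _ "Suc s"]) (simp_all add: C_def W_def)
  moreover have "det C = 0"
    by (subst laplace_expansion_column[of _ "Suc s" s]) (simp_all add: C_def)
  moreover have "det M - det (mat (Suc s) (Suc s) (\<lambda>(i, j). \<Sum>k<s. snd (ac i) k * w k (js j))) \<in> P"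
    unfolding M_def by (rule cong_det) (use ac(2) js in \<open>simp add: a_def less_Suc_eq_le\<close>)
  ultimately have "det M \<in> P" by simp
  moreover have "det M = prod a {0..<Suc s} * det (mat (Suc s) (Suc s) (\<lambda>(i, j). v i (js j)))"
  proof -
    have *: "mat\<^sub>r (Suc s) (Suc s) (\<lambda>i. vec (Suc s) (g i)) = mat (Suc s) (Suc s) (\<lambda>(i, j). g i j)" for g :: "nat \<Rightarrow> nat \<Rightarrow> 'a"
      by (rule eq_matI) auto
    have "mat\<^sub>r (Suc s) (Suc s) (\<lambda>i. a i \<cdot>\<^sub>v vec (Suc s) (\<lambda>j. v i (js j))) = M"
      unfolding M_def by (rule eq_matI) auto
    with det_rows_mul[of "\<lambda>i. vec (Suc s) (\<lambda>j. v i (js j))" "Suc s" a] show ?thesis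
      by (simp add: *)
  qed
  moreover have "prod a {0..<Suc s} \<notin> P"
    by (rule prod_notin) (use ac(1) in \<open>auto simp: a_def\<close>)
  ultimately show ?thesis using prime by metis
qed

text \<open>Expand the bordered determinant along its last column. The cofactors depend on the
  columns \<open>js\<close> only, so one family of coefficients works for every \<open>j\<close>;
  the coefficient of \<open>v\<close> is the given minor, an admissible denominator.\<close>

lemma minor_vspan:
  assumes minor: "det (mat s s (\<lambda>(i, j). w i (js j))) \<notin> P"
    and vanish: "\<And>j. j \<in> N \<Longrightarrow> det (mat (Suc s) (Suc s)
      (\<lambda>(i, k). (if i < s then w i else v) (if k < s then js k else j))) \<in> P"
  shows "vspan N w s v"
proof -
  define M where "M j = mat (Suc s) (Suc s)
    (\<lambda>(i, k). (if i < s then w i else v) (if k < s then js k else j))" for j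
  \<comment> \<open>The cofactor of row \<open>i\<close> in the last column, written without
    \<open>j\<close>. Deleting row \<open>i\<close> renumbers the rows by
    \<open>insert_index i\<close>.\<close>
  define C where "C i = (-1) ^ (i + s) * det (mat s s (\<lambda>(l, k).
     (if insert_index i l < s then w (insert_index i l) else v) (js k)))" for i
  have del: "cofactor (M j) i s = C i" if "i \<le> s" for i j
  proof -
    have "mat_delete (M j) i s = mat s s (\<lambda>(l, k). (if insert_index i l < s then w (insert_index i l) else v) (js k))"
    proof (rule eq_matI)
      fix l k assume "l < dim_row (mat s s (\<lambda>(l, k). (if insert_index i l < s then w (insert_index i l) else v) (js k)))"
        "k < dim_col (mat s s (\<lambda>(l, k). (if insert_index i l < s then w (insert_index i l) else v) (js k)))"
      then have lk: "l < s" "k < s" by auto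
      have "mat_delete (M j) i s $$ (l, k) = M j $$ (insert_index i l, insert_index s k)"
        using that lk by (subst mat_delete_index[of "M j" s i s l k]) (auto simp: M_def)
      also have "\<dots> = (if insert_index i l < s then w (insert_index i l) else v) (js k)"
        using that lk by (auto simp: M_def insert_index_def)
      finally show "mat_delete (M j) i s $$ (l, k) = mat s s (\<lambda>(l, k). (if insert_index i l < s then w (insert_index i l) else v) (js k)) $$ (l, k)"
        using lk by simp
    qed (simp_all add: M_def)
    then show ?thesis by (simp add: cofactor_def C_def)
  qed
  have Cs: "C s = det (mat s s (\<lambda>(i, j). w i (js j)))"
  proof -
    have "mat s s (\<lambda>(l, k). (if insert_index s l < s then w (insert_index s l) else v) (js k)) =
        mat s s (\<lambda>(i, j). w i (js j))"
      by (rule eq_matI) (simp_all add: insert_index_def)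
    then show ?thesis by (simp add: C_def)
  qed
  show ?thesis
  proof (rule vspanI)
    show "C s \<notin> P" using minor Cs by simp
    fix j assume "j \<in> N"
    have "det (M j) = (\<Sum>i<Suc s. M j $$ (i, s) * cofactor (M j) i s)"
      by (rule laplace_expansion_column) (simp_all add: M_def)
    also have "\<dots> = (\<Sum>i<Suc s. (if i < s then w i j else v j) * C i)"
    proof (intro sum.cong refl)
      fix i assume "i \<in> {..<Suc s}"
      moreover from this have "M j $$ (i, s) = (if i < s then w i j else v j)" by (simp add: M_def)
      ultimately show "M j $$ (i, s) * cofactor (M j) i s = (if i < s then w i j else v j) * C i"
        by (simp add: del)
    qed
    also have "\<dots> = C s * v j - (\<Sum>i<s. (- C i) * w i j)"
      by (simp add: sum_negf mult.commute)
    finally have "det (M j) = C s * v j - (\<Sum>i<s. (- C i) * w i j)" .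
    moreover have "det (M j) \<in> P" using vanish[OF \<open>j \<in> N\<close>] by (simp only: M_def)
    ultimately show "C s * v j - (\<Sum>i<s. (- C i) * w i j) \<in> P" by (simp only:)
  qed
qed

text \<open>Some minor of size \<open>s\<close> does not vanish modulo \<open>P\<close> but all
  those of size \<open>s + 1\<close> do, in particular those that border it by any \<open>v\<close>
  in \<open>H\<close> and any column. The least size with vanishing minors is positive because the
  empty determinant is 1.\<close>

lemma maximal_minor_vspan:
  assumes vanish: "\<And>v js. (\<And>i. i < t \<Longrightarrow> v i \<in> H) \<Longrightarrow> (\<And>j. j < t \<Longrightarrow> js j \<in> N) \<Longrightarrow>
      det (mat t t (\<lambda>(i, j). v i (js j))) \<in> P"
  obtains s w js where "s < t" "\<And>i. i < s \<Longrightarrow> w i \<in> H" "\<And>j. j < s \<Longrightarrow> js j \<in> N"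
    "det (mat s s (\<lambda>(i, j). w i (js j))) \<notin> P" "\<And>v. v \<in> H \<Longrightarrow> vspan N w s v"
proof -
  define V where "V t \<longleftrightarrow> (\<forall>v js. (\<forall>i<t. v i \<in> H) \<longrightarrow> (\<forall>j<t. js j \<in> N) \<longrightarrow>
      det (mat t t (\<lambda>(i, j). v i (js j))) \<in> P)" for t
  define u where "u = (LEAST u. V u)"
  have Vt: "V t" using vanish by (simp add: V_def)
  have Vu: "V u" and ut: "u \<le> t" unfolding u_def by (rule LeastI[of V, OF Vt], rule Least_le[of V, OF Vt])
  have "\<not> V 0" by (simp add: V_def one)
  then obtain s where s: "u = Suc s" using Vu by (cases u) auto
  have "\<not> V s" using not_less_Least[of s V] s by (simp add: u_def)
  then obtain w js where w: "\<And>i. i < s \<Longrightarrow> w i \<in> H" "\<And>j. j < s \<Longrightarrow> js j \<in> N"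
      "det (mat s s (\<lambda>(i, j). w i (js j))) \<notin> P"
    unfolding V_def by blast
  have "vspan N w s v" if "v \<in> H" for v
  proof (rule minor_vspan[of s w js])
    show "det (mat s s (\<lambda>(i, j). w i (js j))) \<notin> P" by (rule w(3))
  next
    fix j assume "j \<in> N"
    then show "det (mat (Suc s) (Suc s)
      (\<lambda>(i, k). (if i < s then w i else v) (if k < s then js k else j))) \<in> P"
      using Vu[unfolded s V_def, rule_format, of "\<lambda>i. if i < s then w i else v" "\<lambda>k. if k < s then js k else j"]
        w that by simp
  qed
  moreover have "s < t" using ut s by simp
  ultimately show ?thesis using that w by blast
qed

end

section \<open>Algebraic independence and gradients\<close>

text \<open>Coefficients cannot be divided, so the leading terms are made equal by cross
  multiplication. With \<open>0 < degree q\<close> the degree drops strictly even if the result is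
  zero, which has degree 0.\<close>

lemma pseudo_reduce:
  fixes p q :: "'k::field mpol poly"
  defines "r \<equiv> Polynomial.smult (lead_coeff p) q - monom (lead_coeff q) (degree q - degree p) * p"
  assumes "0 < degree q" "degree p \<le> degree q"
    and p: "\<And>k. coeff p k \<in> mpol_in V" and q: "\<And>k. coeff q k \<in> mpol_in V"
  shows "degree r < degree q" "coeff r k \<in> mpol_in V"
    "poly r x = lead_coeff p * poly q x - lead_coeff q * x ^ (degree q - degree p) * poly p x"
proof -
  let ?d = "degree q - degree p"
  have "degree (monom (lead_coeff q) ?d * p) \<le> ?d + degree p"
    by (rule order.trans[OF degree_mult_le]) (simp add: degree_monom_le)
  then have "degree r \<le> degree q"
    unfolding r_def using assms(3) by (intro degree_diff_le order.trans[OF degree_smult_le]) auto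
  moreover have "coeff r (degree q) = 0"
    using assms(3) mult.commute[of "lead_coeff p" "lead_coeff q"] by (simp add: r_def coeff_monom_mult)
  ultimately show "degree r < degree q"
    using assms(2) by (metis degree_0 leading_coeff_0_iff le_neq_implies_less)
  show "coeff r k \<in> mpol_in V"
    using p q by (simp add: r_def coeff_monom_mult mpol_in_diff mpol_in_mult)
  show "poly r x = lead_coeff p * poly q x - lead_coeff q * x ^ ?d * poly p x"
    by (simp add: r_def poly_monom)
qed

text \<open>The case \<open>t = 0\<close> is set apart because zero has degree 0 and the bound would
  fail for \<open>degree q < degree s\<close>. The bound later keeps the degree of a quotient below
  that of the dividend.\<close>

lemma pseudo_division:
  fixes s q :: "'k::field mpol poly"
  assumes s: "0 < degree s" "\<And>k. coeff s k \<in> mpol_in V" and q: "\<And>k. coeff q k \<in> mpol_in V"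
  obtains N t r where "Polynomial.smult (lead_coeff s ^ N) q = t * s + r" "degree r < degree s"
    "\<And>k. coeff t k \<in> mpol_in V" "\<And>k. coeff r k \<in> mpol_in V"
    "t = 0 \<or> degree t + degree s \<le> degree q"
proof -
  have "\<exists>N t r. Polynomial.smult (lead_coeff s ^ N) q = t * s + r \<and> degree r < degree s \<and>
      (\<forall>k. coeff t k \<in> mpol_in V) \<and> (\<forall>k. coeff r k \<in> mpol_in V) \<and>
      (t = 0 \<or> degree t + degree s \<le> degree q)"
    using q
  proof (induction "degree q" arbitrary: q rule: less_induct)
    case less
    show ?case
    proof (cases "degree q < degree s")
      case True
      then show ?thesis using less.prems
        by (intro exI[of _ 0] exI[of _ "0 :: 'k mpol poly"] exI[of _ q]) simp
    next
      case False
      define d where "d = degree q - degree s"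
      define q' where "q' = Polynomial.smult (lead_coeff s) q - monom (lead_coeff q) d * s"
      have q': "degree q' < degree q" "\<And>k. coeff q' k \<in> mpol_in V"
        using pseudo_reduce[of q s V] False s less.prems unfolding q'_def d_def by auto
      from less.hyps[OF q'] obtain N t r where IH: "Polynomial.smult (lead_coeff s ^ N) q' = t * s + r"
        "degree r < degree s" "\<And>k. coeff t k \<in> mpol_in V" "\<And>k. coeff r k \<in> mpol_in V"
        "t = 0 \<or> degree t + degree s \<le> degree q'" by blast
      let ?t = "t + monom (lead_coeff s ^ N * lead_coeff q) d"
      have "Polynomial.smult (lead_coeff s ^ Suc N) q = Polynomial.smult (lead_coeff s ^ N) q' +
          Polynomial.smult (lead_coeff s ^ N) (monom (lead_coeff q) d * s)"
        by (simp add: q'_def smult_diff_right mult.commute)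
      also have "\<dots> = ?t * s + r"
        by (simp add: IH(1) distrib_right smult_monom flip: mult_smult_left)
      finally have "Polynomial.smult (lead_coeff s ^ Suc N) q = ?t * s + r" .
      moreover have "coeff ?t k \<in> mpol_in V" for k
        using IH(3) s(2) less.prems by (auto intro!: mpol_in_add mpol_in_mult mpol_in_power)
      moreover have "degree ?t \<le> d"
        using IH(5) q'(1) by (intro degree_add_le degree_monom_le) (auto simp: d_def)
      ultimately show ?thesis using IH False
        by (intro exI[of _ "Suc N"] exI[of _ ?t] exI[of _ r]) (auto simp: d_def)
    qed
  qed
  then show ?thesis using that by blast
qed

lemma drop_lead:
  fixes p :: "'k::field mpol poly"
  defines "r \<equiv> p - monom (lead_coeff p) (degree p)"
  assumes "0 < degree p" and p: "\<And>k. coeff p k \<in> mpol_in V"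
  shows "degree r < degree p" "coeff r k \<in> mpol_in V"
    "poly r x = poly p x - lead_coeff p * x ^ degree p"
    "k \<noteq> degree p \<Longrightarrow> coeff r k = coeff p k"
proof -
  have "degree r \<le> degree p" unfolding r_def by (intro degree_diff_le) (auto simp: degree_monom_le)
  moreover have "coeff r (degree p) = 0" by (simp add: r_def)
  ultimately show "degree r < degree p"
    using assms(2) by (metis degree_0 leading_coeff_0_iff le_neq_implies_less)
qed (use p in \<open>auto simp: r_def poly_monom intro: mpol_in_diff\<close>)

lemma (in prime_set) poly_mem: "(\<And>k. coeff q k \<in> P) \<Longrightarrow> poly q x \<in> P"
  unfolding poly_altdef by (intro sum mult_right) simp

lemma (in prime_set) power_notin: "a \<notin> P \<Longrightarrow> a ^ k \<notin> P"
  by (induction k) (use one prime in auto)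

text \<open>Up to denominators, \<open>p\<close> is the minimal polynomial of \<open>x\<close> over
  the fractions of \<open>mpol_in V\<close> modulo \<open>P\<close>. Minimality forces the leading
  coefficient out of \<open>P\<close>, since a leading term in \<open>P\<close> could be dropped; a
  constant relation would have its only coefficient in \<open>P\<close>.\<close>

lemma minimal_relation:
  fixes P :: "'k::field mpol set"
  assumes "prime_set P" and ex: "\<And>k. coeff p0 k \<in> mpol_in V" "poly p0 x \<in> P" "coeff p0 k0 \<notin> P"
  obtains p where "\<And>k. coeff p k \<in> mpol_in V" "poly p x \<in> P" "lead_coeff p \<notin> P" "0 < degree p"
    "\<And>q k. (\<And>l. coeff q l \<in> mpol_in V) \<Longrightarrow> poly q x \<in> P \<Longrightarrow> degree q < degree p \<Longrightarrow> coeff q k \<in> P"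
proof -
  interpret prime_set P by fact
  define R where "R p \<longleftrightarrow> (\<forall>k. coeff p k \<in> mpol_in V) \<and> poly p x \<in> P \<and> (\<exists>k. coeff p k \<notin> P)" for p
  have "R p0" using ex by (auto simp: R_def)
  define p where "p = arg_min degree R"
  have p: "R p" and min: "\<And>q. R q \<Longrightarrow> degree p \<le> degree q"
    unfolding p_def using arg_min_nat_lemma[of R p0 degree] \<open>R p0\<close> by auto
  have pV: "\<And>k. coeff p k \<in> mpol_in V" using p by (simp add: R_def)
  have deg: "0 < degree p"
  proof (rule ccontr)
    assume "\<not> 0 < degree p"
    then obtain c where "p = [:c:]" by (metis degree_eq_zeroE not_gr_zero)
    then show False using p zero by (auto simp: R_def coeff_pCons split: nat.splits)
  qed
  have lead: "lead_coeff p \<notin> P"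
  proof
    assume *: "lead_coeff p \<in> P"
    let ?r = "p - monom (lead_coeff p) (degree p)"
    obtain k where k: "coeff p k \<notin> P" using p by (auto simp: R_def)
    then have "k \<noteq> degree p" using * by auto
    then have "coeff ?r k \<notin> P" using drop_lead(4)[OF deg pV] k by simp
    moreover have "poly ?r x \<in> P"
      using drop_lead(3)[OF deg pV, where x = x] p * by (simp add: R_def diff mult_right)
    ultimately have "R ?r" unfolding R_def using drop_lead(2)[OF deg pV] by blast
    then show False using min[of ?r] drop_lead(1)[OF deg pV] by simp
  qed
  show ?thesis
    by (rule that[OF pV _ lead deg]) (use p min in \<open>auto simp: R_def not_le [symmetric]\<close>)
qed

abbreviation grad :: "'k::field mpol \<Rightarrow> nat \<Rightarrow> 'k mpol" where
  "grad h \<equiv> \<lambda>j. mpol_diff j h"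

lemma (in prime_set) vspan_Suc: "vspan N w s v \<Longrightarrow> vspan N (\<lambda>i. if i < s then w i else u i) (Suc s) v"
proof (erule vspan_trans)
  fix i assume "i < s"
  then show "vspan N (\<lambda>i. if i < s then w i else u i) (Suc s) (w i)"
    using vspan_base[of i "Suc s" N "\<lambda>i. if i < s then w i else u i"] by simp
qed

text \<open>
  Variables are adjoined to \<open>U\<close> one at a time. A variable that is algebraic over the previous ones
  contributes the gradient of one relation of minimal degree, to which every other relation is
  reduced by pseudo-division; a transcendental one contributes nothing.
\<close>
lemma grad_vspan:
  fixes P :: "'k::field mpol set"
  assumes "prime_set P" and U: "P \<inter> mpol_in U \<subseteq> {0}" and "finite W"
  shows "\<exists>w. \<forall>h\<in>P \<inter> mpol_in (U \<union> W). prime_set.vspan P N w (card W) (grad h)"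
  using \<open>finite W\<close>
proof (induction W rule: finite_induct)
  interpret prime_set P by fact
  case empty
  show ?case using U by (auto intro!: exI[of _ undefined] vspan_zero simp: zero dest!: subsetD)
next
  interpret prime_set P by fact
  case (insert i W)
  let ?V = "U \<union> W" and ?x = "mpol_var i :: 'k mpol" and ?s = "card W"
  obtain w where w: "\<And>h. h \<in> P \<Longrightarrow> h \<in> mpol_in ?V \<Longrightarrow> vspan N w ?s (grad h)"
    using insert.IH by blast
  have card: "card (insert i W) = Suc ?s" using insert by simp
  \<comment> \<open>A relation with coefficients in \<open>P\<close> contributes nothing new: the
    gradients of the coefficients are spanned already, and the term with the derivative of the
    variable vanishes modulo \<open>P\<close>.\<close>
  have span0: "vspan N w' (Suc ?s) (grad (poly q ?x))"
    if w': "\<And>h. h \<in> P \<Longrightarrow> h \<in> mpol_in ?V \<Longrightarrow> vspan N w' (Suc ?s) (grad h)"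
      and q: "\<And>k. coeff q k \<in> mpol_in ?V" "\<And>k. coeff q k \<in> P" for q w'
  proof -
    have "vspan N w' (Suc ?s) (\<lambda>j. (\<Sum>k\<le>degree q. ?x ^ k * mpol_diff j (coeff q k)))"
      using q w' by (intro vspan_sum vspan_smult) auto
    moreover have "poly (pderiv q) ?x \<in> P" by (rule poly_mem) (simp add: coeff_pderiv mult q del: of_nat_Suc)
    ultimately show ?thesis
      by (elim vspan_cong) (simp add: mpol_diff_poly mult.commute mult uminus)
  qed
  show ?case
  proof (cases "\<exists>p k. (\<forall>k. coeff p k \<in> mpol_in ?V) \<and> poly p ?x \<in> P \<and> coeff p k \<notin> P")
    case False
    \<comment> \<open>An arbitrary last vector brings the number of vectors to
      \<open>card (insert i W)\<close>.\<close>
    let ?w = "\<lambda>k. if k < ?s then w k else undefined"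
    have "vspan N ?w (Suc ?s) (grad h)" if h: "h \<in> P" "h \<in> mpol_in (U \<union> insert i W)" for h
    proof -
      obtain q where q: "\<And>k. coeff q k \<in> mpol_in ?V" "h = poly q ?x"
        using h(2) mpol_in_insert[of h i ?V] by auto
      then have "coeff q k \<in> P" for k using False h(1) by blast
      then show ?thesis using span0[of ?w q] q vspan_Suc[OF w] by simp
    qed
    then show ?thesis unfolding card by blast
  next
    case True
    then obtain p where p: "\<And>k. coeff p k \<in> mpol_in ?V" "poly p ?x \<in> P" "lead_coeff p \<notin> P" "0 < degree p"
      "\<And>q k. (\<And>l. coeff q l \<in> mpol_in ?V) \<Longrightarrow> poly q ?x \<in> P \<Longrightarrow> degree q < degree p \<Longrightarrow> coeff q k \<in> P"
      using minimal_relation[OF \<open>prime_set P\<close>, of _ ?V ?x] by metis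
    let ?G = "poly p ?x"
    let ?w = "\<lambda>k. if k < ?s then w k else grad ?G"
    have wV: "vspan N ?w (Suc ?s) (grad h)" if "h \<in> P" "h \<in> mpol_in ?V" for h
      using vspan_Suc[OF w[OF that]] .
    have wG: "vspan N ?w (Suc ?s) (grad ?G)" using vspan_base[of ?s "Suc ?s" N ?w] by simp
    have "vspan N ?w (Suc ?s) (grad (poly q ?x))"
      if "\<And>k. coeff q k \<in> mpol_in ?V" "poly q ?x \<in> P" for q
      using that
    proof (induction "degree q" arbitrary: q rule: less_induct)
      case less
      show ?case
      proof (cases "degree q < degree p")
        case True
        then show ?thesis using p(5)[of q] less.prems wV by (intro span0) auto
      next
        case False
        define a where "a = lead_coeff p"
        define b where "b = lead_coeff q * ?x ^ (degree q - degree p)"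
        define q' where "q' = Polynomial.smult (lead_coeff p) q - monom (lead_coeff q) (degree q - degree p) * p"
        have q': "degree q' < degree q" "\<And>k. coeff q' k \<in> mpol_in ?V"
          "poly q' ?x = a * poly q ?x - b * ?G"
          using pseudo_reduce[of q p ?V] False p(1,4) less.prems unfolding q'_def a_def b_def by auto
        then have "poly q' ?x \<in> P" using p(2) less.prems by (simp add: diff mult)
        from less.hyps[OF q'(1,2) this] have "vspan N ?w (Suc ?s) (grad (poly q' ?x))" .
        then have "vspan N ?w (Suc ?s) (\<lambda>j. mpol_diff j (poly q' ?x) + b * mpol_diff j ?G)"
          by (intro vspan_add vspan_smult wG)
        \<comment> \<open>By the product rule the two vectors differ by multiples of
          \<open>poly q ?x\<close> and of \<open>?G\<close>, both in \<open>P\<close>.\<close>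
        then have "vspan N ?w (Suc ?s) (\<lambda>j. a * mpol_diff j (poly q ?x))"
        proof (rule vspan_cong)
          fix j
          have "mpol_diff j (poly q' ?x) + b * mpol_diff j ?G - a * mpol_diff j (poly q ?x) =
              mpol_diff j a * poly q ?x - mpol_diff j b * ?G"
            by (simp add: q'(3) mpol_diff_diff mpol_diff_mult)
          also have "\<dots> \<in> P" using less.prems p(2) by (simp add: diff mult)
          finally show "mpol_diff j (poly q' ?x) + b * mpol_diff j ?G - a * mpol_diff j (poly q ?x) \<in> P" .
        qed
        then show ?thesis unfolding a_def by (rule vspan_cancel[OF p(3)])
      qed
    qed
    then have "vspan N ?w (Suc ?s) (grad h)" if "h \<in> P" "h \<in> mpol_in (U \<union> insert i W)" for h
      using that mpol_in_insert[of h i ?V] by auto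
    then show ?thesis unfolding card by blast
  qed
qed

text \<open>
  Relations of minimal degree over a maximal independent set \<open>U\<close> of variables have a diagonal Jacobi
  matrix; in characteristic zero their derivatives do not lie in \<open>P\<close>.
\<close>
lemma grad_minor:
  fixes P :: "'k::field_char_0 mpol set"
  assumes "prime_set P" and "finite N"
  obtains U h js where "U \<subseteq> N" "P \<inter> mpol_in U \<subseteq> {0}"
    "\<And>i. i < card (N - U) \<Longrightarrow> h i \<in> P \<inter> mpol_in N" "\<And>i. i < card (N - U) \<Longrightarrow> js i \<in> N"
    "det (mat (card (N - U)) (card (N - U)) (\<lambda>(i, j). mpol_diff (js j) (h i))) \<notin> P"
proof -
  interpret prime_set P by fact
  define \<U> where "\<U> = {U. U \<subseteq> N \<and> P \<inter> mpol_in U \<subseteq> {0}}"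
  \<comment> \<open>A nonzero constant is a unit, so the empty set of variables is
    independent.\<close>
  have "P \<inter> mpol_in {} \<subseteq> {0}"
  proof clarify
    fix p assume p: "p \<in> P" "p \<in> mpol_in {}"
    obtain c where c: "p = mpol_const c" using mpol_in_empty[OF p(2)] .
    have "mpol_const (inverse c) * p = 1" if "c \<noteq> 0"
      using that by (simp add: c mpol_const_def mult_single)
    then have "c = 0" using mult[OF p(1), of "mpol_const (inverse c)"] one by metis
    then show "p = 0" by (simp add: c mpol_const_def)
  qed
  then have "{} \<in> \<U>" by (simp add: \<U>_def)
  moreover have "finite \<U>" using \<open>finite N\<close> by (simp add: \<U>_def)
  ultimately obtain U where U: "U \<in> \<U>" and max: "\<And>W. W \<in> \<U> \<Longrightarrow> U \<subseteq> W \<Longrightarrow> U = W"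
    using finite_has_maximal[of \<U>] by auto
  have UN: "U \<subseteq> N" and PU: "P \<inter> mpol_in U \<subseteq> {0}" using U by (auto simp: \<U>_def)
  have "\<exists>h \<in> P \<inter> mpol_in (insert i U). mpol_diff i h \<notin> P" if i: "i \<in> N - U" for i
  proof -
    let ?x = "mpol_var i :: 'k mpol"
    \<comment> \<open>Relations for variable \<open>i\<close> over \<open>mpol_in U\<close>. A
      nonzero \<open>p\<close> automatically has a coefficient outside \<open>P\<close>, because
      \<open>U\<close> is independent.\<close>
    define R where "R p \<longleftrightarrow> (\<forall>k. coeff p k \<in> mpol_in U) \<and> poly p ?x \<in> P \<and> p \<noteq> 0" for p
    have "insert i U \<notin> \<U>" using max[of "insert i U"] i by auto
    then obtain g where g: "g \<in> P" "g \<in> mpol_in (insert i U)" "g \<noteq> 0"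
      using i UN by (auto simp: \<U>_def)
    obtain q where "\<And>k. coeff q k \<in> mpol_in U" "g = poly q ?x" using mpol_in_insert[OF g(2)] by metis
    then have "R q" using g by (auto simp: R_def)
    define p where "p = arg_min degree R"
    have p: "R p" and min: "\<And>q. R q \<Longrightarrow> degree p \<le> degree q"
      unfolding p_def using arg_min_nat_lemma[of R q degree] \<open>R q\<close> by auto
    have deg: "0 < degree p"
    proof (rule ccontr)
      assume "\<not> 0 < degree p"
      then obtain c where c: "p = [:c:]" by (metis degree_eq_zeroE not_gr_zero)
      then have "c \<in> P \<inter> mpol_in U" using p by (auto simp: R_def dest: spec[of _ 0])
      then show False using PU p c by (auto simp: R_def)
    qed
    \<comment> \<open>Characteristic zero enters here. The formal derivative is nonzero of smaller
      degree, so the minimality of \<open>p\<close> keeps its value out of \<open>P\<close>.\<close>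
    have "pderiv p \<noteq> 0" using deg by (simp add: pderiv_eq_0_iff)
    moreover have "degree (pderiv p) < degree p" using deg by (simp add: degree_pderiv)
    moreover have "coeff (pderiv p) k \<in> mpol_in U" for k
    proof -
      have "of_nat (Suc k) = (mpol_const (of_nat (Suc k)) :: 'k mpol)"
        by (simp only: mpol_const_def single_of_nat)
      then have "(of_nat (Suc k) :: 'k mpol) \<in> mpol_in U" by (simp only: mpol_in_const)
      then show ?thesis using p by (simp only: coeff_pderiv R_def mpol_in_mult)
    qed
    ultimately have "poly (pderiv p) ?x \<notin> P" using min[of "pderiv p"] by (auto simp: R_def)
    moreover have "mpol_diff i (poly p ?x) = poly (pderiv p) ?x"
      using p i by (simp add: mpol_diff_poly mpol_diff_var R_def mpol_diff_notin[of _ U])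
    moreover have "poly p ?x \<in> mpol_in (insert i U)" using p by (intro poly_var_in) (auto simp: R_def)
    ultimately show ?thesis using p by (intro bexI[of _ "poly p ?x"]) (auto simp: R_def)
  qed
  then obtain G where G: "\<And>i. i \<in> N - U \<Longrightarrow> G i \<in> P" "\<And>i. i \<in> N - U \<Longrightarrow> G i \<in> mpol_in (insert i U)"
      "\<And>i. i \<in> N - U \<Longrightarrow> mpol_diff i (G i) \<notin> P"
    by (metis Int_iff)
  define l where "l = sorted_list_of_set (N - U)"
  define s where "s = card (N - U)"
  have fin: "finite (N - U)" using \<open>finite N\<close> by simp
  have l: "set l = N - U" "distinct l" "length l = s" using fin by (auto simp: l_def s_def)
  have ln: "l ! i \<in> N - U" if "i < s" for i using that l by (metis nth_mem)
  have lj: "l ! i = l ! j \<longleftrightarrow> i = j" if "i < s" "j < s" for i j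
    using that l by (simp add: nth_eq_iff_index_eq)
  let ?M = "mat s s (\<lambda>(i, j). mpol_diff (l ! j) (G (l ! i)))"
  \<comment> \<open>\<open>G (l ! i)\<close> involves only \<open>U\<close> and its own variable, so
    its derivatives by the other variables outside \<open>U\<close> vanish.\<close>
  have "?M $$ (i, j) = 0" if "i < s" "j < s" "i \<noteq> j" for i j
    using that ln[of i] ln[of j] lj[of i j] by (auto intro!: mpol_diff_notin[OF G(2)])
  then have "det ?M = prod_list (diag_mat ?M)"
    by (intro det_upper_triangular) (auto simp: upper_triangular_def)
  also have "\<dots> = (\<Prod>i = 0..<s. mpol_diff (l ! i) (G (l ! i)))"
    by (subst prod_list_diag_prod) simp
  also have "\<dots> \<notin> P" by (rule prod_notin) (use ln G(3) in auto)
  finally have "det ?M \<notin> P" .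
  moreover have "G (l ! i) \<in> P \<inter> mpol_in N" if "i < s" for i
    using G(1,2) ln[OF that] UN by (auto intro: mpol_in_mono[of "insert (l ! i) U" N])
  ultimately show ?thesis using that[OF UN PU, of "\<lambda>i. G (l ! i)" "\<lambda>j. l ! j"] ln
    by (auto simp: s_def)
qed

text \<open>
  If every further variable were algebraic over \<open>U\<close> modulo \<open>P\<close>, take a maximal set \<open>V\<close> of variables on
  which \<open>P\<close> and \<open>P'\<close> agree and adjoin one more variable: there, an element of \<open>P'\<close> outside \<open>P\<close> of
  minimal degree divides, up to a factor outside \<open>P\<close>, a relation of minimal degree modulo \<open>P\<close>.
\<close>
lemma extend_independent:
  fixes P P' :: "'k::field mpol set"
  assumes "prime_set P" "prime_set P'" "P \<inter> mpol_in N \<subset> P' \<inter> mpol_in N" "finite N"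
    and U: "U \<subseteq> N" "P' \<inter> mpol_in U \<subseteq> {0}"
  obtains i where "i \<in> N - U" "P \<inter> mpol_in (insert i U) \<subseteq> {0}"
proof (rule ccontr)
  interpret P: prime_set P by fact
  interpret P': prime_set P' by fact
  note wit = that
  assume "\<not> thesis"
  then have dep: "\<not> P \<inter> mpol_in (insert i U) \<subseteq> {0}" if "i \<in> N - U" for i
    using wit[of i] that \<open>\<not> thesis\<close> by blast
  have PP': "p \<in> P'" if "p \<in> P" "p \<in> mpol_in N" for p using assms(3) that by blast
  have PU: "P \<inter> mpol_in U \<subseteq> {0}"
    using U PP' by (auto dest: mpol_in_mono)
  define \<V> where "\<V> = {V. U \<subseteq> V \<and> V \<subseteq> N \<and> P' \<inter> mpol_in V \<subseteq> P}"
  have "U \<in> \<V>" using U P.zero by (auto simp: \<V>_def)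
  moreover have "finite \<V>" using \<open>finite N\<close> by (simp add: \<V>_def)
  ultimately obtain V where V: "V \<in> \<V>" and max: "\<And>W. W \<in> \<V> \<Longrightarrow> V \<subseteq> W \<Longrightarrow> V = W"
    using finite_has_maximal[of \<V>] by blast
  have "V \<noteq> N" using V assms(3) by (auto simp: \<V>_def)
  then obtain i where i: "i \<in> N" "i \<notin> V" using V by (auto simp: \<V>_def)
  let ?x = "mpol_var i :: 'k mpol"
  have UV: "U \<subseteq> V" and VN: "insert i V \<subseteq> N" using V i by (auto simp: \<V>_def)
  have P'V: "p \<in> P" if "p \<in> P'" "p \<in> mpol_in V" for p using V that by (auto simp: \<V>_def)
  have polyN: "poly q ?x \<in> mpol_in N" if "\<And>k. coeff q k \<in> mpol_in V" for q
    using poly_var_in[OF that, of i] VN mpol_in_mono by blast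
  \<comment> \<open>Variable \<open>i\<close> is algebraic over \<open>U\<close> by the assumption
    to be refuted. No nonzero element of \<open>mpol_in U\<close> lies in \<open>P\<close>, so its
    relation is nontrivial modulo \<open>P\<close> as well.\<close>
  obtain g where g: "g \<in> P" "g \<in> mpol_in (insert i U)" "g \<noteq> 0"
    using dep[of i] i UV by auto
  obtain q where q: "\<And>k. coeff q k \<in> mpol_in U" "g = poly q ?x" using mpol_in_insert[OF g(2)] by metis
  then have "q \<noteq> 0" using g(3) by auto
  then have "coeff q (degree q) \<notin> P" using PU q(1)[of "degree q"] by auto
  then obtain p where p: "\<And>k. coeff p k \<in> mpol_in V" "poly p ?x \<in> P" "lead_coeff p \<notin> P" "0 < degree p"
      "\<And>q k. (\<And>l. coeff q l \<in> mpol_in V) \<Longrightarrow> poly q ?x \<in> P \<Longrightarrow> degree q < degree p \<Longrightarrow> coeff q k \<in> P"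
    using minimal_relation[OF \<open>prime_set P\<close>, of q V ?x] g(1) q mpol_in_mono[OF UV] by metis
  define R where "R s \<longleftrightarrow> (\<forall>k. coeff s k \<in> mpol_in V) \<and> poly s ?x \<in> P' \<and> poly s ?x \<notin> P" for s
  have "insert i V \<notin> \<V>" using max[of "insert i V"] i by auto
  then obtain h where h: "h \<in> P'" "h \<in> mpol_in (insert i V)" "h \<notin> P"
    using UV VN by (auto simp: \<V>_def)
  obtain s0 where "\<And>k. coeff s0 k \<in> mpol_in V" "h = poly s0 ?x" using mpol_in_insert[OF h(2)] by metis
  then have "R s0" using h by (simp add: R_def)
  define s where "s = arg_min degree R"
  have s: "R s" and min: "\<And>q. R q \<Longrightarrow> degree s \<le> degree q"
    unfolding s_def using arg_min_nat_lemma[of R s0 degree] \<open>R s0\<close> by auto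
  have sV: "\<And>k. coeff s k \<in> mpol_in V" using s by (simp add: R_def)
  have deg: "0 < degree s"
  proof (rule ccontr)
    assume "\<not> 0 < degree s"
    then obtain c where c: "s = [:c:]" by (metis degree_eq_zeroE not_gr_zero)
    then have "c \<in> mpol_in V" using sV[of 0] by simp
    then show False using P'V[of c] s c by (auto simp: R_def)
  qed
  \<comment> \<open>A leading coefficient in \<open>P\<close> also lies in \<open>P'\<close>, so the
    leading term could be dropped without leaving \<open>P'\<close> or entering
    \<open>P\<close>.\<close>
  have lead: "lead_coeff s \<notin> P"
  proof
    assume *: "lead_coeff s \<in> P"
    let ?r = "s - monom (lead_coeff s) (degree s)"
    have "lead_coeff s \<in> P'" using * PP' sV VN mpol_in_mono[of V N] by blast
    then have "R ?r"
      using s * drop_lead(2)[OF deg sV] drop_lead(3)[OF deg sV, where x = ?x]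
        P.cong_mem[of "poly s ?x" "poly ?r ?x"]
      by (simp add: R_def P.mult_right P'.mult_right P'.diff)
    then show False using min[of ?r] drop_lead(1)[OF deg sV] by simp
  qed
  \<comment> \<open>Otherwise a reduction by \<open>p\<close> would give a polynomial of smaller
    degree than \<open>s\<close> whose value is still in \<open>P'\<close> and not in
    \<open>P\<close>.\<close>
  have less: "degree s < degree p"
  proof (rule ccontr)
    assume *: "\<not> degree s < degree p"
    let ?r = "Polynomial.smult (lead_coeff p) s - monom (lead_coeff s) (degree s - degree p) * p"
    have r: "degree ?r < degree s" "\<And>k. coeff ?r k \<in> mpol_in V"
        "poly ?r ?x = lead_coeff p * poly s ?x - lead_coeff s * ?x ^ (degree s - degree p) * poly p ?x"
      using pseudo_reduce[OF deg _ p(1) sV] * by auto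
    have "poly p ?x \<in> P'" using PP' p polyN by blast
    then have "poly ?r ?x \<in> P'" using s unfolding r(3) by (simp add: R_def P'.diff P'.mult)
    moreover have "lead_coeff p * poly s ?x \<notin> P" using P.prime p(3) s by (auto simp: R_def)
    then have "poly ?r ?x \<notin> P"
      using P.cong_mem[of "lead_coeff p * poly s ?x" "poly ?r ?x"] p(2)
      unfolding r(3) by (simp add: P.mult)
    ultimately have "R ?r" using r(2) by (simp add: R_def)
    then show False using min[of ?r] r(1) by simp
  qed
  \<comment> \<open>The remainder has its value in \<open>P'\<close>, hence in \<open>P\<close> by
    the minimality of \<open>s\<close>. As the value of \<open>s\<close> is outside
    \<open>P\<close>, the quotient has its value in \<open>P\<close> too. Both degrees are below
    that of \<open>p\<close>, so all coefficients of \<open>t\<close> and \<open>r\<close> lie in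
    \<open>P\<close>, and with them \<open>lead_coeff s ^ M * lead_coeff p\<close>, whose factors
    are outside \<open>P\<close>.\<close>
  obtain M t r where div: "Polynomial.smult (lead_coeff s ^ M) p = t * s + r" "degree r < degree s"
    "\<And>k. coeff t k \<in> mpol_in V" "\<And>k. coeff r k \<in> mpol_in V"
    "t = 0 \<or> degree t + degree s \<le> degree p"
    using pseudo_division[OF deg sV p(1)] by metis
  have "poly (Polynomial.smult (lead_coeff s ^ M) p) ?x = poly (t * s + r) ?x" using div(1) by simp
  then have eq: "lead_coeff s ^ M * poly p ?x = poly t ?x * poly s ?x + poly r ?x" by simp
  have "poly r ?x = lead_coeff s ^ M * poly p ?x - poly t ?x * poly s ?x" using eq by simp
  also have "\<dots> \<in> P'" using PP'[OF p(2) polyN[OF p(1)]] s by (simp add: R_def P'.diff P'.mult)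
  finally have "poly r ?x \<in> P'" .
  then have rP: "poly r ?x \<in> P" using min[of r] div(2,4) by (auto simp: R_def)
  have "poly t ?x * poly s ?x = lead_coeff s ^ M * poly p ?x - poly r ?x" using eq by simp
  also have "\<dots> \<in> P" using p(2) rP by (simp add: P.diff P.mult)
  finally have tP: "poly t ?x \<in> P" using P.prime s by (auto simp: R_def)
  have "coeff (t * s + r) k \<in> P" for k
  proof -
    have "coeff t k \<in> P" for k
      using p(5)[OF div(3) tP] div(5) deg P.zero by auto
    moreover have "coeff r k \<in> P" using p(5)[OF div(4) rP] less div(2) by simp
    ultimately show ?thesis by (simp add: coeff_mult P.add P.sum P.mult_right)
  qed
  then have "lead_coeff s ^ M * lead_coeff p \<in> P"
    using div(1) by (metis coeff_smult)
  then show False using P.prime P.power_notin lead p(3) by blast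
qed

section \<open>Localizations and chains of primes\<close>

lemma UN_const:
  assumes "\<And>x. x \<in> X \<Longrightarrow> h x = c" "a \<in> X"
  shows "(\<Union>x\<in>X. h x) = c"
proof -
  have "(\<Union>x\<in>X. h x) = (\<Union>x\<in>X. c)" by (rule SUP_cong[OF refl]) (rule assms(1))
  also have "\<dots> = c" using assms(2) by blast
  finally show ?thesis .
qed

text \<open>The operations of \<open>localization\<close> are unions over all pairs of
  representatives. They are classes once all pairs yield the same class, so this is where
  well-definedness is used.\<close>

lemma UN_pairs_const:
  assumes "\<And>u v u' v'. (u, v) \<in> X \<Longrightarrow> (u', v') \<in> Y \<Longrightarrow> g u v u' v' = c" "(a, b) \<in> X" "(a', b') \<in> Y"
  shows "(\<Union>(u, v)\<in>X. \<Union>(u', v')\<in>Y. g u v u' v') = c"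
proof (rule UN_const[OF _ assms(2)])
  fix x assume "x \<in> X"
  then show "(case x of (u, v) \<Rightarrow> \<Union>(u', v')\<in>Y. g u v u' v') = c"
    using assms(1) by (cases x) (auto simp only: prod.case intro!: UN_const[OF _ assms(3)])
qed

locale domain_localization = domain A for A (structure) +
  fixes S
  assumes S_carrier: "S \<subseteq> carrier A"
    and S_one: "\<one> \<in> S"
    and S_mult: "s \<in> S \<Longrightarrow> t \<in> S \<Longrightarrow> s \<otimes> t \<in> S"
    and S_zero: "\<zero> \<notin> S"
begin

abbreviation loc where "loc \<equiv> localization A S"
abbreviation frac where "frac \<equiv> frac_class A S"

lemma S_closed [simp]: "s \<in> S \<Longrightarrow> s \<in> carrier A"
  using S_carrier by blast

text \<open>In a domain with zero not in \<open>S\<close> the multiplier \<open>t\<close> of the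
  definition can be cancelled, which leaves cross multiplication.\<close>

lemma mem_frac:
  assumes "r \<in> carrier A" "s \<in> S"
  shows "(r', s') \<in> frac r s \<longleftrightarrow> r' \<in> carrier A \<and> s' \<in> S \<and> s' \<otimes> r = s \<otimes> r'"
proof -
  have "(\<exists>t\<in>S. t \<otimes> (s' \<otimes> r \<ominus> s \<otimes> r') = \<zero>) \<longleftrightarrow> s' \<otimes> r = s \<otimes> r'"
    if "r' \<in> carrier A" "s' \<in> S"
  proof
    assume "\<exists>t\<in>S. t \<otimes> (s' \<otimes> r \<ominus> s \<otimes> r') = \<zero>"
    then obtain t where t: "t \<in> S" "t \<otimes> (s' \<otimes> r \<ominus> s \<otimes> r') = \<zero>" by blast
    then have "s' \<otimes> r \<ominus> s \<otimes> r' = \<zero>"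
      using assms that S_zero integral[of t "s' \<otimes> r \<ominus> s \<otimes> r'"] by auto
    then show "s' \<otimes> r = s \<otimes> r'" using assms that by (simp add: r_right_minus_eq)
  next
    assume "s' \<otimes> r = s \<otimes> r'"
    then show "\<exists>t\<in>S. t \<otimes> (s' \<otimes> r \<ominus> s \<otimes> r') = \<zero>"
      using assms that S_one by (intro bexI[of _ \<one>]) (auto simp: r_right_minus_eq)
  qed
  then show ?thesis by (auto simp: frac_class_def)
qed

lemma frac_eq:
  assumes "r \<in> carrier A" "s \<in> S" "r' \<in> carrier A" "s' \<in> S"
  shows "frac r s = frac r' s' \<longleftrightarrow> s' \<otimes> r = s \<otimes> r'"
proof
  assume "frac r s = frac r' s'"
  then have "(r', s') \<in> frac r s" using mem_frac[of r' s' r' s'] assms by simp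
  then show "s' \<otimes> r = s \<otimes> r'" using assms by (simp add: mem_frac)
next
  assume eq: "s' \<otimes> r = s \<otimes> r'"
  have "v \<otimes> r = s \<otimes> u \<longleftrightarrow> v \<otimes> r' = s' \<otimes> u" if uv: "u \<in> carrier A" "v \<in> S" for u v
  proof -
    have nz: "s \<noteq> \<zero>" "s' \<noteq> \<zero>" using assms S_zero by auto
    have "v \<otimes> r = s \<otimes> u \<longleftrightarrow> s' \<otimes> (v \<otimes> r) = s' \<otimes> (s \<otimes> u)"
      using assms uv nz by (simp add: m_lcancel)
    also have "s' \<otimes> (v \<otimes> r) = s \<otimes> (v \<otimes> r')"
      using assms uv eq by (metis S_closed m_lcomm)
    also have "s' \<otimes> (s \<otimes> u) = s \<otimes> (s' \<otimes> u)" using assms uv by (simp add: m_lcomm)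
    also have "s \<otimes> (v \<otimes> r') = s \<otimes> (s' \<otimes> u) \<longleftrightarrow> v \<otimes> r' = s' \<otimes> u"
      using assms uv nz by (simp add: m_lcancel)
    finally show ?thesis .
  qed
  then have "(u, v) \<in> frac r s \<longleftrightarrow> (u, v) \<in> frac r' s'" for u v
    using assms by (auto simp: mem_frac)
  then show "frac r s = frac r' s'" by auto
qed

lemma frac_mult:
  assumes "r \<in> carrier A" "s \<in> S" "r' \<in> carrier A" "s' \<in> S"
  shows "frac r s \<otimes>\<^bsub>loc\<^esub> frac r' s' = frac (r \<otimes> r') (s \<otimes> s')"
proof -
  have "frac (u \<otimes> u') (v \<otimes> v') = frac (r \<otimes> r') (s \<otimes> s')"
    if "(u, v) \<in> frac r s" "(u', v') \<in> frac r' s'" for u v u' v'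
  proof -
    have u: "u \<in> carrier A" "v \<in> S" "v \<otimes> r = s \<otimes> u" and u': "u' \<in> carrier A" "v' \<in> S" "v' \<otimes> r' = s' \<otimes> u'"
      using that assms by (auto simp: mem_frac)
    have "(s \<otimes> s') \<otimes> (u \<otimes> u') = (s \<otimes> u) \<otimes> (s' \<otimes> u')" using assms u u' by (simp add: m_ac)
    also have "\<dots> = (v \<otimes> v') \<otimes> (r \<otimes> r')"
      using assms u(1,2) u'(1,2) by (simp add: u(3) [symmetric] u'(3) [symmetric] m_ac)
    finally show ?thesis using assms u u' S_mult by (simp add: frac_eq)
  qed
  moreover have "(r, s) \<in> frac r s" "(r', s') \<in> frac r' s'" using assms by (auto simp: mem_frac)
  ultimately have "(\<Union>(u, v)\<in>frac r s. \<Union>(u', v')\<in>frac r' s'. frac (u \<otimes> u') (v \<otimes> v')) =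
      frac (r \<otimes> r') (s \<otimes> s')"
    by (rule UN_pairs_const)
  then show ?thesis by (simp add: localization_def)
qed

lemma frac_add:
  assumes "r \<in> carrier A" "s \<in> S" "r' \<in> carrier A" "s' \<in> S"
  shows "frac r s \<oplus>\<^bsub>loc\<^esub> frac r' s' = frac (s' \<otimes> r \<oplus> s \<otimes> r') (s \<otimes> s')"
proof -
  have "frac (v' \<otimes> u \<oplus> v \<otimes> u') (v \<otimes> v') = frac (s' \<otimes> r \<oplus> s \<otimes> r') (s \<otimes> s')"
    if "(u, v) \<in> frac r s" "(u', v') \<in> frac r' s'" for u v u' v'
  proof -
    have u: "u \<in> carrier A" "v \<in> S" "v \<otimes> r = s \<otimes> u" and u': "u' \<in> carrier A" "v' \<in> S" "v' \<otimes> r' = s' \<otimes> u'"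
      using that assms by (auto simp: mem_frac)
    have "(s \<otimes> s') \<otimes> (v' \<otimes> u \<oplus> v \<otimes> u') = s' \<otimes> v' \<otimes> (s \<otimes> u) \<oplus> s \<otimes> v \<otimes> (s' \<otimes> u')"
      using assms u(1,2) u'(1,2) by (simp add: r_distr m_ac)
    also have "\<dots> = (v \<otimes> v') \<otimes> (s' \<otimes> r \<oplus> s \<otimes> r')"
      using assms u(1,2) u'(1,2) by (simp add: u(3) [symmetric] u'(3) [symmetric] r_distr m_ac)
    finally show ?thesis using assms u u' S_mult by (simp add: frac_eq)
  qed
  moreover have "(r, s) \<in> frac r s" "(r', s') \<in> frac r' s'" using assms by (auto simp: mem_frac)
  ultimately have "(\<Union>(u, v)\<in>frac r s. \<Union>(u', v')\<in>frac r' s'. frac (v' \<otimes> u \<oplus> v \<otimes> u') (v \<otimes> v')) =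
      frac (s' \<otimes> r \<oplus> s \<otimes> r') (s \<otimes> s')"
    by (rule UN_pairs_const)
  then show ?thesis by (simp add: localization_def)
qed

lemma carrier_loc: "x \<in> carrier loc \<longleftrightarrow> (\<exists>r s. r \<in> carrier A \<and> s \<in> S \<and> x = frac r s)"
  by (auto simp: localization_def)

lemma frac_closed: "r \<in> carrier A \<Longrightarrow> s \<in> S \<Longrightarrow> frac r s \<in> carrier loc"
  by (auto simp: carrier_loc)

lemma loc_zero: "\<zero>\<^bsub>loc\<^esub> = frac \<zero> \<one>" and loc_one: "\<one>\<^bsub>loc\<^esub> = frac \<one> \<one>"
  by (simp_all add: localization_def)

lemma frac_add_same:
  assumes "r \<in> carrier A" "r' \<in> carrier A" "s \<in> S"
  shows "frac r s \<oplus>\<^bsub>loc\<^esub> frac r' s = frac (r \<oplus> r') s"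
  using assms S_mult by (simp add: frac_add frac_eq r_distr m_ac)

lemma common_denominator:
  assumes "x \<in> carrier loc" "y \<in> carrier loc"
  obtains r r' s where "r \<in> carrier A" "r' \<in> carrier A" "s \<in> S" "x = frac r s" "y = frac r' s"
proof -
  obtain a b where a: "a \<in> carrier A" "b \<in> S" "x = frac a b" using assms(1) by (auto simp: carrier_loc)
  obtain c d where c: "c \<in> carrier A" "d \<in> S" "y = frac c d" using assms(2) by (auto simp: carrier_loc)
  have "x = frac (a \<otimes> d) (b \<otimes> d)" using a c S_mult by (simp add: frac_eq m_ac)
  moreover have "y = frac (c \<otimes> b) (b \<otimes> d)" using a c S_mult by (simp add: frac_eq m_ac)
  ultimately show ?thesis using that[of "a \<otimes> d" "c \<otimes> b" "b \<otimes> d"] a c S_mult by simp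
qed

lemma cring_loc: "cring loc"
proof (rule cringI)
  show "abelian_group loc"
  proof (rule abelian_groupI)
    fix x y assume xy: "x \<in> carrier loc" "y \<in> carrier loc"
    then obtain r r' s where r: "r \<in> carrier A" "r' \<in> carrier A" "s \<in> S" "x = frac r s" "y = frac r' s"
      by (rule common_denominator)
    then show "x \<oplus>\<^bsub>loc\<^esub> y \<in> carrier loc" "x \<oplus>\<^bsub>loc\<^esub> y = y \<oplus>\<^bsub>loc\<^esub> x"
      by (simp_all add: frac_add_same frac_closed a_comm)
    fix z assume "z \<in> carrier loc"
    with r obtain t u where t: "t \<in> carrier A" "u \<in> S" "z = frac t u" by (auto simp: carrier_loc)
    have su: "s \<otimes> u \<in> S" using r t S_mult by simp
    have eqs: "x = frac (r \<otimes> u) (s \<otimes> u)" "y = frac (r' \<otimes> u) (s \<otimes> u)" "z = frac (t \<otimes> s) (s \<otimes> u)"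
      using r t su by (simp_all add: frac_eq m_ac)
    show "x \<oplus>\<^bsub>loc\<^esub> y \<oplus>\<^bsub>loc\<^esub> z = x \<oplus>\<^bsub>loc\<^esub> (y \<oplus>\<^bsub>loc\<^esub> z)"
      unfolding eqs using r(1-3) t(1,2) su by (simp add: frac_add_same a_assoc)
  next
    show "\<zero>\<^bsub>loc\<^esub> \<in> carrier loc" by (simp add: loc_zero frac_closed S_one)
    fix x assume "x \<in> carrier loc"
    then obtain r s where r: "r \<in> carrier A" "s \<in> S" "x = frac r s" by (auto simp: carrier_loc)
    show "\<zero>\<^bsub>loc\<^esub> \<oplus>\<^bsub>loc\<^esub> x = x"
      using r S_one S_mult by (simp add: loc_zero frac_add frac_eq)
    have "frac (\<ominus> r) s \<oplus>\<^bsub>loc\<^esub> x = \<zero>\<^bsub>loc\<^esub>"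
      using r S_one by (simp add: loc_zero frac_add_same frac_eq l_neg)
    then show "\<exists>y\<in>carrier loc. y \<oplus>\<^bsub>loc\<^esub> x = \<zero>\<^bsub>loc\<^esub>" using r frac_closed by blast
  qed
  show "comm_monoid loc"
  proof (rule comm_monoidI)
    fix x y z assume "x \<in> carrier loc" "y \<in> carrier loc"
    then obtain r s r' s' where r: "r \<in> carrier A" "s \<in> S" "x = frac r s" "r' \<in> carrier A" "s' \<in> S" "y = frac r' s'"
      by (auto simp: carrier_loc)
    then show "x \<otimes>\<^bsub>loc\<^esub> y \<in> carrier loc" "x \<otimes>\<^bsub>loc\<^esub> y = y \<otimes>\<^bsub>loc\<^esub> x"
      by (simp_all add: frac_mult frac_closed m_comm S_mult)
    assume "z \<in> carrier loc"
    then obtain t u where t: "t \<in> carrier A" "u \<in> S" "z = frac t u" by (auto simp: carrier_loc)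
    show "x \<otimes>\<^bsub>loc\<^esub> y \<otimes>\<^bsub>loc\<^esub> z = x \<otimes>\<^bsub>loc\<^esub> (y \<otimes>\<^bsub>loc\<^esub> z)"
      using r t by (simp add: frac_mult S_mult m_assoc)
  next
    show "\<one>\<^bsub>loc\<^esub> \<in> carrier loc" by (simp add: loc_one frac_closed S_one)
    fix x assume "x \<in> carrier loc"
    then show "\<one>\<^bsub>loc\<^esub> \<otimes>\<^bsub>loc\<^esub> x = x"
      using S_one by (auto simp: carrier_loc loc_one frac_mult)
  qed
  fix x y z assume xy: "x \<in> carrier loc" "y \<in> carrier loc" and z: "z \<in> carrier loc"
  obtain r r' s where r: "r \<in> carrier A" "r' \<in> carrier A" "s \<in> S" "x = frac r s" "y = frac r' s"
    using xy by (rule common_denominator)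
  obtain t u where "t \<in> carrier A" "u \<in> S" "z = frac t u" using z by (auto simp: carrier_loc)
  with r show "(x \<oplus>\<^bsub>loc\<^esub> y) \<otimes>\<^bsub>loc\<^esub> z = x \<otimes>\<^bsub>loc\<^esub> z \<oplus>\<^bsub>loc\<^esub> y \<otimes>\<^bsub>loc\<^esub> z"
    by (simp add: frac_add_same frac_mult S_mult l_distr)
qed

lemma frac_one_hom: "(\<lambda>a. frac a \<one>) \<in> Ring.ring_hom A loc"
  using S_one by (intro ring_hom_memI) (simp_all add: frac_closed frac_mult frac_add_same loc_one)

lemma frac_split: "a \<in> carrier A \<Longrightarrow> s \<in> S \<Longrightarrow> frac s \<one> \<otimes>\<^bsub>loc\<^esub> frac a s = frac a \<one>"
  using S_one S_mult by (simp add: frac_mult frac_eq)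

lemma frac_one_inj: "a \<in> carrier A \<Longrightarrow> b \<in> carrier A \<Longrightarrow> frac a \<one> = frac b \<one> \<longleftrightarrow> a = b"
  using S_one by (auto simp: frac_eq)

lemma field_loc:
  assumes S: "S = carrier A - {\<zero>}"
  shows "field loc"
proof (rule cring.cring_fieldI2[OF cring_loc])
  show "\<zero>\<^bsub>loc\<^esub> \<noteq> \<one>\<^bsub>loc\<^esub>" by (simp add: loc_zero loc_one frac_one_inj)
  fix x assume x: "x \<in> carrier loc" "x \<noteq> \<zero>\<^bsub>loc\<^esub>"
  then obtain r s where r: "r \<in> carrier A" "s \<in> S" "x = frac r s"
    by (auto simp: carrier_loc)
  have "r \<noteq> \<zero>"
  proof
    assume "r = \<zero>"
    then have "x = \<zero>\<^bsub>loc\<^esub>" unfolding r(3) loc_zero using r S_one by (subst frac_eq) simp_all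
    with x(2) show False by simp
  qed
  then have rS: "r \<in> S" "s \<in> carrier A" using r S by auto
  have "x \<otimes>\<^bsub>loc\<^esub> frac s r = frac (r \<otimes> s) (s \<otimes> r)"
    unfolding r(3) by (rule frac_mult[OF r(1,2) rS(2,1)])
  also have "\<dots> = \<one>\<^bsub>loc\<^esub>"
    unfolding loc_one using r(1) rS S_mult[OF r(2) rS(1)] S_one
    by (subst frac_eq) (simp_all add: m_comm)
  finally show "\<exists>y\<in>carrier loc. x \<otimes>\<^bsub>loc\<^esub> y = \<one>\<^bsub>loc\<^esub>"
    using rS frac_closed by blast
qed

end

lemma domain_localization_nonzero:
  assumes "domain A"
  shows "domain_localization A (carrier A - {\<zero>\<^bsub>A\<^esub>})"
proof -
  interpret domain A by fact
  show ?thesis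
    by (intro domain_localization.intro domain_localization_axioms.intro domain_axioms)
      (auto simp: integral_iff)
qed

section \<open>Combinations of generators, primes above an ideal, and preimages of primes\<close>

lemma (in cring) idealI_mult:
  assumes "K \<subseteq> carrier R" "\<zero> \<in> K"
    and "\<And>a b. a \<in> K \<Longrightarrow> b \<in> K \<Longrightarrow> a \<oplus> b \<in> K"
    and mult: "\<And>a x. a \<in> K \<Longrightarrow> x \<in> carrier R \<Longrightarrow> x \<otimes> a \<in> K"
  shows "ideal K R"
proof (rule idealI[OF ring_axioms])
  show "subgroup K (add_monoid R)"
  proof (rule group.subgroupI[OF a_group])
    fix a assume "a \<in> K"
    then have "\<ominus> \<one> \<otimes> a \<in> K" by (intro mult) auto
    moreover have "\<ominus> \<one> \<otimes> a = \<ominus> a" using \<open>a \<in> K\<close> assms(1) by (auto simp: l_minus)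
    ultimately show "inv\<^bsub>add_monoid R\<^esub> a \<in> K" by (simp add: a_inv_def)
  qed (use assms in auto)
  fix a x assume "a \<in> K" "x \<in> carrier R"
  then show "x \<otimes> a \<in> K" by (rule mult)
  then show "a \<otimes> x \<in> K" using \<open>a \<in> K\<close> \<open>x \<in> carrier R\<close> assms(1) m_comm by (metis subsetD)
qed

text \<open>The combinations form an ideal that contains the generators. They are indexed by
  \<open>T\<close> and not by ring elements, which suits families with repetitions.\<close>

lemma (in cring) genideal_combination:
  assumes "finite T" "g \<in> T \<rightarrow> carrier R" "x \<in> Idl (g ` T)"
  obtains a where "a \<in> T \<rightarrow> carrier R" "x = (\<Oplus>i\<in>T. a i \<otimes> g i)"
proof -
  define K where "K = {x. \<exists>a\<in>T \<rightarrow> carrier R. x = (\<Oplus>i\<in>T. a i \<otimes> g i)}"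
  have "ideal K R"
  proof (rule idealI_mult)
    show "K \<subseteq> carrier R" using assms(2) by (auto simp: K_def Pi_def intro!: finsum_closed)
    have "(\<Oplus>i\<in>T. \<zero> \<otimes> g i) = (\<Oplus>i\<in>T. \<zero>)"
      using assms(2) by (intro finsum_cong') (auto simp: Pi_def)
    then have "\<zero> = (\<Oplus>i\<in>T. \<zero> \<otimes> g i)" by simp
    then show "\<zero> \<in> K" unfolding K_def by (intro CollectI bexI[of _ "\<lambda>_. \<zero>"]) auto
  next
    fix x y assume "x \<in> K" "y \<in> K"
    then obtain a b where a: "a \<in> T \<rightarrow> carrier R" "x = (\<Oplus>i\<in>T. a i \<otimes> g i)"
      and b: "b \<in> T \<rightarrow> carrier R" "y = (\<Oplus>i\<in>T. b i \<otimes> g i)" by (auto simp: K_def)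
    have "x \<oplus> y = (\<Oplus>i\<in>T. a i \<otimes> g i \<oplus> b i \<otimes> g i)"
      unfolding a b using a(1) b(1) assms(2) by (intro finsum_addf [symmetric]) (auto simp: Pi_def)
    also have "\<dots> = (\<Oplus>i\<in>T. (a i \<oplus> b i) \<otimes> g i)"
      using a(1) b(1) assms(2) by (intro finsum_cong') (auto simp: Pi_def l_distr)
    finally show "x \<oplus> y \<in> K" unfolding K_def using a(1) b(1)
      by (intro CollectI bexI[of _ "\<lambda>i. a i \<oplus> b i"]) (auto simp: Pi_def)
  next
    fix x y assume "x \<in> K" and y: "y \<in> carrier R"
    then obtain a where a: "a \<in> T \<rightarrow> carrier R" "x = (\<Oplus>i\<in>T. a i \<otimes> g i)" by (auto simp: K_def)
    have "y \<otimes> x = (\<Oplus>i\<in>T. y \<otimes> (a i \<otimes> g i))"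
      unfolding a using a(1) y assms by (intro finsum_rdistr) (auto simp: Pi_def)
    also have "\<dots> = (\<Oplus>i\<in>T. (y \<otimes> a i) \<otimes> g i)"
      using a(1) y assms(2) by (intro finsum_cong') (auto simp: Pi_def m_assoc)
    finally show "y \<otimes> x \<in> K" unfolding K_def using a(1) y
      by (intro CollectI bexI[of _ "\<lambda>i. y \<otimes> a i"]) (auto simp: Pi_def)
  qed
  moreover have "g ` T \<subseteq> K"
  proof clarify
    fix j assume j: "j \<in> T"
    have "(\<Oplus>i\<in>T. (if i = j then \<one> else \<zero>) \<otimes> g i) = (\<Oplus>i\<in>T. if j = i then g i else \<zero>)"
      using assms(2) by (intro finsum_cong') (auto simp: Pi_def)
    also have "\<dots> = g j" using j assms(1,2) by (intro finsum_singleton) (auto simp: Pi_def)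
    finally have *: "g j = (\<Oplus>i\<in>T. (if i = j then \<one> else \<zero>) \<otimes> g i)" ..
    have "(\<lambda>i. if i = j then \<one> else \<zero>) \<in> T \<rightarrow> carrier R" by simp
    with * show "g j \<in> K" unfolding K_def
      by (intro CollectI bexI[of _ "\<lambda>i. if i = j then \<one> else \<zero>"])
  qed
  ultimately have "Idl (g ` T) \<subseteq> K" by (rule genideal_minimal)
  then have "x \<in> K" using assms(3) by blast
  then show ?thesis using that unfolding K_def by blast
qed

text \<open>Zorn's lemma for the ideals above \<open>K\<close> without 1: in a Noetherian ring the
  union of a chain of ideals belongs to the chain. A maximal element is a maximal ideal, hence
  prime.\<close>

lemma (in noetherian_ring) exists_prime_above:
  assumes "cring R" "ideal K R" "\<one> \<notin> K"
  obtains p where "primeideal p R" "K \<subseteq> p"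
proof -
  define F where "F = {L. ideal L R \<and> K \<subseteq> L \<and> \<one> \<notin> L}"
  have "\<exists>M\<in>F. \<forall>L\<in>F. M \<subseteq> L \<longrightarrow> L = M"
  proof (rule subset_Zorn_nonempty)
    show "F \<noteq> {}" using assms by (auto simp: F_def)
    fix C assume C: "C \<noteq> {}" "subset.chain F C"
    then have "subset.chain {I. ideal I R} C"
      by (auto simp: subset_chain_def F_def)
    then have "\<Union>C \<in> C" using C by (intro ideal_chain_is_trivial)
    then show "\<Union>C \<in> F" using C by (auto simp: subset_chain_def)
  qed
  then obtain M where M: "ideal M R" "K \<subseteq> M" "\<one> \<notin> M"
    and max: "\<And>L. ideal L R \<Longrightarrow> M \<subseteq> L \<Longrightarrow> \<one> \<notin> L \<Longrightarrow> L = M"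
    by (auto simp: F_def)
  have "maximalideal M R"
  proof (rule maximalidealI[OF M(1)])
    show "carrier R \<noteq> M" using M(3) by auto
    fix L assume L: "ideal L R" "M \<subseteq> L" "L \<subseteq> carrier R"
    show "L = M \<or> L = carrier R"
      using max[OF L(1,2)] ideal.one_imp_carrier[OF L(1)] by blast
  qed
  then have "primeideal M R" by (rule cring.maximalideal_prime[OF assms(1)])
  then show ?thesis using M(2) that by blast
qed

text \<open>Brings the primes of \<open>A\<close> and of its localizations into the setting of
  \<open>prime_set\<close>. As the homomorphism is defined on the whole type, the preimage needs no
  carrier.\<close>

lemma prime_set_vimage:
  fixes \<phi> :: "'a::comm_ring_1 \<Rightarrow> 'b"
  assumes "\<phi> \<in> Ring.ring_hom class_ring R" "primeideal q R"
  shows "prime_set (\<phi> -` q)"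
proof -
  interpret q: primeideal q R by fact
  interpret cring R by (rule q.is_cring)
  have h: "\<phi> x \<in> carrier R" "\<phi> (x + y) = \<phi> x \<oplus>\<^bsub>R\<^esub> \<phi> y" "\<phi> (x * y) = \<phi> x \<otimes>\<^bsub>R\<^esub> \<phi> y" "\<phi> 1 = \<one>\<^bsub>R\<^esub>" for x y
    using assms(1) by (auto simp: Ring.ring_hom_def)
  have "\<phi> 0 \<oplus>\<^bsub>R\<^esub> \<phi> 0 = \<phi> 0" using h(2)[of 0 0] by simp
  then have "\<phi> 0 = \<zero>\<^bsub>R\<^esub>" using h(1) by (metis q.add.l_cancel_one)
  show ?thesis
  proof
    show "0 \<in> \<phi> -` q" using \<open>\<phi> 0 = \<zero>\<^bsub>R\<^esub>\<close> by simp
    show "1 \<notin> \<phi> -` q" using q.I_notcarr q.one_imp_carrier by (auto simp: h(4))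
    fix a b
    show "a + b \<in> \<phi> -` q" if "a \<in> \<phi> -` q" "b \<in> \<phi> -` q" using that by (simp add: h)
    show "a * b \<in> \<phi> -` q" if "b \<in> \<phi> -` q" using that q.I_l_closed[OF _ h(1)] by (simp add: h)
    show "a \<in> \<phi> -` q \<or> b \<in> \<phi> -` q" if "a * b \<in> \<phi> -` q"
      using that q.I_prime[OF h(1) h(1)] by (simp add: h)
  qed
qed

context domain_localization
begin

lemma extended_ideal:
  assumes "ideal K A"
  shows "ideal {frac a s | a s. a \<in> K \<and> s \<in> S} loc"
proof -
  interpret K: ideal K A by fact
  have Kc: "a \<in> carrier A" if "a \<in> K" for a using that K.a_subset by auto
  show ?thesis
  proof (rule cring.idealI_mult[OF cring_loc])
    show "{frac a s | a s. a \<in> K \<and> s \<in> S} \<subseteq> carrier loc" using Kc frac_closed by auto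
    show "\<zero>\<^bsub>loc\<^esub> \<in> {frac a s | a s. a \<in> K \<and> s \<in> S}" unfolding loc_zero using S_one K.zero_closed by blast
  next
    fix x y assume "x \<in> {frac a s | a s. a \<in> K \<and> s \<in> S}" "y \<in> {frac a s | a s. a \<in> K \<and> s \<in> S}"
    then obtain a s b t where a: "a \<in> K" "s \<in> S" "x = frac a s" and b: "b \<in> K" "t \<in> S" "y = frac b t" by blast
    then have "x \<oplus>\<^bsub>loc\<^esub> y = frac (t \<otimes> a \<oplus> s \<otimes> b) (s \<otimes> t)" using Kc by (simp add: frac_add)
    moreover have "t \<otimes> a \<oplus> s \<otimes> b \<in> K" using a b by (simp add: K.a_closed K.I_l_closed)
    ultimately show "x \<oplus>\<^bsub>loc\<^esub> y \<in> {frac a s | a s. a \<in> K \<and> s \<in> S}" using S_mult[OF a(2) b(2)] by blast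
  next
    fix x y assume "x \<in> {frac a s | a s. a \<in> K \<and> s \<in> S}" "y \<in> carrier loc"
    then obtain a s b t where a: "a \<in> K" "s \<in> S" "x = frac a s" and b: "b \<in> carrier A" "t \<in> S" "y = frac b t"
      by (auto simp: carrier_loc)
    then have "y \<otimes>\<^bsub>loc\<^esub> x = frac (b \<otimes> a) (t \<otimes> s)" using Kc by (simp add: frac_mult)
    moreover have "b \<otimes> a \<in> K" using a b by (simp add: K.I_l_closed)
    ultimately show "y \<otimes>\<^bsub>loc\<^esub> x \<in> {frac a s | a s. a \<in> K \<and> s \<in> S}" using S_mult[OF b(2) a(2)] by blast
  qed
qed

lemma frac_mem_prime:
  assumes "primeideal q loc" "a \<in> carrier A" "s \<in> S"
  shows "frac a s \<in> q \<longleftrightarrow> frac a \<one> \<in> q" "a \<in> S \<Longrightarrow> frac a s \<notin> q"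
proof -
  interpret q: primeideal q loc by (rule assms)
  interpret L: cring loc by (rule cring_loc)
  have "frac a s = frac \<one> s \<otimes>\<^bsub>loc\<^esub> frac a \<one>" using assms S_one by (simp add: frac_mult)
  then show *: "frac a s \<in> q \<longleftrightarrow> frac a \<one> \<in> q"
    using frac_split[OF assms(2,3)] q.I_l_closed assms S_one by (metis S_closed frac_closed one_closed)
  show "frac a s \<notin> q" if "a \<in> S"
  proof
    assume "frac a s \<in> q"
    then have "frac \<one> a \<otimes>\<^bsub>loc\<^esub> frac a \<one> \<in> q" using * that by (intro q.I_l_closed) (auto intro: frac_closed)
    moreover have "frac \<one> a \<otimes>\<^bsub>loc\<^esub> frac a \<one> = \<one>\<^bsub>loc\<^esub>"
      using that S_one by (simp add: frac_mult loc_one frac_eq)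
    ultimately show False using q.one_imp_carrier q.I_notcarr by simp
  qed
qed

text \<open>The maximal ideal of the local ring is the extension of \<open>p\<close>. Numerators of
  its generators therefore lie in \<open>p\<close> and generate \<open>p\<close> up to multipliers
  from \<open>S\<close>.\<close>

lemma local_generators:
  assumes S: "S = carrier A - p" and p: "primeideal p A"
    and B: "B \<subseteq> carrier loc" "finite B" "maximalideal (Idl\<^bsub>loc\<^esub> B) loc"
  obtains G where "G \<subseteq> p" "finite G" "card G \<le> card B" "\<And>h. h \<in> p \<Longrightarrow> \<exists>t\<in>S. t \<otimes> h \<in> Idl G"
proof -
  interpret p: primeideal p A by fact
  interpret M: maximalideal "Idl\<^bsub>loc\<^esub> B" loc by fact
  interpret L: cring loc by (rule cring_loc)
  have M: "primeideal (Idl\<^bsub>loc\<^esub> B) loc" by (rule L.maximalideal_prime[OF B(3)])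
  have Mp: "\<exists>a\<in>p. \<exists>s\<in>S. x = frac a s" if x: "x \<in> Idl\<^bsub>loc\<^esub> B" for x
  proof -
    obtain a s where a: "a \<in> carrier A" "s \<in> S" "x = frac a s"
      using x M.a_subset carrier_loc by blast
    then have "a \<notin> S" using frac_mem_prime(2)[OF M a(1,2)] x by blast
    then show ?thesis using a S by blast
  qed
  define E where "E K = {frac a s | a s. a \<in> K \<and> s \<in> S}" for K
  \<comment> \<open>The extension of \<open>p\<close> is proper and contains the maximal ideal,
    whose elements are not units and so have numerators in \<open>p\<close>.\<close>
  have "Idl\<^bsub>loc\<^esub> B = E p"
  proof -
    have "ideal (E p) loc" unfolding E_def by (rule extended_ideal) (rule p.is_ideal)
    moreover have "Idl\<^bsub>loc\<^esub> B \<subseteq> E p" using Mp by (auto simp: E_def)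
    moreover have "E p \<noteq> carrier loc"
    proof
      assume "E p = carrier loc"
      then have "\<one>\<^bsub>loc\<^esub> \<in> E p" by simp
      then obtain a s where a: "a \<in> p" "s \<in> S" "frac \<one> \<one> = frac a s" by (auto simp: E_def loc_one)
      then have "s = a" using S_one p.a_subset by (auto simp: frac_eq)
      then show False using a S by blast
    qed
    ultimately show ?thesis using M.I_maximal[of "E p"] ideal.axioms additive_subgroup.a_subset by metis
  qed
  obtain num den where nd: "\<And>x. x \<in> Idl\<^bsub>loc\<^esub> B \<Longrightarrow> num x \<in> p \<and> den x \<in> S \<and> x = frac (num x) (den x)"
    using Mp by metis
  have BM: "b \<in> Idl\<^bsub>loc\<^esub> B" if "b \<in> B" for b using M.genideal_self[OF B(1)] that by blast
  define G where "G = num ` B"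
  have Gp: "G \<subseteq> p" using nd BM by (auto simp: G_def)
  then have Gc: "G \<subseteq> carrier A" using p.a_subset by blast
  have "ideal (E (Idl G)) loc" unfolding E_def by (rule extended_ideal) (rule genideal_ideal[OF Gc])
  moreover have "B \<subseteq> E (Idl G)"
  proof
    fix b assume b: "b \<in> B"
    then have "num b \<in> Idl G" using genideal_self[OF Gc] by (auto simp: G_def)
    then show "b \<in> E (Idl G)" using nd[OF BM[OF b]] by (auto simp: E_def)
  qed
  ultimately have sub: "Idl\<^bsub>loc\<^esub> B \<subseteq> E (Idl G)" by (rule M.genideal_minimal)
  have "\<exists>t\<in>S. t \<otimes> h \<in> Idl G" if "h \<in> p" for h
  proof -
    have hc: "h \<in> carrier A" using that p.a_subset by blast
    have "frac h \<one> \<in> E p" using that S_one by (auto simp: E_def)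
    then have "frac h \<one> \<in> E (Idl G)" using sub \<open>Idl\<^bsub>loc\<^esub> B = E p\<close> by blast
    then obtain a t where a: "a \<in> Idl G" "t \<in> S" "frac h \<one> = frac a t" by (auto simp: E_def)
    moreover have "a \<in> carrier A"
      using a(1) genideal_ideal[OF Gc] by (meson additive_subgroup.a_Hcarr ideal_def)
    ultimately have "t \<otimes> h = a" using hc S_one by (simp add: frac_eq)
    then show ?thesis using a by auto
  qed
  moreover have "finite G" "card G \<le> card B" using B(2) by (auto simp: G_def card_image_le)
  ultimately show ?thesis using that Gp by blast
qed

end

text \<open>A finite supremum of a nonempty set of extended natural numbers is attained. Positivity
  of \<open>d\<close> excludes the empty set, whose supremum is 0.\<close>

lemma krull_dim_chain:
  assumes "krull_dim R = enat d" "0 < d"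
  obtains q where "\<And>k. k \<le> d \<Longrightarrow> primeideal (q k) R" "\<And>k. k < d \<Longrightarrow> q k \<subset> q (Suc k)"
proof -
  let ?X = "{enat k | k. \<exists>p. (\<forall>i\<le>k. primeideal (p i) R) \<and> (\<forall>i<k. p i \<subset> p (Suc i))}"
  have sup: "Sup ?X = enat d" using assms(1) by (simp add: krull_dim_def)
  have mem: "enat d \<in> X" if X: "Sup X = enat d" for X :: "enat set"
  proof -
    have "X \<noteq> {}" using X assms(2) by (auto simp: bot_enat_def enat_0_iff)
    moreover have "finite X" using X calculation by (metis Sup_enat_def enat.distinct(1))
    ultimately have "Sup X = Max X" "Max X \<in> X" by (simp_all add: Sup_enat_def)
    then show ?thesis using X by simp
  qed
  obtain q where "\<forall>i\<le>d. primeideal (q i) R" "\<forall>i<d. q i \<subset> q (Suc i)" using mem[OF sup] by auto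
  then show ?thesis using that[of q] by simp
qed

text \<open>Read from the top prime downwards, each strict inclusion frees one more variable. This
  bounds the length of a chain by the gain in independent variables.\<close>

lemma chain_independent:
  fixes P :: "nat \<Rightarrow> 'k::field mpol set"
  assumes "\<And>k. k \<le> d \<Longrightarrow> prime_set (P k)" "\<And>k. k < d \<Longrightarrow> P k \<inter> mpol_in N \<subset> P (Suc k) \<inter> mpol_in N"
    and "finite N" "U \<subseteq> N" "P d \<inter> mpol_in U \<subseteq> {0}"
  shows "\<exists>W\<subseteq>N. card W = card U + d \<and> P 0 \<inter> mpol_in W \<subseteq> {0}"
  using assms
proof (induction d arbitrary: U)
  case 0
  then show ?case by auto
next
  case (Suc d)
  obtain i where i: "i \<in> N - U" "P d \<inter> mpol_in (insert i U) \<subseteq> {0}"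
    using extend_independent[of "P d" "P (Suc d)" N U] Suc.prems by auto
  have "finite U" using Suc.prems finite_subset by blast
  then have "card (insert i U) = Suc (card U)" using i by simp
  then show ?case using Suc.IH[of "insert i U"] Suc.prems i by auto
qed

lemma (in prime_set) vspan_minor_vanish:
  assumes "s < t" "\<And>i. i < t \<Longrightarrow> vspan N w s (v i)" "\<And>j. j < t \<Longrightarrow> js j \<in> N"
  shows "det (mat t t (\<lambda>(i, j). v i (js j))) \<in> P"
proof -
  obtain t' where t: "t = Suc t'" using assms(1) by (cases t) auto
  have "vspan N w t' (v i)" if "i < t" for i
    using assms(2)[OF that]
  proof (rule vspan_trans)
    fix i assume "i < s"
    then show "vspan N w t' (w i)" using t assms(1) by (intro vspan_base) simp
  qed
  then show ?thesis unfolding t using assms(3) t by (intro vspan_minor[of t' N w v js]) auto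
qed

section \<open>The Jacobian criterion\<close>

text \<open>The simplifier would rewrite the index set \<open>{1..n}\<close> to \<open>{Suc 0..n}\<close>.\<close>
declare One_nat_def [simp del]

lemma cring_poly_ring_n: "cring (poly_ring_n n :: 'k::field mpol ring)"
proof (rule cringI)
  show "abelian_group (poly_ring_n n :: 'k mpol ring)"
  proof (rule abelian_groupI)
    fix x :: "'k mpol" assume "x \<in> carrier (poly_ring_n n)"
    then show "\<exists>y\<in>carrier (poly_ring_n n). y \<oplus>\<^bsub>poly_ring_n n\<^esub> x = \<zero>\<^bsub>poly_ring_n n\<^esub>"
      unfolding carrier_poly_ring_n by (intro bexI[of _ "- x"]) (auto simp: poly_ring_n_def mpol_in_uminus)
  qed (unfold carrier_poly_ring_n, auto simp: poly_ring_n_def mpol_in_add add_ac)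
  show "comm_monoid (poly_ring_n n :: 'k mpol ring)"
    by (rule comm_monoidI; unfold carrier_poly_ring_n)
      (auto simp: poly_ring_n_def mpol_in_mult mult_ac)
qed (auto simp: poly_ring_n_def distrib_right)

lemma poly_ring_n_simps:
  "\<zero>\<^bsub>poly_ring_n n\<^esub> = 0" "\<one>\<^bsub>poly_ring_n n\<^esub> = 1" "x \<oplus>\<^bsub>poly_ring_n n\<^esub> y = x + y"
  "x \<otimes>\<^bsub>poly_ring_n n\<^esub> y = x * y"
  by (simp_all add: poly_ring_n_def)

definition minor_poly :: "(nat \<Rightarrow> 'k::field mpol) \<Rightarrow> nat list \<Rightarrow> nat list \<Rightarrow> 'k mpol" where
  "minor_poly f is js = det (mat (length is) (length is) (\<lambda>(i, j). mpol_diff (js ! j) (f (is ! i))))"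

locale affine_domain =
  fixes n m :: nat and f :: "nat \<Rightarrow> 'k::field_char_0 mpol"
  assumes f_in: "i \<in> {1..m} \<Longrightarrow> f i \<in> mpol_in {1..n}"
    and prime_I: "primeideal (gen_ideal n m f) (poly_ring_n n)"
begin

abbreviation "N \<equiv> {1..n}"
abbreviation "A \<equiv> aff_alg n m f"
abbreviation "I \<equiv> gen_ideal n m f"

text \<open>
  Setting the variables outside \<open>{1..n}\<close> to zero extends the residue map to a ring homomorphism on the
  whole type of polynomials, which removes all carrier conditions.
\<close>
definition cls :: "'k mpol \<Rightarrow> 'k mpol set" where
  "cls p = residue_class n m f (mpol_restrict N p)"

sublocale Pn: cring "poly_ring_n n :: 'k mpol ring" by (rule cring_poly_ring_n)
sublocale I: primeideal I "poly_ring_n n" by (rule prime_I)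
sublocale A: domain A unfolding aff_alg_def by (rule I.quotient_is_domain)

lemma residue_class_hom: "residue_class n m f \<in> Ring.ring_hom (poly_ring_n n) A"
  using I.rcos_ring_hom by (simp add: aff_alg_def residue_class_def [abs_def])

lemma restrict_carrier [simp]: "mpol_restrict N p \<in> carrier (poly_ring_n n)"
  by (simp add: carrier_poly_ring_n)

lemma cls_hom: "cls \<in> Ring.ring_hom class_ring A"
proof (rule ring_hom_memI)
  note h = residue_class_hom
  fix x y :: "'k mpol"
  show "cls x \<in> carrier A" unfolding cls_def by (rule ring_hom_closed[OF h restrict_carrier])
  show "cls (x \<otimes>\<^bsub>class_ring\<^esub> y) = cls x \<otimes>\<^bsub>A\<^esub> cls y"
    using ring_hom_mult[OF h restrict_carrier restrict_carrier, of x y]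
    by (simp add: cls_def mpol_restrict_mult poly_ring_n_simps)
  show "cls (x \<oplus>\<^bsub>class_ring\<^esub> y) = cls x \<oplus>\<^bsub>A\<^esub> cls y"
    using ring_hom_add[OF h restrict_carrier restrict_carrier, of x y]
    by (simp add: cls_def mpol_restrict_add poly_ring_n_simps)
  show "cls \<one>\<^bsub>class_ring\<^esub> = \<one>\<^bsub>A\<^esub>"
    using ring_hom_one[OF h] by (simp add: cls_def poly_ring_n_simps)
qed

lemma cls_closed [simp]: "cls p \<in> carrier A"
  and cls_add: "cls (p + q) = cls p \<oplus>\<^bsub>A\<^esub> cls q"
  and cls_mult: "cls (p * q) = cls p \<otimes>\<^bsub>A\<^esub> cls q"
  and cls_1: "cls 1 = \<one>\<^bsub>A\<^esub>"
  using cls_hom by (auto simp: Ring.ring_hom_def)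

lemma cls_0: "cls 0 = \<zero>\<^bsub>A\<^esub>"
proof -
  have "cls 0 \<oplus>\<^bsub>A\<^esub> cls 0 = cls 0" using cls_add[of 0 0] by simp
  then show ?thesis using cls_closed by (metis A.add.l_cancel_one)
qed

lemma cls_uminus: "cls (- p) = \<ominus>\<^bsub>A\<^esub> cls p"
  using cls_add[of "- p" p] by (intro A.minus_equality [symmetric]) (simp_all add: cls_0)

lemma cls_diff: "cls (p - q) = cls p \<ominus>\<^bsub>A\<^esub> cls q"
  using cls_add[of p "- q"] by (simp add: cls_uminus A.minus_eq)

lemma cls_sum: "cls (sum g S) = (\<Oplus>\<^bsub>A\<^esub>x\<in>S. cls (g x))"
  by (induction S rule: infinite_finite_induct) (simp_all add: cls_0 cls_add)

lemma cls_prod: "cls (prod g S) = (\<Otimes>\<^bsub>A\<^esub>x\<in>S. cls (g x))"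
  by (induction S rule: infinite_finite_induct) (simp_all add: cls_1 cls_mult)

lemma cls_eq: "p \<in> mpol_in N \<Longrightarrow> cls p = residue_class n m f p"
  by (simp add: cls_def mpol_restrict_id)

lemma cls_restrict: "cls (mpol_restrict N p) = cls p"
  by (simp add: cls_def mpol_restrict_id)

lemma cls_surj:
  assumes "x \<in> carrier A"
  obtains p where "p \<in> mpol_in N" "x = cls p"
proof -
  obtain p where "p \<in> carrier (poly_ring_n n)" "x = residue_class n m f p"
    using assms by (auto simp: aff_alg_def residue_class_def FactRing_def A_RCOSETS_def')
  then show ?thesis using that[of p] by (simp add: carrier_poly_ring_n cls_eq)
qed

lemma cls_eq_0_iff: "cls p = \<zero>\<^bsub>A\<^esub> \<longleftrightarrow> mpol_restrict N p \<in> I"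
proof -
  have "\<zero>\<^bsub>A\<^esub> = I" by (simp add: aff_alg_def FactRing_def)
  then show ?thesis
    unfolding cls_def residue_class_def
    by (metis I.a_rcos_const I.a_rcos_self restrict_carrier)
qed

text \<open>The kernel of \<open>cls\<close>, which is the ideal generated by \<open>I\<close> and
  the variables outside \<open>N\<close>. Every equation in \<open>A\<close> becomes a congruence
  modulo this set.\<close>

definition Iext :: "'k mpol set" where "Iext = {p. cls p = \<zero>\<^bsub>A\<^esub>}"

sublocale Iext: prime_set Iext
proof -
  have "Iext = cls -` {\<zero>\<^bsub>A\<^esub>}" by (auto simp: Iext_def)
  then show "prime_set Iext" using prime_set_vimage[OF cls_hom A.zeroprimeideal] by simp
qed

lemma gen_ideal_combination:
  assumes "p \<in> I"
  shows "\<exists>a. p = (\<Sum>i\<in>{1..m}. a i * f i)"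
proof -
  have f: "f \<in> {1..m} \<rightarrow> carrier (poly_ring_n n)" using f_in by (auto simp: carrier_poly_ring_n)
  obtain a where a: "a \<in> {1..m} \<rightarrow> carrier (poly_ring_n n)"
      "p = (\<Oplus>\<^bsub>poly_ring_n n\<^esub>i\<in>{1..m}. a i \<otimes>\<^bsub>poly_ring_n n\<^esub> f i)"
    using Pn.genideal_combination[OF _ f, of p] assms unfolding gen_ideal_def by blast
  have "(\<Oplus>\<^bsub>poly_ring_n n\<^esub>i\<in>S. a i \<otimes>\<^bsub>poly_ring_n n\<^esub> f i) = (\<Sum>i\<in>S. a i * f i)"
    if "S \<subseteq> {1..m}" for S
  proof -
    have "finite S" using that finite_subset by blast
    then show ?thesis using that
    proof (induction S rule: finite_induct)
      case (insert i S)
      have 1: "(\<lambda>i. a i \<otimes>\<^bsub>poly_ring_n n\<^esub> f i) \<in> S \<rightarrow> carrier (poly_ring_n n)"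
        and 2: "a i \<otimes>\<^bsub>poly_ring_n n\<^esub> f i \<in> carrier (poly_ring_n n)"
        using insert.prems a(1) f by (auto simp: Pi_def)
      from Pn.finsum_insert[OF insert.hyps 1 2] insert show ?case
        by (simp add: poly_ring_n_simps)
    qed (simp add: poly_ring_n_simps)
  qed
  from this[of "{1..m}"] a have "p = (\<Sum>i\<in>{1..m}. a i * f i)" by simp
  then show ?thesis by blast
qed

lemma f_Iext:
  assumes "i \<in> {1..m}"
  shows "f i \<in> Iext"
proof -
  have "f ` {1..m} \<subseteq> carrier (poly_ring_n n)" using f_in by (auto simp: carrier_poly_ring_n)
  then have "f i \<in> I" unfolding gen_ideal_def using Pn.genideal_self assms by blast
  then show ?thesis using f_in[OF assms] by (simp add: Iext_def cls_eq_0_iff mpol_restrict_id)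
qed

lemma Iext_combination:
  assumes "p \<in> Iext" "p \<in> mpol_in N"
  shows "\<exists>a. p = (\<Sum>i\<in>{1..m}. a i * f i)"
  using assms gen_ideal_combination[of p] by (simp add: Iext_def cls_eq_0_iff mpol_restrict_id)

text \<open>Both determinants are given by the Leibniz formula, which a ring homomorphism respects.
  Minors can thus be handled as determinants of polynomials.\<close>

lemma minor_eq_cls:
  assumes "set is \<subseteq> {1..m}"
  shows "minor n m f is js = cls (minor_poly f is js)"
proof -
  let ?k = "length is"
  have lt: "p i < ?k" if "p permutes {0..<?k}" "i < ?k" for p i
    using permutes_in_image[OF that(1), of i] that(2) by simp
  have jac: "jacobi n m f (is ! i) j = cls (mpol_diff j (f (is ! i)))" if "i < ?k" for i j
    using that assms f_in by (simp add: jacobi_def cls_eq mpol_in_diff_mpol subset_iff)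
  have "cls (minor_poly f is js) =
      (\<Oplus>\<^bsub>A\<^esub>p\<in>{p. p permutes {0..<?k}}. cls (signof p) \<otimes>\<^bsub>A\<^esub> (\<Otimes>\<^bsub>A\<^esub>i\<in>{0..<?k}. cls (mpol_diff (js ! p i) (f (is ! i)))))"
  proof -
    have "minor_poly f is js =
      (\<Sum>p\<in>{p. p permutes {0..<?k}}. signof p * (\<Prod>i = 0..<?k. mpol_diff (js ! p i) (f (is ! i))))"
      unfolding minor_poly_def by (subst det_def'[of _ ?k]) (auto intro!: sum.cong prod.cong simp: lt)
    then show ?thesis by (simp only: cls_sum cls_mult cls_prod)
  qed
  also have "\<dots> = minor n m f is js"
    unfolding minor_def ring_det_def lessThan_atLeast0
  proof (rule A.finsum_cong')
    fix p assume p: "p \<in> {p. p permutes {0..<?k}}"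
    have "cls (signof p) = (if evenperm p then \<one>\<^bsub>A\<^esub> else \<ominus>\<^bsub>A\<^esub> \<one>\<^bsub>A\<^esub>)"
      by (simp add: sign_def cls_1 cls_uminus)
    moreover have "(\<Otimes>\<^bsub>A\<^esub>i\<in>{0..<?k}. cls (mpol_diff (js ! p i) (f (is ! i)))) =
        (\<Otimes>\<^bsub>A\<^esub>i\<in>{0..<?k}. jacobi n m f (is ! i) (js ! p i))"
      by (rule A.finprod_cong') (auto simp: jac)
    ultimately show "cls (signof p) \<otimes>\<^bsub>A\<^esub> (\<Otimes>\<^bsub>A\<^esub>i\<in>{0..<?k}. cls (mpol_diff (js ! p i) (f (is ! i)))) =
        (if evenperm p then \<one>\<^bsub>A\<^esub> else \<ominus>\<^bsub>A\<^esub> \<one>\<^bsub>A\<^esub>) \<otimes>\<^bsub>A\<^esub> (\<Otimes>\<^bsub>A\<^esub>i\<in>{0..<?k}. jacobi n m f (is ! i) (js ! p i))"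
      by simp
  next
    have "(\<Otimes>\<^bsub>A\<^esub>i\<in>{0..<?k}. jacobi n m f (is ! i) (js ! p i)) \<in> carrier A" for p
      by (rule A.finprod_closed) (auto simp: jac)
    then show "(\<lambda>p. (if evenperm p then \<one>\<^bsub>A\<^esub> else \<ominus>\<^bsub>A\<^esub> \<one>\<^bsub>A\<^esub>) \<otimes>\<^bsub>A\<^esub> (\<Otimes>\<^bsub>A\<^esub>i\<in>{0..<?k}. jacobi n m f (is ! i) (js ! p i)))
        \<in> {p. p permutes {0..<?k}} \<rightarrow> carrier A" by auto
  qed simp
  finally show ?thesis ..
qed

text \<open>If all minors of size \<open>r\<close> lay in \<open>p\<close>, the gradients of the
  generators would be spanned by \<open>s < r\<close> vectors modulo \<open>P\<close>, and those of
  all of \<open>P\<close> by \<open>s + card G\<close> vectors, where \<open>card G \<le> d\<close>.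
  The nonvanishing minor belonging to \<open>U\<close> then gives
  \<open>n - card U \<le> s + d\<close>. A chain of length \<open>d\<close> in the local ring yields
  \<open>card U + d\<close> independent variables modulo \<open>I\<close>, so
  \<open>r \<le> n - card U - d\<close>, a contradiction.\<close>

proposition jacobian_criterion:
  assumes reg: "regular_ring A" and p: "primeideal p A"
    and rank: "length is0 = r" "set is0 \<subseteq> {1..m}" "length js0 = r" "set js0 \<subseteq> N"
      "minor n m f is0 js0 \<noteq> \<zero>\<^bsub>A\<^esub>"
  obtains "is" js where "length is = r" "set is \<subseteq> {1..m}" "length js = r" "set js \<subseteq> N"
    "minor n m f is js \<notin> p"
proof (rule ccontr)
  note wit = that
  assume neg: "\<not> thesis"
  interpret p: primeideal p A by (rule p)
  define S where "S = carrier A - p"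
  interpret domain_localization A S
  proof
    show "S \<subseteq> carrier A" by (auto simp: S_def)
    show "\<one>\<^bsub>A\<^esub> \<in> S" using p.I_notcarr p.one_imp_carrier by (auto simp: S_def)
    show "\<zero>\<^bsub>A\<^esub> \<notin> S" by (simp add: S_def)
    show "s \<otimes>\<^bsub>A\<^esub> t \<in> S" if "s \<in> S" "t \<in> S" for s t
      using that p.I_prime by (auto simp: S_def)
  qed
  define P where "P = cls -` p"
  interpret P: prime_set P unfolding P_def by (rule prime_set_vimage[OF cls_hom p])
  have IP: "Iext \<subseteq> P" by (auto simp: Iext_def P_def)
  have regl: "regular_local_ring loc" using reg p by (simp add: regular_ring_def S_def)
  obtain M where M: "\<And>M'. maximalideal M' loc \<longleftrightarrow> M' = M"
      "\<exists>B\<subseteq>carrier loc. finite B \<and> Idl\<^bsub>loc\<^esub> B = M \<and> enat (card B) = krull_dim loc"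
    using regl unfolding regular_local_ring_def by blast
  obtain B where B: "B \<subseteq> carrier loc" "finite B" "Idl\<^bsub>loc\<^esub> B = M" "enat (card B) = krull_dim loc"
    using M(2) by blast
  define d where "d = card B"
  have Bmax: "maximalideal (Idl\<^bsub>loc\<^esub> B) loc" using M(1) B(3) by simp
  obtain G where G: "G \<subseteq> p" "finite G" "card G \<le> d" "\<And>h. h \<in> p \<Longrightarrow> \<exists>t\<in>S. t \<otimes>\<^bsub>A\<^esub> h \<in> Idl\<^bsub>A\<^esub> G"
    using local_generators[OF S_def p B(1,2) Bmax] unfolding d_def by blast
  obtain U h js where U: "U \<subseteq> N" "P \<inter> mpol_in U \<subseteq> {0}"
    "\<And>i. i < card (N - U) \<Longrightarrow> h i \<in> P \<inter> mpol_in N" "\<And>i. i < card (N - U) \<Longrightarrow> js i \<in> N"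
    "det (mat (card (N - U)) (card (N - U)) (\<lambda>(i, j). mpol_diff (js j) (h i))) \<notin> P"
    using grad_minor[OF P.prime_set_axioms, of N] by auto
  obtain W where W: "W \<subseteq> N" "card W = card U + d" "Iext \<inter> mpol_in W \<subseteq> {0}"
  \<comment> \<open>In dimension 0 no chain has to be climbed: \<open>U\<close> is independent
    modulo \<open>P\<close> and hence modulo the smaller \<open>Iext\<close>.\<close>
  proof (cases "d = 0")
    case True
    then show ?thesis using that[of U] U(1,2) IP by auto
  next
    case False
    obtain q where q: "\<And>k. k \<le> d \<Longrightarrow> primeideal (q k) loc" "\<And>k. k < d \<Longrightarrow> q k \<subset> q (Suc k)"
      using krull_dim_chain[of loc d] B(4) False by (auto simp: d_def)
    define \<phi> where "\<phi> p = frac (cls p) \<one>\<^bsub>A\<^esub>" for p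
    have \<phi>: "\<phi> \<in> Ring.ring_hom class_ring loc"
      using ring_hom_trans[OF cls_hom frac_one_hom] by (simp add: \<phi>_def [abs_def] comp_def)
    have \<phi>r: "\<phi> (mpol_restrict N p) = \<phi> p" for p by (simp add: \<phi>_def cls_restrict)
    have prime: "prime_set (\<phi> -` q k)" if "k \<le> d" for k
      by (rule prime_set_vimage[OF \<phi> q(1)[OF that]])
    \<comment> \<open>A fraction belongs to a prime together with its numerator, and every element
      of \<open>A\<close> is the class of a polynomial in the variables from \<open>N\<close>. So
      the inclusions stay strict after pulling back and intersecting with
      \<open>mpol_in N\<close>.\<close>
    have strict: "(\<phi> -` q k) \<inter> mpol_in N \<subset> (\<phi> -` q (Suc k)) \<inter> mpol_in N" if k: "k < d" for k
    proof -
      obtain x where x: "x \<in> q (Suc k)" "x \<notin> q k" using q(2)[OF k] by auto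
      have pq: "primeideal (q (Suc k)) loc" "primeideal (q k) loc" using q(1) k by auto
      then have "x \<in> carrier loc" using x(1)
        by (meson additive_subgroup.a_Hcarr ideal_def primeideal.axioms(1))
      then obtain a s where a: "a \<in> carrier A" "s \<in> S" "x = frac a s" by (auto simp: carrier_loc)
      have "frac a \<one>\<^bsub>A\<^esub> \<in> q (Suc k)" "frac a \<one>\<^bsub>A\<^esub> \<notin> q k"
        using frac_mem_prime(1)[OF pq(1) a(1,2)] frac_mem_prime(1)[OF pq(2) a(1,2)] x a(3) by auto
      moreover obtain p where "p \<in> mpol_in N" "a = cls p" using cls_surj[OF a(1)] .
      ultimately have "p \<in> \<phi> -` q (Suc k)" "p \<notin> \<phi> -` q k" "p \<in> mpol_in N" by (auto simp: \<phi>_def)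
      then show ?thesis using q(2)[OF k] by blast
    qed
    \<comment> \<open>A prime of the local ring contains no unit, so no class from \<open>S\<close>
      is mapped into it.\<close>
    have "\<phi> -` q d \<subseteq> P"
    proof
      fix x assume "x \<in> \<phi> -` q d"
      then have "cls x \<notin> S" using frac_mem_prime(2)[OF q(1)[of d], of "cls x" "\<one>\<^bsub>A\<^esub>"] S_one
        by (auto simp: \<phi>_def)
      then show "x \<in> P" by (simp add: S_def P_def)
    qed
    then have "(\<phi> -` q d) \<inter> mpol_in U \<subseteq> {0}" using U(2) by blast
    then obtain W where W: "W \<subseteq> N" "card W = card U + d" "(\<phi> -` q 0) \<inter> mpol_in W \<subseteq> {0}"
      using chain_independent[of d "\<lambda>k. \<phi> -` q k" N U] prime strict U(1) by auto
    have "Iext \<subseteq> \<phi> -` q 0"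
    proof
      fix x assume "x \<in> Iext"
      then have "\<phi> x = \<zero>\<^bsub>loc\<^esub>" by (simp add: Iext_def \<phi>_def loc_zero)
      moreover have "\<zero>\<^bsub>loc\<^esub> \<in> q 0"
        using q(1)[of 0] by (simp add: additive_subgroup.zero_closed ideal_def primeideal_def)
      ultimately show "x \<in> \<phi> -` q 0" by simp
    qed
    then show ?thesis using that[of W] W by blast
  qed
  have finU: "finite U" "finite W" using U(1) W(1) finite_subset by blast+
  have NU: "card (N - U) = n - card U" and NW: "card (N - W) = n - card W"
    using U(1) W(1) finU by (simp_all add: card_Diff_subset)
  have "card W \<le> n" using W(1) card_mono[of N W] by simp
  \<comment> \<open>Over the field of fractions of \<open>A\<close>, the gradients of
    \<open>I\<close> are spanned by \<open>n - card W\<close> vectors, while a minor of size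
    \<open>r\<close> does not vanish there.\<close>
  have rle: "r \<le> n - card W"
  proof (rule ccontr)
    assume *: "\<not> r \<le> n - card W"
    obtain w where w: "\<And>h. h \<in> Iext \<Longrightarrow> h \<in> mpol_in N \<Longrightarrow> Iext.vspan N w (card (N - W)) (grad h)"
      using grad_vspan[OF Iext.prime_set_axioms W(3), of "N - W" N] W(1) by (auto simp: Un_absorb1)
    have "det (mat r r (\<lambda>(i, j). grad (f (is0 ! i)) (js0 ! j))) \<in> Iext"
    proof (rule Iext.vspan_minor_vanish[where N = N and w = w and s = "card (N - W)"])
      show "card (N - W) < r" using * NW by simp
      show "Iext.vspan N w (card (N - W)) (grad (f (is0 ! i)))" if "i < r" for i
        using that rank(1,2) f_Iext f_in by (intro w) (auto simp: subset_iff)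
      show "js0 ! j \<in> N" if "j < r" for j using that rank(3,4) by (auto simp: subset_iff)
    qed
    then have "cls (minor_poly f is0 js0) = \<zero>\<^bsub>A\<^esub>" by (simp add: Iext_def minor_poly_def rank(1))
    then show False using rank(5) minor_eq_cls[OF rank(2)] by simp
  qed
  have vanish: "det (mat r r (\<lambda>(i, j). v i (js j))) \<in> P"
    if v: "\<And>i. i < r \<Longrightarrow> v i \<in> (\<lambda>i. grad (f i)) ` {1..m}" and js: "\<And>j. j < r \<Longrightarrow> js j \<in> N" for v js
  proof -
    have "\<forall>i. \<exists>k. i < r \<longrightarrow> k \<in> {1..m} \<and> v i = grad (f k)"
    proof
      fix i
      show "\<exists>k. i < r \<longrightarrow> k \<in> {1..m} \<and> v i = grad (f k)"
      proof (cases "i < r")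
        case True
        from v[OF True] obtain k where "v i = grad (f k)" "k \<in> {1..m}" by (rule imageE)
        then show ?thesis by (intro exI[of _ k]) simp
      qed simp
    qed
    from choice[OF this] obtain k where k: "\<And>i. i < r \<Longrightarrow> k i \<in> {1..m} \<and> v i = grad (f (k i))" by auto
    define ks where "ks = map k [0..<r]"
    define ls where "ls = map js [0..<r]"
    have ks: "length ks = r" "set ks \<subseteq> {1..m}" "length ls = r" "set ls \<subseteq> N"
      using k js by (auto simp: ks_def ls_def)
    have "cls (minor_poly f ks ls) \<in> p"
      using wit[OF ks] neg minor_eq_cls[OF ks(2)] by auto
    moreover have "minor_poly f ks ls = det (mat r r (\<lambda>(i, j). v i (js j)))"
      unfolding minor_poly_def ks(1)
      by (rule arg_cong[of _ _ det], rule eq_matI) (use k in \<open>auto simp: ks_def ls_def\<close>)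
    ultimately show ?thesis by (simp add: P_def)
  qed
  let ?H = "(\<lambda>i. grad (f i)) ` {1..m}"
  have "\<exists>s w. s < r \<and> (\<forall>v\<in>?H. P.vspan N w s v)"
  proof (rule P.maximal_minor_vspan)
    fix v js assume "\<And>i. i < r \<Longrightarrow> v i \<in> ?H" "\<And>j. j < r \<Longrightarrow> js j \<in> N"
    then show "det (mat r r (\<lambda>(i, j). v i (js j))) \<in> P" by (rule vanish)
  next
    fix s w js assume "s < r" "\<And>v. v \<in> ?H \<Longrightarrow> P.vspan N w s v"
    then show ?thesis by blast
  qed
  then obtain s w where s: "s < r" and span: "\<And>v. v \<in> ?H \<Longrightarrow> P.vspan N w s v" by blast
  obtain e where e: "bij_betw e {..<card G} G"
    using ex_bij_betw_nat_finite[OF G(2)] unfolding lessThan_atLeast0 by blast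
  have "\<exists>g. g \<in> mpol_in N \<and> e i = cls g" if "i < card G" for i
  proof -
    have "e i \<in> carrier A" using bij_betw_apply[OF e, of i] that G(1) p.a_subset by auto
    then obtain g where "g \<in> mpol_in N" "e i = cls g" by (rule cls_surj)
    then show ?thesis by blast
  qed
  then obtain g where g: "\<And>i. i < card G \<Longrightarrow> g i \<in> mpol_in N" "\<And>i. i < card G \<Longrightarrow> e i = cls (g i)" by metis
  have gP: "g i \<in> P" if "i < card G" for i
  proof -
    have "e i \<in> p" using bij_betw_apply[OF e, of i] that G(1) by auto
    then show ?thesis using g(2)[OF that] by (simp add: P_def)
  qed
  \<comment> \<open>The vectors that span the Jacobi rows modulo \<open>P\<close>, followed by the
    gradients of the local generators of \<open>P\<close>.\<close>
  define w' where "w' i = (if i < s then w i else grad (g (i - s)))" for i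
  define u where "u = s + card G"
  have w'f: "P.vspan N w' u (grad (f i))" if "i \<in> {1..m}" for i
  proof (rule P.vspan_trans[OF span])
    show "grad (f i) \<in> (\<lambda>i. grad (f i)) ` {1..m}" using that by blast
    show "P.vspan N w' u (w i)" if "i < s" for i
      using P.vspan_base[of i u N w'] that by (simp add: w'_def u_def)
  qed
  have w'g: "P.vspan N w' u (grad (g i))" if "i < card G" for i
    using P.vspan_base[of "s + i" u N w'] that by (simp add: w'_def u_def)
  have "P.vspan N w' u (grad h)" if h: "h \<in> P" "h \<in> mpol_in N" for h
  proof -
    obtain t where t: "t \<in> S" "t \<otimes>\<^bsub>A\<^esub> cls h \<in> Idl\<^bsub>A\<^esub> G" using G(4)[of "cls h"] h(1) by (auto simp: P_def)
    then have "t \<in> carrier A" by simp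
    then obtain t' where t': "t' \<in> mpol_in N" "t = cls t'" by (rule cls_surj)
    have "e ` {..<card G} = G" using e by (simp add: bij_betw_def)
    then have idl: "t \<otimes>\<^bsub>A\<^esub> cls h \<in> Idl\<^bsub>A\<^esub> (e ` {..<card G})" using t(2) by simp
    have eA: "e \<in> {..<card G} \<rightarrow> carrier A" using g(2) by auto
    obtain c where c: "c \<in> {..<card G} \<rightarrow> carrier A"
      "t \<otimes>\<^bsub>A\<^esub> cls h = (\<Oplus>\<^bsub>A\<^esub>i\<in>{..<card G}. c i \<otimes>\<^bsub>A\<^esub> e i)"
      by (rule A.genideal_combination[OF finite_lessThan eA idl])
    have "\<exists>b. b \<in> mpol_in N \<and> c i = cls b" if "i < card G" for i
    proof -
      have "c i \<in> carrier A" using c(1) that by auto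
      then obtain b where "b \<in> mpol_in N" "c i = cls b" by (rule cls_surj)
      then show ?thesis by blast
    qed
    then obtain b where b: "\<And>i. i < card G \<Longrightarrow> b i \<in> mpol_in N" "\<And>i. i < card G \<Longrightarrow> c i = cls (b i)" by metis
    have "(\<Oplus>\<^bsub>A\<^esub>i\<in>{..<card G}. c i \<otimes>\<^bsub>A\<^esub> e i) = (\<Oplus>\<^bsub>A\<^esub>i\<in>{..<card G}. cls (b i * g i))"
      using b g by (intro A.finsum_cong') (auto simp: cls_mult)
    then have "cls (t' * h - (\<Sum>i<card G. b i * g i)) = \<zero>\<^bsub>A\<^esub>"
      using c(2) t'(2) by (simp add: cls_diff cls_mult cls_sum A.r_right_minus_eq)
    moreover have "t' * h - (\<Sum>i<card G. b i * g i) \<in> mpol_in N"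
      using t'(1) h(2) b(1) g(1) by (intro mpol_in_diff mpol_in_sum mpol_in_mult) auto
    ultimately obtain a where a: "t' * h - (\<Sum>i<card G. b i * g i) = (\<Sum>i\<in>{1..m}. a i * f i)"
      using Iext_combination[of "t' * h - (\<Sum>i<card G. b i * g i)"] unfolding Iext_def by blast
    \<comment> \<open>When this equation is differentiated modulo \<open>P\<close>, the derivatives
      of the multiplier and of the coefficients disappear, because \<open>h\<close>, the
      \<open>g i\<close> and the \<open>f i\<close> all lie in \<open>P\<close>.\<close>
    then have eq: "t' * h = (\<Sum>i<card G. b i * g i) + (\<Sum>i\<in>{1..m}. a i * f i)" by (simp add: algebra_simps)
    have "P.vspan N w' u (\<lambda>j. (\<Sum>i<card G. b i * mpol_diff j (g i)) + (\<Sum>i\<in>{1..m}. a i * mpol_diff j (f i)))"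
      by (intro P.vspan_add P.vspan_sum P.vspan_smult w'f w'g) auto
    then have "P.vspan N w' u (\<lambda>j. t' * mpol_diff j h)"
    proof (rule P.vspan_cong)
      fix j
      have "mpol_diff j (t' * h) = mpol_diff j ((\<Sum>i<card G. b i * g i) + (\<Sum>i\<in>{1..m}. a i * f i))"
        by (simp only: eq)
      then have "(\<Sum>i<card G. b i * mpol_diff j (g i)) + (\<Sum>i\<in>{1..m}. a i * mpol_diff j (f i)) - t' * mpol_diff j h
          = mpol_diff j t' * h - (\<Sum>i<card G. mpol_diff j (b i) * g i) - (\<Sum>i\<in>{1..m}. mpol_diff j (a i) * f i)"
        by (simp add: mpol_diff_mult mpol_diff_add mpol_diff_sum sum.distrib algebra_simps)
      also have "\<dots> \<in> P"
        using h(1) gP f_Iext IP by (intro P.diff P.sum P.mult) auto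
      finally show "(\<Sum>i<card G. b i * mpol_diff j (g i)) + (\<Sum>i\<in>{1..m}. a i * mpol_diff j (f i)) - t' * mpol_diff j h \<in> P" .
    qed
    moreover have "t' \<notin> P" using t(1) t'(2) by (auto simp: S_def P_def)
    ultimately show ?thesis by (metis P.vspan_cancel)
  qed
  then have "det (mat (card (N - U)) (card (N - U)) (\<lambda>(i, j). grad (h i) (js j))) \<in> P"
    if "u < card (N - U)" using that U(3,4)
    by (intro P.vspan_minor_vanish[where N = N and w = w' and s = u]) auto
  moreover have "u < card (N - U)"
    using s rle G(3) \<open>card W \<le> n\<close> unfolding NU u_def W(2) by linarith
  ultimately show False using U(5) by blast
qed

end

section \<open>The rank of the Jacobi matrix\<close>

lemma (in ring) func_space_add_apply: "x \<in> S \<Longrightarrow> (a \<oplus>\<^bsub>func_space S\<^esub> b) x = a x \<oplus> b x"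
  by (simp add: func_space_def)

lemma (in cring) func_space_finsum:
  assumes "finite T" "g \<in> T \<rightarrow> carrier (func_space S)" "x \<in> S"
  shows "(\<Oplus>\<^bsub>func_space S\<^esub>t\<in>T. g t) x = (\<Oplus>t\<in>T. g t x)"
  using assms(1,2)
proof (induction T rule: finite_induct)
  interpret fs: module R "func_space S" by (rule func_space_is_module)
  case empty
  have "\<zero>\<^bsub>func_space S\<^esub> x = \<zero>" using assms(3) by (simp add: func_space_def)
  then show ?case by (simp only: fs.finsum_empty finsum_empty)
next
  interpret fs: module R "func_space S" by (rule func_space_is_module)
  case (insert t T)
  have g: "g t \<in> carrier (func_space S)" "g \<in> T \<rightarrow> carrier (func_space S)" using insert.prems by auto
  have 1: "(\<lambda>t. g t x) \<in> T \<rightarrow> carrier R" "g t x \<in> carrier R"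
    using g assms(3) by (auto simp: func_space_def Pi_def PiE_def)
  have "(\<Oplus>\<^bsub>func_space S\<^esub>t\<in>insert t T. g t) x = (g t \<oplus>\<^bsub>func_space S\<^esub> (\<Oplus>\<^bsub>func_space S\<^esub>t\<in>T. g t)) x"
    by (simp only: fs.finsum_insert[OF insert.hyps g(2,1)])
  also have "\<dots> = g t x \<oplus> (\<Oplus>\<^bsub>func_space S\<^esub>t\<in>T. g t) x"
    by (rule func_space_add_apply[OF assms(3)])
  also have "\<dots> = (\<Oplus>t\<in>insert t T. g t x)"
    using insert.IH[OF g(2)] finsum_insert[OF insert.hyps 1] by simp
  finally show ?case .
qed

lemma (in vectorspace) dim_span_le:
  assumes "finite B" "B \<subseteq> span X" "X \<subseteq> span B" "X \<subseteq> carrier V"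
  shows "vectorspace.dim K (V\<lparr>carrier := span X\<rparr>) \<le> card B"
proof -
  have sub: "submodule K (span X) V" by (rule span_is_submodule[OF assms(4)])
  interpret W: vectorspace K "V\<lparr>carrier := span X\<rparr>"
    by (rule subspace_is_vs) (simp add: subspace_def sub vectorspace_axioms)
  have BV: "B \<subseteq> carrier V" using assms(2) span_is_subset2[OF assms(4)] by blast
  have "W.span B = span B" by (rule span_li_not_depend(1)[OF assms(2) sub])
  moreover have "span X \<subseteq> span B" by (rule span_is_subset[OF assms(3) span_is_submodule[OF BV]])
  moreover have "span B \<subseteq> span X" by (rule span_is_subset[OF assms(2) sub])
  ultimately show ?thesis using W.gen_ge_dim[OF assms(1)] assms(2) by simp
qed

lemma (in vectorspace) dim_span_witness:
  assumes "finite X" "X \<subseteq> carrier V"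
  shows "\<exists>B. finite B \<and> card B = vectorspace.dim K (V\<lparr>carrier := span X\<rparr>) \<and> B \<subseteq> carrier V \<and> X \<subseteq> span B"
proof -
  have sub: "submodule K (span X) V" by (rule span_is_submodule[OF assms(2)])
  interpret W: vectorspace K "V\<lparr>carrier := span X\<rparr>"
    by (rule subspace_is_vs) (simp add: subspace_def sub vectorspace_axioms)
  have Xs: "X \<subseteq> span X" by (rule in_own_span[OF assms(2)])
  have "W.span X = span X" by (rule span_li_not_depend(1)[OF Xs sub])
  then have "\<exists>k A. finite A \<and> card A = k \<and> A \<subseteq> carrier (V\<lparr>carrier := span X\<rparr>) \<and> W.gen_set A"
    using assms(1) Xs by (intro exI[of _ "card X"] exI[of _ X]) simp
  from LeastI_ex[OF this] obtain B where B: "finite B" "card B = W.dim"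
      "B \<subseteq> carrier (V\<lparr>carrier := span X\<rparr>)" "W.gen_set B"
    unfolding W.dim_def by blast
  have BX: "B \<subseteq> span X" using B(3) by simp
  have "W.span B = span B" by (rule span_li_not_depend(1)[OF BX sub])
  then have "span B = span X" using B(4) by simp
  moreover have "B \<subseteq> carrier V" using BX span_is_subset2[OF assms(2)] by blast
  ultimately show ?thesis using B(1,2) Xs by blast
qed

lemma (in domain_localization) finite_common_denominator:
  assumes "finite X" "X \<subseteq> carrier loc"
  shows "\<exists>s\<in>S. \<forall>x\<in>X. \<exists>a\<in>carrier A. frac s \<one> \<otimes>\<^bsub>loc\<^esub> x = frac a \<one>"
  using assms
proof (induction X rule: finite_induct)
  case empty
  then show ?case using S_one by blast
next
  case (insert x X)
  obtain s where s: "s \<in> S" "\<forall>x\<in>X. \<exists>a\<in>carrier A. frac s \<one> \<otimes>\<^bsub>loc\<^esub> x = frac a \<one>"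
    using insert by blast
  obtain b t where b: "b \<in> carrier A" "t \<in> S" "x = frac b t"
    using insert.prems by (auto simp: carrier_loc)
  have st: "s \<otimes> t \<in> S" by (rule S_mult[OF s(1) b(2)])
  have "frac (s \<otimes> t) \<one> \<otimes>\<^bsub>loc\<^esub> x = frac (s \<otimes> t \<otimes> b) (\<one> \<otimes> t)"
    unfolding b(3) using st b S_one by (intro frac_mult) auto
  also have "\<dots> = frac (s \<otimes> b) \<one>"
  proof (subst frac_eq)
    show "\<one> \<otimes> (s \<otimes> t \<otimes> b) = \<one> \<otimes> t \<otimes> (s \<otimes> b)"
      using b(1,2) s(1) by (simp add: m_ac)
  qed (use st b(1,2) s(1) S_one in simp_all)
  finally have x: "frac (s \<otimes> t) \<one> \<otimes>\<^bsub>loc\<^esub> x = frac (s \<otimes> b) \<one>" .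
  have y: "\<exists>a\<in>carrier A. frac (s \<otimes> t) \<one> \<otimes>\<^bsub>loc\<^esub> y = frac a \<one>" if yX: "y \<in> X" for y
  proof -
    obtain a where a: "a \<in> carrier A" "frac s \<one> \<otimes>\<^bsub>loc\<^esub> y = frac a \<one>" using s(2) yX by blast
    have yc: "y \<in> carrier loc" using insert.prems yX by blast
    have hom: "frac (s \<otimes> t) \<one> = frac t \<one> \<otimes>\<^bsub>loc\<^esub> frac s \<one>"
      using ring_hom_mult[OF frac_one_hom, of t s] b(2) s(1) by (simp add: m_comm)
    interpret L: cring loc by (rule cring_loc)
    have "frac (s \<otimes> t) \<one> \<otimes>\<^bsub>loc\<^esub> y = frac t \<one> \<otimes>\<^bsub>loc\<^esub> (frac s \<one> \<otimes>\<^bsub>loc\<^esub> y)"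
      unfolding hom using b(2) s(1) S_one yc by (intro L.m_assoc) (auto intro: frac_closed)
    also have "\<dots> = frac (t \<otimes> a) \<one>"
      using ring_hom_mult[OF frac_one_hom, of t a] a b(2) by simp
    finally show ?thesis using a(1) b(2) by (intro bexI[of _ "t \<otimes> a"]) auto
  qed
  have "\<exists>a\<in>carrier A. frac (s \<otimes> t) \<one> \<otimes>\<^bsub>loc\<^esub> x = frac a \<one>"
    using x s(1) b(1) by (intro bexI[of _ "s \<otimes> b"]) auto
  then show ?case using st y by blast
qed

section \<open>Row vectors over the field of fractions and their polynomial lifts\<close>

context affine_domain
begin

sublocale Q: domain_localization A "carrier A - {\<zero>\<^bsub>A\<^esub>}"
  by (rule domain_localization_nonzero) (rule A.domain_axioms)

definition embed :: "'k mpol \<Rightarrow> ('k mpol set \<times> 'k mpol set) set" where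
  "embed p = Q.frac (cls p) \<one>\<^bsub>A\<^esub>"

lemma field_Q: "field Q.loc"
  by (rule Q.field_loc) simp

sublocale QF: field Q.loc by (rule field_Q)

lemma embed_closed [simp]: "embed p \<in> carrier Q.loc"
  by (simp add: embed_def Q.frac_closed)

lemma embed_hom: "embed \<in> Ring.ring_hom class_ring Q.loc"
  using ring_hom_trans[OF cls_hom Q.frac_one_hom] by (simp add: embed_def [abs_def] comp_def)

lemma embed_add: "embed (p + q) = embed p \<oplus>\<^bsub>Q.loc\<^esub> embed q"
  and embed_mult: "embed (p * q) = embed p \<otimes>\<^bsub>Q.loc\<^esub> embed q"
  using ring_hom_add[OF embed_hom, of p q] ring_hom_mult[OF embed_hom, of p q] by simp_all

lemma embed_eq_iff: "embed p = embed q \<longleftrightarrow> p - q \<in> Iext"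
  unfolding embed_def Iext_def by (simp add: Q.frac_one_inj cls_diff A.r_right_minus_eq)

lemma embed_0: "embed 0 = \<zero>\<^bsub>Q.loc\<^esub>"
  by (simp add: embed_def Q.loc_zero cls_0)

lemma embed_sum: "embed (sum g S) = (\<Oplus>\<^bsub>Q.loc\<^esub>x\<in>S. embed (g x))"
  by (induction S rule: infinite_finite_induct) (simp_all add: embed_0 embed_add)

lemma embed_nonzero: "p \<notin> Iext \<Longrightarrow> embed p \<noteq> \<zero>\<^bsub>Q.loc\<^esub>"
  using embed_eq_iff[of p 0] by (simp add: embed_0)

lemma embed_denominator:
  assumes "finite X" "X \<subseteq> carrier Q.loc"
  shows "\<exists>s num. s \<notin> Iext \<and> (\<forall>x\<in>X. embed s \<otimes>\<^bsub>Q.loc\<^esub> x = embed (num x))"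
proof -
  obtain t where t: "t \<in> carrier A - {\<zero>\<^bsub>A\<^esub>}"
      "\<forall>x\<in>X. \<exists>a\<in>carrier A. Q.frac t \<one>\<^bsub>A\<^esub> \<otimes>\<^bsub>Q.loc\<^esub> x = Q.frac a \<one>\<^bsub>A\<^esub>"
    using Q.finite_common_denominator[OF assms] by blast
  then have "t \<in> carrier A" by blast
  then obtain s where s: "t = cls s" by (rule cls_surj)
  have "\<exists>p. embed s \<otimes>\<^bsub>Q.loc\<^esub> x = embed p" if xX: "x \<in> X" for x
  proof -
    obtain a where a: "a \<in> carrier A" "Q.frac t \<one>\<^bsub>A\<^esub> \<otimes>\<^bsub>Q.loc\<^esub> x = Q.frac a \<one>\<^bsub>A\<^esub>" using t(2) xX by blast
    obtain p where "a = cls p" using a(1) by (rule cls_surj)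
    then show ?thesis using a(2) s by (auto simp: embed_def)
  qed
  then have "\<forall>x. \<exists>p. x \<in> X \<longrightarrow> embed s \<otimes>\<^bsub>Q.loc\<^esub> x = embed p" by blast
  from choice[OF this] obtain num where "\<forall>x\<in>X. embed s \<otimes>\<^bsub>Q.loc\<^esub> x = embed (num x)" by blast
  moreover have "s \<notin> Iext" using t(1) s by (simp add: Iext_def)
  ultimately show ?thesis by blast
qed

abbreviation "V \<equiv> QF.func_space N"

definition vec_embed :: "(nat \<Rightarrow> 'k mpol) \<Rightarrow> nat \<Rightarrow> ('k mpol set \<times> 'k mpol set) set" where
  "vec_embed v = (\<lambda>j\<in>N. embed (v j))"

sublocale V: vectorspace Q.loc V
  using QF.func_space_is_module[of N] field_Q by (simp add: vectorspace_def)

lemma vec_embed_closed: "vec_embed v \<in> carrier V"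
  by (simp add: vec_embed_def ring.func_space_def[OF QF.ring_axioms])

lemma carrier_V_apply: "b \<in> carrier V \<Longrightarrow> j \<in> N \<Longrightarrow> b j \<in> carrier Q.loc"
  by (auto simp: ring.func_space_def[OF QF.ring_axioms])

lemma V_eqI:
  assumes "a \<in> carrier V" "b \<in> carrier V" "\<And>j. j \<in> N \<Longrightarrow> a j = b j"
  shows "a = b"
proof -
  have "carrier V = N \<rightarrow>\<^sub>E carrier Q.loc" by (simp add: ring.func_space_def[OF QF.ring_axioms])
  then show ?thesis using assms(1,2) by (metis (no_types) PiE_ext assms(3))
qed

lemma V_smult_apply: "j \<in> N \<Longrightarrow> (c \<odot>\<^bsub>V\<^esub> b) j = c \<otimes>\<^bsub>Q.loc\<^esub> b j"
  by (simp add: ring.func_space_def[OF QF.ring_axioms])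

lemma V_finsum_apply:
  assumes "finite T" "\<And>t. t \<in> T \<Longrightarrow> c t \<in> carrier Q.loc" "\<And>t. t \<in> T \<Longrightarrow> b t \<in> carrier V" "j \<in> N"
  shows "(\<Oplus>\<^bsub>V\<^esub>t\<in>T. c t \<odot>\<^bsub>V\<^esub> b t) j = (\<Oplus>\<^bsub>Q.loc\<^esub>t\<in>T. c t \<otimes>\<^bsub>Q.loc\<^esub> b t j)"
proof -
  have "(\<lambda>t. c t \<odot>\<^bsub>V\<^esub> b t) \<in> T \<rightarrow> carrier V" using assms(2,3) by auto
  from QF.func_space_finsum[OF assms(1) this assms(4)] show ?thesis
    using assms(4) by (simp add: V_smult_apply)
qed

text \<open>Denominators are cleared in two places: \<open>s\<close> for the entries of the vectors
  in \<open>B\<close>, which fixes \<open>w\<close> once for all \<open>v\<close>, and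
  \<open>t\<close> for the coefficients, which depend on \<open>v\<close>.\<close>

lemma span_imp_vspan:
  assumes B: "finite B" "B \<subseteq> carrier V"
  shows "\<exists>w. \<forall>v. vec_embed v \<in> V.span B \<longrightarrow> Iext.vspan N w (card B) v"
proof -
  obtain e where e: "bij_betw e {..<card B} B"
    using ex_bij_betw_nat_finite[OF B(1)] unfolding lessThan_atLeast0 by blast
  have eB: "e i \<in> B" if "i < card B" for i using bij_betw_apply[OF e, of i] that by simp
  define X where "X = (\<lambda>(i, j). e i j) ` ({..<card B} \<times> N)"
  have "finite X" by (simp add: X_def)
  moreover have "X \<subseteq> carrier Q.loc" using eB B(2) carrier_V_apply by (auto simp: X_def subset_iff)
  ultimately obtain s num where s: "s \<notin> Iext" "\<And>x. x \<in> X \<Longrightarrow> embed s \<otimes>\<^bsub>Q.loc\<^esub> x = embed (num x)"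
    using embed_denominator[of X] by blast
  define w where "w i j = num (e i j)" for i j
  have w: "embed s \<otimes>\<^bsub>Q.loc\<^esub> e i j = embed (w i j)" if "i < card B" "j \<in> N" for i j
  proof -
    have "e i j \<in> X" unfolding X_def using that by (intro image_eqI[of _ _ "(i, j)"]) auto
    then show ?thesis unfolding w_def by (rule s(2))
  qed
  have "Iext.vspan N w (card B) v" if v: "vec_embed v \<in> V.span B" for v
  proof -
    have "vec_embed v \<in> {V.lincomb c B | c. c \<in> B \<rightarrow> carrier Q.loc}"
      using v by (simp only: V.finite_span[OF B])
    then obtain c where c: "c \<in> B \<rightarrow> carrier Q.loc" "V.lincomb c B = vec_embed v"
      by (elim CollectE exE conjE) simp
    define Y where "Y = (\<lambda>i. c (e i)) ` {..<card B}"
    have "finite Y" "Y \<subseteq> carrier Q.loc" using c(1) eB by (auto simp: Y_def)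
    then obtain t num' where t: "t \<notin> Iext" "\<And>x. x \<in> Y \<Longrightarrow> embed t \<otimes>\<^bsub>Q.loc\<^esub> x = embed (num' x)"
      using embed_denominator[of Y] by blast
    define d where "d i = num' (c (e i))" for i
    have d: "embed t \<otimes>\<^bsub>Q.loc\<^esub> c (e i) = embed (d i)" if "i < card B" for i
    proof -
      have "c (e i) \<in> Y" unfolding Y_def using that by blast
      then show ?thesis unfolding d_def by (rule t(2))
    qed
    show ?thesis
    proof (rule Iext.vspanI)
      show "s * t \<notin> Iext" using s(1) t(1) Iext.prime by blast
      fix j assume j: "j \<in> N"
      have cB: "c b \<in> carrier Q.loc" "b j \<in> carrier Q.loc" if "b \<in> B" for b
        using c(1) that B(2) carrier_V_apply j by auto
      have "embed (v j) = V.lincomb c B j" using c(2) j by (simp add: vec_embed_def)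
      also have "\<dots> = (\<Oplus>\<^bsub>Q.loc\<^esub>b\<in>B. c b \<otimes>\<^bsub>Q.loc\<^esub> b j)"
        unfolding V.lincomb_def using c(1) B j by (intro V_finsum_apply) auto
      also have "\<dots> = (\<Oplus>\<^bsub>Q.loc\<^esub>i\<in>{..<card B}. c (e i) \<otimes>\<^bsub>Q.loc\<^esub> e i j)"
        using QF.finsum_reindex[of "\<lambda>b. c b \<otimes>\<^bsub>Q.loc\<^esub> b j" e "{..<card B}"] e cB
        by (auto simp: bij_betw_def)
      finally have "embed (s * t * v j) = embed (s * t) \<otimes>\<^bsub>Q.loc\<^esub> (\<Oplus>\<^bsub>Q.loc\<^esub>i\<in>{..<card B}. c (e i) \<otimes>\<^bsub>Q.loc\<^esub> e i j)"
        by (simp add: embed_mult)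
      also have "\<dots> = (\<Oplus>\<^bsub>Q.loc\<^esub>i\<in>{..<card B}. embed (s * t) \<otimes>\<^bsub>Q.loc\<^esub> (c (e i) \<otimes>\<^bsub>Q.loc\<^esub> e i j))"
        using cB eB by (intro QF.finsum_rdistr) auto
      also have "\<dots> = (\<Oplus>\<^bsub>Q.loc\<^esub>i\<in>{..<card B}. embed (d i * w i j))"
      proof (rule QF.finsum_cong')
        fix i assume i: "i \<in> {..<card B}"
        then have "embed (s * t) \<otimes>\<^bsub>Q.loc\<^esub> (c (e i) \<otimes>\<^bsub>Q.loc\<^esub> e i j) =
            (embed t \<otimes>\<^bsub>Q.loc\<^esub> c (e i)) \<otimes>\<^bsub>Q.loc\<^esub> (embed s \<otimes>\<^bsub>Q.loc\<^esub> e i j)"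
          using cB[OF eB[of i]] by (simp add: embed_mult QF.m_ac)
        then show "embed (s * t) \<otimes>\<^bsub>Q.loc\<^esub> (c (e i) \<otimes>\<^bsub>Q.loc\<^esub> e i j) = embed (d i * w i j)"
          using d w i j by (simp add: embed_mult)
      qed auto
      also have "\<dots> = embed (\<Sum>i<card B. d i * w i j)" by (simp only: embed_sum)
      finally show "s * t * v j - (\<Sum>i<card B. d i * w i j) \<in> Iext" by (simp add: embed_eq_iff)
    qed
  qed
  then show ?thesis by blast
qed

lemma vspan_imp_span:
  assumes "Iext.vspan N w s v"
  shows "vec_embed v \<in> V.span ((\<lambda>i. vec_embed (w i)) ` {..<s})"
proof -
  let ?B = "(\<lambda>i. vec_embed (w i)) ` {..<s}"
  obtain a c where a: "a \<notin> Iext" "\<And>j. j \<in> N \<Longrightarrow> a * v j - (\<Sum>i<s. c i * w i j) \<in> Iext"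
    using assms unfolding Iext.vspan_def by blast
  have BV: "?B \<subseteq> carrier V" using vec_embed_closed by auto
  interpret sp: submodule Q.loc "V.span ?B" V by (rule V.span_is_submodule[OF BV])
  have span: "vec_embed (w i) \<in> V.span ?B" if "i < s" for i
    using V.in_own_span[OF BV] that by auto
  define u where "u = (\<Oplus>\<^bsub>V\<^esub>i\<in>{..<s}. embed (c i) \<odot>\<^bsub>V\<^esub> vec_embed (w i))"
  have "(\<Oplus>\<^bsub>V\<^esub>i\<in>T. embed (c i) \<odot>\<^bsub>V\<^esub> vec_embed (w i)) \<in> V.span ?B" if "T \<subseteq> {..<s}" for T
  proof -
    have "finite T" using that finite_subset by blast
    then show ?thesis using that
    proof (induction T rule: finite_induct)
      case empty
      show ?case by (simp only: V.finsum_empty sp.zero_closed)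
    next
      case (insert i T)
      have mem: "embed (c i) \<odot>\<^bsub>V\<^esub> vec_embed (w i) \<in> carrier V" for i
        by (intro V.smult_closed embed_closed vec_embed_closed)
      have T: "(\<lambda>i. embed (c i) \<odot>\<^bsub>V\<^esub> vec_embed (w i)) \<in> T \<rightarrow> carrier V"
        by (rule funcsetI) (rule mem)
      have "embed (c i) \<odot>\<^bsub>V\<^esub> vec_embed (w i) \<in> V.span ?B"
        using insert.prems by (intro sp.smult_closed embed_closed span) simp
      moreover have "(\<Oplus>\<^bsub>V\<^esub>i\<in>T. embed (c i) \<odot>\<^bsub>V\<^esub> vec_embed (w i)) \<in> V.span ?B"
        using insert.IH insert.prems by blast
      ultimately show ?case
        unfolding V.finsum_insert[OF insert.hyps T mem] by (rule sp.m_closed)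
    qed
  qed
  then have u: "u \<in> V.span ?B" by (simp add: u_def)
  then have uV: "u \<in> carrier V" using V.span_is_subset2[OF BV] by blast
  have "embed a \<odot>\<^bsub>V\<^esub> vec_embed v = u"
  proof (rule V_eqI[OF _ uV])
    show "embed a \<odot>\<^bsub>V\<^esub> vec_embed v \<in> carrier V" using vec_embed_closed by simp
    fix j assume j: "j \<in> N"
    have "(embed a \<odot>\<^bsub>V\<^esub> vec_embed v) j = embed (a * v j)"
      using j by (simp add: V_smult_apply vec_embed_def embed_mult)
    also have "\<dots> = embed (\<Sum>i<s. c i * w i j)" using a(2)[OF j] by (simp add: embed_eq_iff)
    also have "\<dots> = (\<Oplus>\<^bsub>Q.loc\<^esub>i\<in>{..<s}. embed (c i) \<otimes>\<^bsub>Q.loc\<^esub> vec_embed (w i) j)"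
      using j by (simp add: embed_sum embed_mult vec_embed_def)
    also have "\<dots> = u j" unfolding u_def using j vec_embed_closed by (intro V_finsum_apply [symmetric]) auto
    finally show "(embed a \<odot>\<^bsub>V\<^esub> vec_embed v) j = u j" .
  qed
  moreover have "embed a \<in> Units Q.loc" using embed_nonzero[OF a(1)] by (simp add: QF.field_Units)
  ultimately have "vec_embed v = inv\<^bsub>Q.loc\<^esub> embed a \<odot>\<^bsub>V\<^esub> u"
    using vec_embed_closed[of v] V.smult_assoc1[of "inv\<^bsub>Q.loc\<^esub> embed a" "embed a" "vec_embed v"] by simp
  also have "\<dots> \<in> V.span ?B"
    using u \<open>embed a \<in> Units Q.loc\<close> by (intro sp.smult_closed) simp_all
  finally show ?thesis .
qed

lemma jacobi_rank_eq:
  "jacobi_rank n m f = vectorspace.dim Q.loc (V\<lparr>carrier := V.span ((\<lambda>i. vec_embed (grad (f i))) ` {1..m})\<rparr>)"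
proof -
  have "(\<lambda>j\<in>N. Q.frac (jacobi n m f i j) \<one>\<^bsub>A\<^esub>) = vec_embed (grad (f i))" if "i \<in> {1..m}" for i
    unfolding vec_embed_def embed_def jacobi_def
    by (rule restrict_ext) (simp add: cls_eq f_in[OF that] mpol_in_diff_mpol)
  then have "(\<lambda>i. \<lambda>j\<in>N. Q.frac (jacobi n m f i j) \<one>\<^bsub>A\<^esub>) ` {1..m} = (\<lambda>i. vec_embed (grad (f i))) ` {1..m}"
    by (intro image_cong) auto
  then show ?thesis unfolding jacobi_rank_def Let_def frac_field_def by simp
qed

lemma jacobi_rank_vspan:
  "\<exists>w. \<forall>i\<in>{1..m}. Iext.vspan N w (jacobi_rank n m f) (grad (f i))"
proof -
  let ?X = "(\<lambda>i. vec_embed (grad (f i))) ` {1..m}"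
  have XV: "?X \<subseteq> carrier V" using vec_embed_closed by auto
  obtain B where B: "finite B" "card B = jacobi_rank n m f" "B \<subseteq> carrier V" "?X \<subseteq> V.span B"
    using V.dim_span_witness[OF _ XV] unfolding jacobi_rank_eq by blast
  obtain w where "\<And>v. vec_embed v \<in> V.span B \<Longrightarrow> Iext.vspan N w (card B) v"
    using span_imp_vspan[OF B(1,3)] by blast
  then show ?thesis using B(2,4) by auto
qed

text \<open>These minors are the values of the Jacobian derivations on the generators of the ideal;
  their vanishing is what makes the derivations well defined on \<open>A\<close>.\<close>

lemma minor_poly_rank_Suc:
  assumes "length is = Suc (jacobi_rank n m f)" "set is \<subseteq> {1..m}" "length js = length is" "set js \<subseteq> N"
  shows "minor_poly f is js \<in> Iext"
proof -
  obtain w where w: "\<And>i. i \<in> {1..m} \<Longrightarrow> Iext.vspan N w (jacobi_rank n m f) (grad (f i))"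
    using jacobi_rank_vspan by blast
  have "det (mat (Suc (jacobi_rank n m f)) (Suc (jacobi_rank n m f)) (\<lambda>(i, j). grad (f (is ! i)) (js ! j))) \<in> Iext"
    by (rule Iext.vspan_minor[where N = N and w = w])
      (use w assms in \<open>auto simp: subset_iff\<close>)
  then show ?thesis by (simp add: minor_poly_def assms(1))
qed

text \<open>A nonvanishing minor of maximal size \<open>s\<close> picks out \<open>s\<close> rows
  that span all rows, so \<open>s\<close> is at least the dimension of the row space. It is not
  larger, because minors of size rank plus 1 vanish.\<close>

lemma exists_rank_minor:
  "\<exists>is js. length is = jacobi_rank n m f \<and> set is \<subseteq> {1..m} \<and> length js = jacobi_rank n m f \<and> set js \<subseteq> N \<and>
     minor n m f is js \<noteq> \<zero>\<^bsub>A\<^esub>"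
proof -
  let ?r = "jacobi_rank n m f" and ?H = "(\<lambda>i. grad (f i)) ` {1..m}"
  obtain w0 where w0: "\<And>i. i \<in> {1..m} \<Longrightarrow> Iext.vspan N w0 ?r (grad (f i))"
    using jacobi_rank_vspan by blast
  have "\<exists>s w js. s \<le> ?r \<and> (\<forall>i<s. w i \<in> ?H) \<and> (\<forall>j<s. js j \<in> N) \<and>
      det (mat s s (\<lambda>(i, j). w i (js j))) \<notin> Iext \<and> (\<forall>v\<in>?H. Iext.vspan N w s v)"
  proof (rule Iext.maximal_minor_vspan)
    fix v js assume v: "\<And>i. i < Suc ?r \<Longrightarrow> v i \<in> ?H" and js: "\<And>j. j < Suc ?r \<Longrightarrow> js j \<in> N"
    have "Iext.vspan N w0 ?r (v i)" if "i < Suc ?r" for i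
      using v[OF that] w0 by fastforce
    then show "det (mat (Suc ?r) (Suc ?r) (\<lambda>(i, j). v i (js j))) \<in> Iext"
      using js by (intro Iext.vspan_minor[where N = N and w = w0]) auto
  next
    fix s w js
    assume "s < Suc ?r" "\<And>i. i < s \<Longrightarrow> w i \<in> ?H" "\<And>j. j < s \<Longrightarrow> js j \<in> N"
      "det (mat s s (\<lambda>(i, j). w i (js j))) \<notin> Iext" "\<And>v. v \<in> ?H \<Longrightarrow> Iext.vspan N w s v"
    then show ?thesis
      by (intro exI[of _ s] exI[of _ w] exI[of _ js]) simp
  qed
  then obtain s w js where s: "s \<le> ?r" "\<forall>i<s. w i \<in> ?H" "\<forall>j<s. js j \<in> N"
      "det (mat s s (\<lambda>(i, j). w i (js j))) \<notin> Iext" "\<forall>v\<in>?H. Iext.vspan N w s v" by blast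
  have "\<forall>i. \<exists>k. i < s \<longrightarrow> k \<in> {1..m} \<and> w i = grad (f k)"
  proof
    fix i
    show "\<exists>k. i < s \<longrightarrow> k \<in> {1..m} \<and> w i = grad (f k)"
    proof (cases "i < s")
      case True
      then have "w i \<in> ?H" using s(2) by blast
      then obtain k where "w i = grad (f k)" "k \<in> {1..m}" by (rule imageE)
      then show ?thesis by (intro exI[of _ k]) simp
    qed simp
  qed
  from choice[OF this] obtain k where k: "\<And>i. i < s \<Longrightarrow> k i \<in> {1..m} \<and> w i = grad (f (k i))" by auto
  let ?X = "(\<lambda>i. vec_embed (grad (f i))) ` {1..m}" and ?B = "(\<lambda>i. vec_embed (w i)) ` {..<s}"
  have XV: "?X \<subseteq> carrier V" using vec_embed_closed by auto
  have "?B \<subseteq> ?X" using k by auto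
  then have "?B \<subseteq> V.span ?X" using V.in_own_span[OF XV] by blast
  moreover have "?X \<subseteq> V.span ?B" using s(5) vspan_imp_span by blast
  ultimately have "?r \<le> card ?B"
    unfolding jacobi_rank_eq using XV by (intro V.dim_span_le) auto
  also have "\<dots> \<le> s" using card_image_le[of "{..<s}" "\<lambda>i. vec_embed (w i)"] by simp
  finally have sr: "s = ?r" using s(1) by simp
  define ks where "ks = map k [0..<s]"
  define ls where "ls = map js [0..<s]"
  have ks: "length ks = ?r" "set ks \<subseteq> {1..m}" "length ls = ?r" "set ls \<subseteq> N"
    using k s(3) sr by (auto simp: ks_def ls_def)
  have "minor_poly f ks ls = det (mat s s (\<lambda>(i, j). w i (js j)))"
    unfolding minor_poly_def ks(1) sr [symmetric]
    by (rule arg_cong[of _ _ det], rule eq_matI) (use k in \<open>auto simp: ks_def ls_def\<close>)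
  then have "minor n m f ks ls \<noteq> \<zero>\<^bsub>A\<^esub>" using s(4) minor_eq_cls[OF ks(2)] by (simp add: Iext_def)
  then show ?thesis using ks by blast
qed

end

section \<open>Minors and Jacobian derivations\<close>

text \<open>Rows and columns carry labels of arbitrary types: a row may be labelled by a generator
  index or by a polynomial, and transposition turns statements about rows into statements about
  columns.\<close>

definition sub_det :: "('i \<Rightarrow> 'j \<Rightarrow> 'a::comm_ring_1) \<Rightarrow> 'i list \<Rightarrow> 'j list \<Rightarrow> 'a" where
  "sub_det M is js = det (mat (length is) (length is) (\<lambda>(i, j). M (is ! i) (js ! j)))"

lemma sub_det_transpose:
  assumes "length js = length is"
  shows "sub_det (\<lambda>j i. M i j) js is = sub_det M is js"
proof -
  let ?A = "mat (length is) (length is) (\<lambda>(i, j). M (is ! i) (js ! j))"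
  have "transpose_mat ?A = mat (length js) (length js) (\<lambda>(j, i). M (is ! i) (js ! j))"
    using assms by (intro eq_matI) auto
  then show ?thesis using det_transpose[of ?A "length is"] by (simp add: sub_det_def)
qed

lemma sub_det_permute_rows:
  assumes "\<sigma> permutes {..<length is}"
  shows "sub_det M (permute_list \<sigma> is) js = signof \<sigma> * sub_det M is js"
proof -
  let ?A = "mat (length is) (length is) (\<lambda>(i, j). M (is ! i) (js ! j))"
  have lt: "\<sigma> i < length is" if "i < length is" for i
    using permutes_in_image[OF assms, of i] that by simp
  have "mat (length is) (length is) (\<lambda>(i, j). M (permute_list \<sigma> is ! i) (js ! j)) =
      mat (length is) (length is) (\<lambda>(i, j). ?A $$ (\<sigma> i, j))"
    using assms lt by (intro eq_matI) (auto simp: permute_list_nth)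
  then show ?thesis
    using det_permute_rows[of ?A "length is" \<sigma>] assms by (simp add: sub_det_def atLeast0LessThan)
qed

lemma sub_det_permute_cols:
  assumes "\<sigma> permutes {..<length js}" "length js = length is"
  shows "sub_det M is (permute_list \<sigma> js) = signof \<sigma> * sub_det M is js"
  using sub_det_permute_rows[OF assms(1), of "\<lambda>j i. M i j" "is"]
    sub_det_transpose[of "permute_list \<sigma> js" "is" M] sub_det_transpose[of js "is" M] assms
  by simp

lemma sub_det_rows_distinct:
  assumes "sub_det M is js \<noteq> 0"
  shows "distinct is"
proof (rule ccontr)
  assume "\<not> distinct is"
  then obtain i k where ik: "i < length is" "k < length is" "i \<noteq> k" "is ! i = is ! k"
    by (auto simp: distinct_conv_nth)
  let ?A = "mat (length is) (length is) (\<lambda>(i, j). M (is ! i) (js ! j))"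
  have "row ?A i = row ?A k" using ik by (intro eq_vecI) auto
  then have "det ?A = 0" using ik by (intro det_identical_rows[of ?A "length is" i k]) auto
  then show False using assms by (simp add: sub_det_def)
qed

lemma sub_det_cols_distinct:
  assumes "sub_det M is js \<noteq> 0" "length js = length is"
  shows "distinct js"
  using sub_det_rows_distinct[of "\<lambda>j i. M i j" js "is"] assms sub_det_transpose[OF assms(2), of M] by simp

section \<open>Permutations that sort index tuples\<close>

lemma exists_sorting_permutation:
  fixes xs :: "'a::linorder list"
  obtains \<sigma> where "\<sigma> permutes {..<length xs}" "permute_list \<sigma> xs = sort xs"
proof (rule mset_eq_permutation[of "sort xs" xs])
  show "mset (sort xs) = mset xs" by simp
  fix \<sigma> assume "\<sigma> permutes {..<length xs}" "permute_list \<sigma> xs = sort xs"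
  then show thesis by (rule that)
qed

text \<open>For distinct entries the sorting permutation is unique, so the definite description in
  \<open>jacobi_symbol\<close> denotes it.\<close>

lemma permute_list_inj:
  assumes "distinct xs" "\<sigma> permutes {..<length xs}" "\<tau> permutes {..<length xs}"
    and "permute_list \<sigma> xs = permute_list \<tau> xs"
  shows "\<sigma> = \<tau>"
proof
  fix i
  show "\<sigma> i = \<tau> i"
  proof (cases "i < length xs")
    case True
    then have "xs ! \<sigma> i = xs ! \<tau> i"
      using assms(4) permute_list_nth[OF assms(2) True] permute_list_nth[OF assms(3) True] by simp
    moreover have "\<sigma> i < length xs" "\<tau> i < length xs"
      using permutes_in_image[OF assms(2), of i] permutes_in_image[OF assms(3), of i] True by simp_all
    ultimately show ?thesis using assms(1) nth_eq_iff_index_eq by blast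
  next
    case False
    then show ?thesis using assms(2,3) by (simp add: permutes_def)
  qed
qed

definition sort_perm :: "nat list \<Rightarrow> nat \<Rightarrow> nat" where
  "sort_perm xs = (THE \<sigma>. \<sigma> permutes {..<length xs} \<and> permute_list \<sigma> xs = sort xs)"

lemma sort_perm:
  assumes "distinct xs"
  shows "sort_perm xs permutes {..<length xs}" "permute_list (sort_perm xs) xs = sort xs"
proof -
  obtain \<sigma> where \<sigma>: "\<sigma> permutes {..<length xs}" "permute_list \<sigma> xs = sort xs"
    using exists_sorting_permutation by blast
  have "sort_perm xs = \<sigma>" unfolding sort_perm_def
  proof (rule the_equality)
    fix \<tau> assume \<tau>: "\<tau> permutes {..<length xs} \<and> permute_list \<tau> xs = sort xs"
    then have "permute_list \<tau> xs = permute_list \<sigma> xs" using \<sigma>(2) by simp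
    then show "\<tau> = \<sigma>" using permute_list_inj[OF assms, of \<tau> \<sigma>] \<sigma>(1) \<tau> by blast
  qed (use \<sigma> in simp)
  with \<sigma> show "sort_perm xs permutes {..<length xs}" "permute_list (sort_perm xs) xs = sort xs" by simp_all
qed

lemma sort_perm_sorted:
  assumes "sorted_wrt (<) xs"
  shows "sort_perm xs = id" "sort xs = xs"
proof -
  have d: "distinct xs" and s: "sort xs = xs"
    using assms strict_sorted_iff by (auto intro: sort_key_id_if_sorted simp: strict_sorted_imp_sorted)
  show "sort xs = xs" by (rule s)
  have "permute_list (sort_perm xs) xs = permute_list id xs" using sort_perm(2)[OF d] s by simp
  then show "sort_perm xs = id" using permute_list_inj[OF d sort_perm(1)[OF d] permutes_id] by blast
qed

lemma signof_square: "signof \<sigma> * signof \<sigma> = (1 :: 'a::comm_ring_1)"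
  by (simp add: sign_def)

lemma nth_omit:
  assumes "k < length xs" "i < length xs - 1"
  shows "omit k xs ! i = xs ! insert_index k i"
  using assms by (auto simp: omit_def nth_append insert_index_def)

lemma minor_poly_eq_sub_det: "minor_poly f = sub_det (\<lambda>i j. mpol_diff j (f i))"
  by (intro ext) (simp add: minor_poly_def sub_det_def)

text \<open>The lift of \<open>\<partial>\<^sub>i\<^sub>,\<^sub>j\<close> to the polynomial ring.\<close>
definition jac_op :: "(nat \<Rightarrow> 'k::field mpol) \<Rightarrow> nat list \<Rightarrow> nat list \<Rightarrow> 'k mpol \<Rightarrow> 'k mpol" where
  "jac_op f is js p = (\<Sum>k\<le>length is.
     (-1) ^ (length is + k) * minor_poly f is (omit k js) * mpol_diff (js ! k) p)"

text \<open>Laplace expansion along the last row, which holds the partial derivatives of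
  \<open>p\<close>. The determinant form shows the behaviour under permutations of \<open>js\<close>
  and the values on the generators.\<close>

lemma jac_op_det:
  assumes "length js = Suc (length is)"
  shows "jac_op f is js p = sub_det (\<lambda>g j. mpol_diff j g) (map f is @ [p]) js"
proof -
  let ?r = "length is"
  let ?A = "mat (Suc ?r) (Suc ?r) (\<lambda>(i, j). mpol_diff (js ! j) ((map f is @ [p]) ! i))"
  have "sub_det (\<lambda>g j. mpol_diff j g) (map f is @ [p]) js = det ?A" by (simp add: sub_det_def)
  also have "\<dots> = (\<Sum>k<Suc ?r. ?A $$ (?r, k) * cofactor ?A ?r k)"
    by (rule laplace_expansion_row) simp_all
  also have "\<dots> = (\<Sum>k<Suc ?r. (-1) ^ (?r + k) * minor_poly f is (omit k js) * mpol_diff (js ! k) p)"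
  proof (intro sum.cong refl)
    fix k assume k: "k \<in> {..<Suc ?r}"
    have "mat_delete ?A ?r k = mat ?r ?r (\<lambda>(i, j). mpol_diff (omit k js ! j) (f (is ! i)))"
    proof (rule eq_matI)
      fix i j
      assume "i < dim_row (mat ?r ?r (\<lambda>(i, j). mpol_diff (omit k js ! j) (f (is ! i))))"
        "j < dim_col (mat ?r ?r (\<lambda>(i, j). mpol_diff (omit k js ! j) (f (is ! i))))"
      then have ij: "i < ?r" "j < ?r" by auto
      have "mat_delete ?A ?r k $$ (i, j) = ?A $$ (insert_index ?r i, insert_index k j)"
        using ij k by (intro mat_delete_index [symmetric]) auto
      also have "\<dots> = mpol_diff (omit k js ! j) (f (is ! i))"
        using ij k assms by (simp add: nth_omit nth_append insert_index_def)
      finally show "mat_delete ?A ?r k $$ (i, j) = mat ?r ?r (\<lambda>(i, j). mpol_diff (omit k js ! j) (f (is ! i))) $$ (i, j)"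
        using ij by simp
    qed simp_all
    then have "cofactor ?A ?r k = (-1) ^ (?r + k) * minor_poly f is (omit k js)"
      by (simp add: cofactor_def minor_poly_def)
    moreover have "?A $$ (?r, k) = mpol_diff (js ! k) p" using k by (simp add: nth_append)
    ultimately show "?A $$ (?r, k) * cofactor ?A ?r k =
        (-1) ^ (?r + k) * minor_poly f is (omit k js) * mpol_diff (js ! k) p"
      by (simp only: mult_ac)
  qed
  finally show ?thesis by (simp add: jac_op_def lessThan_Suc_atMost)
qed

lemma jac_op_permute:
  assumes "length js = Suc (length is)" "\<sigma> permutes {..<length js}"
  shows "jac_op f is (permute_list \<sigma> js) p = signof \<sigma> * jac_op f is js p"
  using assms by (simp add: jac_op_det sub_det_permute_cols)

lemma jac_op_generator:
  assumes "length js = Suc (length is)"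
  shows "jac_op f is js (f l) = minor_poly f (is @ [l]) js"
proof -
  have "mat (Suc (length is)) (Suc (length is)) (\<lambda>(i, j). mpol_diff (js ! j) ((map f is @ [f l]) ! i)) =
      mat (Suc (length is)) (Suc (length is)) (\<lambda>(i, j). mpol_diff (js ! j) (f ((is @ [l]) ! i)))"
    by (intro eq_matI) (auto simp: nth_append)
  then show ?thesis using assms by (simp add: jac_op_det sub_det_def minor_poly_def)
qed

lemma jac_op_var:
  "jac_op f is js (mpol_var l) =
     (\<Sum>k\<in>{k. k \<le> length is \<and> js ! k = l}. (-1) ^ (length is + k) * minor_poly f is (omit k js))"
  unfolding jac_op_def mpol_diff_var
  by (rule sum.mono_neutral_cong_right) auto

text \<open>A sum over variables is regrouped by the positions of \<open>js\<close>. Each position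
  belongs to exactly one variable, also if \<open>js\<close> has repetitions.\<close>

lemma sum_jac_op_var:
  assumes "finite T"
  shows "(\<Sum>l\<in>T. jac_op f is js (mpol_var l) * g l) =
     (\<Sum>k\<in>{k. k \<le> length is \<and> js ! k \<in> T}. (-1) ^ (length is + k) * minor_poly f is (omit k js) * g (js ! k))"
proof -
  define c where "c k = (-1) ^ (length is + k) * minor_poly f is (omit k js)" for k
  have "(\<Sum>l\<in>T. jac_op f is js (mpol_var l) * g l) =
      (\<Sum>l\<in>T. \<Sum>k\<in>{k. k \<le> length is \<and> js ! k \<in> T}. if js ! k = l then c k * g (js ! k) else 0)"
  proof (rule sum.cong[OF refl])
    fix l assume "l \<in> T"
    have "jac_op f is js (mpol_var l) * g l = (\<Sum>k\<in>{k. k \<le> length is \<and> js ! k = l}. c k * g (js ! k))"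
      by (simp add: jac_op_var c_def sum_distrib_right)
    also have "\<dots> = (\<Sum>k\<in>{k. k \<le> length is \<and> js ! k \<in> T}. if js ! k = l then c k * g (js ! k) else 0)"
      using \<open>l \<in> T\<close> by (intro sum.mono_neutral_cong_left) auto
    finally show "jac_op f is js (mpol_var l) * g l =
        (\<Sum>k\<in>{k. k \<le> length is \<and> js ! k \<in> T}. if js ! k = l then c k * g (js ! k) else 0)" .
  qed
  also have "\<dots> = (\<Sum>k\<in>{k. k \<le> length is \<and> js ! k \<in> T}. \<Sum>l\<in>T. if js ! k = l then c k * g (js ! k) else 0)"
    by (rule sum.swap)
  also have "\<dots> = (\<Sum>k\<in>{k. k \<le> length is \<and> js ! k \<in> T}. c k * g (js ! k))"
    using assms by (intro sum.cong) auto
  finally show ?thesis by (simp add: c_def)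
qed

lemma jac_op_expand:
  assumes "finite T" "set js \<subseteq> T" "length js = Suc (length is)"
  shows "jac_op f is js p = (\<Sum>l\<in>T. mpol_diff l p * jac_op f is js (mpol_var l))"
proof -
  have "{k. k \<le> length is \<and> js ! k \<in> T} = {..length is}"
    using assms(2,3) by (auto simp: subset_iff)
  then have "(\<Sum>l\<in>T. jac_op f is js (mpol_var l) * mpol_diff l p) = jac_op f is js p"
    using sum_jac_op_var[OF assms(1), of f "is" js "\<lambda>l. mpol_diff l p"]
    by (simp only: jac_op_def [of f "is" js p])
  moreover have "(\<Sum>l\<in>T. jac_op f is js (mpol_var l) * mpol_diff l p) =
      (\<Sum>l\<in>T. mpol_diff l p * jac_op f is js (mpol_var l))"
    by (intro sum.cong refl mult.commute)
  ultimately show ?thesis by simp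
qed

text \<open>Horner's scheme builds a polynomial in one more variable by sums and products, so
  constants and variables generate everything.\<close>

lemma mpol_in_induct [consumes 2, case_names const var add mult]:
  fixes p :: "'k::field mpol"
  assumes "finite V" "p \<in> mpol_in V"
    and const: "\<And>c. P (mpol_const c)" and var: "\<And>i. i \<in> V \<Longrightarrow> P (mpol_var i)"
    and add: "\<And>p q. p \<in> mpol_in V \<Longrightarrow> q \<in> mpol_in V \<Longrightarrow> P p \<Longrightarrow> P q \<Longrightarrow> P (p + q)"
    and mult: "\<And>p q. p \<in> mpol_in V \<Longrightarrow> q \<in> mpol_in V \<Longrightarrow> P p \<Longrightarrow> P q \<Longrightarrow> P (p * q)"
  shows "P p"
proof -
  have "P p" if "finite W" "W \<subseteq> V" "p \<in> mpol_in W" for W p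
    using that
  proof (induction W arbitrary: p rule: finite_induct)
    case empty
    obtain c where "p = mpol_const c" using mpol_in_empty[OF empty(2)] by blast
    then show ?case using const by simp
  next
    case (insert i W)
    have WV: "W \<subseteq> V" "i \<in> V" using insert.prems by auto
    obtain q where q: "\<And>k. coeff q k \<in> mpol_in W" "p = poly q (mpol_var i)"
      using mpol_in_insert[OF insert.prems(2)] by metis
    have "P (poly q (mpol_var i)) \<and> poly q (mpol_var i) \<in> mpol_in V"
      if "\<And>k. coeff q k \<in> mpol_in W" for q
      using that
    proof (induction q rule: pCons_induct)
      case 0
      have "P (mpol_const 0)" by (rule const)
      then show ?case by (simp add: mpol_const_def)
    next
      case (pCons a q)
      have "a \<in> mpol_in W" using pCons.prems[of 0] by simp
      then have a: "P a" "a \<in> mpol_in V" using insert.IH WV(1) mpol_in_mono[OF WV(1)] by auto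
      have q: "P (poly q (mpol_var i))" "poly q (mpol_var i) \<in> mpol_in V"
        using pCons.IH pCons.prems[of "Suc _"] by auto
      have x: "P (mpol_var i)" "mpol_var i \<in> mpol_in V" using var WV(2) by (auto intro: mpol_in_var)
      have xq: "P (mpol_var i * poly q (mpol_var i))" "mpol_var i * poly q (mpol_var i) \<in> mpol_in V"
        by (rule mult[OF x(2) q(2) x(1) q(1)], rule mpol_in_mult[OF x(2) q(2)])
      show ?case using add[OF a(2) xq(2) a(1) xq(1)] mpol_in_add[OF a(2) xq(2)] by simp
    qed
    then show ?case using q by blast
  qed
  from this[of V p] show ?thesis using assms(1,2) by blast
qed

context affine_domain
begin

abbreviation "r \<equiv> jacobi_rank n m f"
abbreviation "mp \<equiv> minor_poly f"
abbreviation "NR \<equiv> nonsing_rows n m f r"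
abbreviation "NC \<equiv> nonsing_cols n m f r"
abbreviation "EC \<equiv> ext_cols n m f r"

lemma minor_nonzero_iff: "set is \<subseteq> {1..m} \<Longrightarrow> minor n m f is js \<noteq> \<zero>\<^bsub>A\<^esub> \<longleftrightarrow> mp is js \<notin> Iext"
  by (simp add: minor_eq_cls Iext_def)

lemma NR_D: "is \<in> NR \<Longrightarrow> length is = r \<and> sorted_wrt (<) is \<and> set is \<subseteq> {1..m}"
  by (simp add: nonsing_rows_def)

lemma NC_D:
  assumes "js \<in> NC"
  shows "length js = r" "sorted_wrt (<) js" "set js \<subseteq> N" "distinct js"
    "\<exists>is. length is = r \<and> set is \<subseteq> {1..m} \<and> mp is js \<notin> Iext"
  using assms minor_nonzero_iff strict_sorted_iff[of js] unfolding nonsing_cols_def by blast+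

lemma EC_D:
  assumes "js \<in> EC"
  shows "length js = Suc r" "sorted_wrt (<) js" "set js \<subseteq> N" "distinct js"
  using assms strict_sorted_iff[of js] unfolding ext_cols_def by auto

text \<open>A prime above \<open>K\<close> would leave out some minor of size \<open>r\<close> by
  the Jacobian criterion. This minor is nonzero, so its rows and columns are distinct and can be
  sorted at the cost of a sign. The two sorted tuples then witness each other's
  non-singularity.\<close>

lemma nonsing_cover:
  assumes reg: "regular_ring A" and K: "ideal K A"
    and mem: "\<And>is js. is \<in> NR \<Longrightarrow> js \<in> NC \<Longrightarrow> cls (mp is js) \<in> K"
  shows "\<one>\<^bsub>A\<^esub> \<in> K"
proof (rule ccontr)
  assume 1: "\<one>\<^bsub>A\<^esub> \<notin> K"
  have noeth: "noetherian_ring A" using reg by (simp add: regular_ring_def)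
  obtain p where p: "primeideal p A" "K \<subseteq> p"
    using noetherian_ring.exists_prime_above[OF noeth A.is_cring K 1] by blast
  interpret p: primeideal p A by (rule p)
  obtain is0 js0 where 0: "length is0 = r" "set is0 \<subseteq> {1..m}" "length js0 = r" "set js0 \<subseteq> N"
     "minor n m f is0 js0 \<noteq> \<zero>\<^bsub>A\<^esub>" using exists_rank_minor by blast
  obtain "is" js where ij: "length is = r" "set is \<subseteq> {1..m}" "length js = r" "set js \<subseteq> N"
    "minor n m f is js \<notin> p"
    by (rule jacobian_criterion[OF reg p(1) 0])
  have "mp is js \<noteq> 0" using ij(5) minor_eq_cls[OF ij(2)] cls_0 p.zero_closed by metis
  then have dist: "distinct is" "distinct js"
    using sub_det_rows_distinct[of _ "is" js] sub_det_cols_distinct[of _ "is" js] ij(1,3)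
    unfolding minor_poly_eq_sub_det by auto
  have len: "length (sort is) = r" "length (sort js) = r" using ij by auto
  have "mp (sort is) (sort js) = signof (sort_perm js) * mp (sort is) js"
    using sub_det_permute_cols[OF sort_perm(1)[OF dist(2)], of "sort is"] ij(1,3)
    unfolding minor_poly_eq_sub_det by (simp add: sort_perm(2)[OF dist(2)])
  also have "mp (sort is) js = signof (sort_perm is) * mp is js"
    using sub_det_permute_rows[OF sort_perm(1)[OF dist(1)]]
    unfolding minor_poly_eq_sub_det by (simp add: sort_perm(2)[OF dist(1)])
  finally have eq: "mp (sort is) (sort js) = signof (sort_perm js) * (signof (sort_perm is) * mp is js)" .
  have notp: "cls (mp (sort is) (sort js)) \<notin> p"
  proof
    assume "cls (mp (sort is) (sort js)) \<in> p"
    then have "cls (signof (sort_perm is)) \<otimes>\<^bsub>A\<^esub> (cls (signof (sort_perm js)) \<otimes>\<^bsub>A\<^esub> cls (mp (sort is) (sort js))) \<in> p"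
      by (intro p.I_l_closed) auto
    then have "cls (signof (sort_perm is) * (signof (sort_perm js) * mp (sort is) (sort js))) \<in> p"
      by (simp only: cls_mult)
    moreover have "signof (sort_perm is) * (signof (sort_perm js) * mp (sort is) (sort js)) =
        (signof (sort_perm is) * signof (sort_perm is)) * ((signof (sort_perm js) * signof (sort_perm js)) * mp is js)"
      unfolding eq by (simp only: mult_ac)
    ultimately have "cls (mp is js) \<in> p" by (simp only: signof_square mult_1)
    then show False using ij(5) minor_eq_cls[OF ij(2)] by simp
  qed
  then have nz: "minor n m f (sort is) (sort js) \<noteq> \<zero>\<^bsub>A\<^esub>"
    using minor_eq_cls[of "sort is" "sort js"] ij(2) p.zero_closed by (metis set_sort)
  have ss: "sorted_wrt (<) (sort is)" "sorted_wrt (<) (sort js)"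
    using dist by (auto simp: strict_sorted_iff)
  have "sort is \<in> NR" unfolding nonsing_rows_def using nz ss ij len by auto
  moreover have "sort js \<in> NC" unfolding nonsing_cols_def using nz ss ij len by auto
  ultimately show False using mem[of "sort is" "sort js"] notp p(2) by blast
qed

end

section \<open>The module of derivations and its presentation\<close>

lemma (in cring) func_space_simps:
  "carrier (func_space S) = S \<rightarrow>\<^sub>E carrier R"
  "\<zero>\<^bsub>func_space S\<^esub> = (\<lambda>v\<in>S. \<zero>)"
  "a \<oplus>\<^bsub>func_space S\<^esub> b = (\<lambda>v\<in>S. a v \<oplus> b v)"
  "c \<odot>\<^bsub>func_space S\<^esub> a = (\<lambda>v\<in>S. c \<otimes> a v)"
  by (simp_all add: func_space_def)

context affine_domain
begin

lemma cls_eq_iff: "cls p = cls q \<longleftrightarrow> p - q \<in> Iext"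
  by (simp add: Iext_def cls_diff A.r_right_minus_eq)

text \<open>
  A derivation of \<open>A\<close> is encoded by a family \<open>y\<close> of polynomials that lift the images of the variables;
  \<open>tangent\<close> says that the derivation with these values exists.
\<close>
definition dop :: "(nat \<Rightarrow> 'k mpol) \<Rightarrow> 'k mpol \<Rightarrow> 'k mpol" where
  "dop y p = (\<Sum>l\<in>N. mpol_diff l p * y l)"

definition tangent :: "(nat \<Rightarrow> 'k mpol) \<Rightarrow> bool" where
  "tangent y \<longleftrightarrow> (\<forall>i\<in>{1..m}. dop y (f i) \<in> Iext)"

lemma dop_add: "dop y (p + q) = dop y p + dop y q"
  by (simp add: dop_def mpol_diff_add distrib_right sum.distrib)

lemma dop_diff: "dop y (p - q) = dop y p - dop y q"
  by (simp add: dop_def mpol_diff_diff left_diff_distrib sum_subtractf)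

lemma dop_mult: "dop y (p * q) = dop y p * q + p * dop y q"
  by (simp add: dop_def mpol_diff_mult distrib_right distrib_left sum.distrib sum_distrib_left sum_distrib_right mult_ac)

lemma dop_const: "dop y (mpol_const c) = 0"
  by (simp add: dop_def)

lemma dop_sum: "dop y (sum g T) = (\<Sum>t\<in>T. dop y (g t))"
  by (induction T rule: infinite_finite_induct) (simp_all add: dop_add, simp_all add: dop_def)

lemma dop_var:
  assumes "l \<in> N"
  shows "dop y (mpol_var l) = y l"
proof -
  have "dop y (mpol_var l) = (\<Sum>k\<in>N. if l = k then y k else 0)"
    unfolding dop_def mpol_diff_var by (intro sum.cong) auto
  then show ?thesis using assms by (simp del: atLeastAtMost_iff)
qed

lemma dop_smult: "dop (\<lambda>l. a * y l) p = a * dop y p"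
  by (simp add: dop_def sum_distrib_left mult_ac)

lemma dop_field_add: "dop (\<lambda>l. y l + z l) p = dop y p + dop z p"
  by (simp add: dop_def distrib_left sum.distrib)

lemma dop_field_diff: "dop (\<lambda>l. y l - z l) p = dop y p - dop z p"
  by (simp add: dop_def right_diff_distrib sum_subtractf)

lemma dop_field_sum: "dop (\<lambda>l. \<Sum>t\<in>T. y t l) p = (\<Sum>t\<in>T. dop (y t) p)"
  unfolding dop_def sum_distrib_left by (rule sum.swap)

lemma dop_in: "(\<And>l. l \<in> N \<Longrightarrow> y l \<in> Iext) \<Longrightarrow> dop y p \<in> Iext"
  unfolding dop_def by (intro Iext.sum Iext.mult)

lemma tangent_add: "tangent y \<Longrightarrow> tangent z \<Longrightarrow> tangent (\<lambda>l. y l + z l)"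
  by (simp add: tangent_def dop_field_add Iext.add)

lemma tangent_diff: "tangent y \<Longrightarrow> tangent z \<Longrightarrow> tangent (\<lambda>l. y l - z l)"
  by (simp add: tangent_def dop_field_diff Iext.diff)

lemma tangent_smult: "tangent y \<Longrightarrow> tangent (\<lambda>l. a * y l)"
  by (simp add: tangent_def dop_smult Iext.mult)

lemma tangent_sum: "(\<And>t. t \<in> T \<Longrightarrow> tangent (y t)) \<Longrightarrow> tangent (\<lambda>l. \<Sum>t\<in>T. y t l)"
  by (simp add: tangent_def dop_field_sum Iext.sum)

lemma tangent_0: "tangent (\<lambda>_. 0)"
  by (simp add: tangent_def dop_def Iext.zero)

text \<open>On a combination of the \<open>f i\<close>, the product rule leaves multiples of
  \<open>f i\<close> and of \<open>dop y (f i)\<close>, all in \<open>Iext\<close>. Hence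
  \<open>dop y\<close> passes to classes.\<close>

lemma dop_Iext:
  assumes "tangent y" "p \<in> Iext" "p \<in> mpol_in N"
  shows "dop y p \<in> Iext"
proof -
  obtain a where p: "p = (\<Sum>i\<in>{1..m}. a i * f i)" using Iext_combination[OF assms(2,3)] by blast
  show ?thesis unfolding p dop_sum dop_mult
    using assms(1) f_Iext by (intro Iext.sum Iext.add Iext.mult) (simp_all add: tangent_def)
qed

text \<open>A total definition through a chosen representative; for tangent \<open>y\<close> the
  value is independent of the choice.\<close>

definition der :: "(nat \<Rightarrow> 'k mpol) \<Rightarrow> 'k mpol set \<Rightarrow> 'k mpol set" where
  "der y = (\<lambda>x\<in>carrier A. cls (dop y (SOME p. p \<in> mpol_in N \<and> cls p = x)))"

lemma der_cls:
  assumes "tangent y" "p \<in> mpol_in N"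
  shows "der y (cls p) = cls (dop y p)"
proof -
  define q where "q = (SOME q. q \<in> mpol_in N \<and> cls q = cls p)"
  have q: "q \<in> mpol_in N \<and> cls q = cls p"
    unfolding q_def by (rule someI[of _ p]) (simp add: assms(2))
  then have "dop y (q - p) \<in> Iext"
    using assms by (intro dop_Iext) (simp_all add: cls_eq_iff mpol_in_diff)
  then have "cls (dop y q) = cls (dop y p)" by (simp add: cls_eq_iff dop_diff)
  moreover have "der y (cls p) = cls (dop y q)" unfolding q_def by (simp add: der_def)
  ultimately show ?thesis by simp
qed

lemma der_extensional: "der y \<in> carrier A \<rightarrow>\<^sub>E carrier A"
  by (simp add: der_def)

abbreviation "consts \<equiv> range (\<lambda>c. residue_class n m f (mpol_const c))"

lemma der_in: 
  assumes "tangent y"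
  shows "der y \<in> derivations A consts"
  unfolding derivations_def
proof (intro CollectI conjI ballI)
  show "der y \<in> carrier A \<rightarrow>\<^sub>E carrier A" by (rule der_extensional)
  fix a b assume a: "a \<in> carrier A"
  obtain p where p: "p \<in> mpol_in N" "a = cls p" using a by (rule cls_surj)
  show "der y (a \<oplus>\<^bsub>A\<^esub> b) = der y a \<oplus>\<^bsub>A\<^esub> der y b"
    and "der y (a \<otimes>\<^bsub>A\<^esub> b) = der y a \<otimes>\<^bsub>A\<^esub> b \<oplus>\<^bsub>A\<^esub> a \<otimes>\<^bsub>A\<^esub> der y b" if b: "b \<in> carrier A"
  proof -
    obtain q where q: "q \<in> mpol_in N" "b = cls q" using b by (rule cls_surj)
    show "der y (a \<oplus>\<^bsub>A\<^esub> b) = der y a \<oplus>\<^bsub>A\<^esub> der y b"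
      using p q by (simp add: cls_add [symmetric] der_cls assms mpol_in_add dop_add)
    show "der y (a \<otimes>\<^bsub>A\<^esub> b) = der y a \<otimes>\<^bsub>A\<^esub> b \<oplus>\<^bsub>A\<^esub> a \<otimes>\<^bsub>A\<^esub> der y b"
      using p q by (simp add: cls_add [symmetric] cls_mult [symmetric] der_cls assms mpol_in_mult dop_mult)
  qed
  fix c assume "c \<in> consts"
  then obtain k where "c = cls (mpol_const k)" by (auto simp: cls_eq)
  then show "der y (c \<otimes>\<^bsub>A\<^esub> a) = c \<otimes>\<^bsub>A\<^esub> der y a"
    using p by (simp add: cls_mult [symmetric] der_cls assms mpol_in_mult dop_mult dop_const)
qed

text \<open>A derivation that is linear over the constants is determined by its values on the
  variables, which \<open>y\<close> lifts. It is tangent because \<open>d\<close> maps the classes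
  of the \<open>f i\<close>, which are zero, to zero.\<close>

lemma der_exhaust:
  assumes "d \<in> derivations A consts"
  shows "\<exists>y. tangent y \<and> d = der y"
proof -
  have dE: "d \<in> carrier A \<rightarrow>\<^sub>E carrier A"
    and d_add: "\<And>a b. a \<in> carrier A \<Longrightarrow> b \<in> carrier A \<Longrightarrow> d (a \<oplus>\<^bsub>A\<^esub> b) = d a \<oplus>\<^bsub>A\<^esub> d b"
    and d_mult: "\<And>a b. a \<in> carrier A \<Longrightarrow> b \<in> carrier A \<Longrightarrow> d (a \<otimes>\<^bsub>A\<^esub> b) = d a \<otimes>\<^bsub>A\<^esub> b \<oplus>\<^bsub>A\<^esub> a \<otimes>\<^bsub>A\<^esub> d b"
    and d_smult: "\<And>c a. c \<in> consts \<Longrightarrow> a \<in> carrier A \<Longrightarrow> d (c \<otimes>\<^bsub>A\<^esub> a) = c \<otimes>\<^bsub>A\<^esub> d a"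
    using assms unfolding derivations_def by blast+
  have dA: "d a \<in> carrier A" if "a \<in> carrier A" for a using dE that by (rule PiE_mem)
  have "\<exists>q. d (cls (mpol_var l)) = cls q" for l
  proof -
    have "d (cls (mpol_var l)) \<in> carrier A" by (rule dA) simp
    then obtain q where "d (cls (mpol_var l)) = cls q" by (rule cls_surj)
    then show ?thesis by blast
  qed
  then obtain y where y: "\<And>l. d (cls (mpol_var l)) = cls (y l)" by metis
  have d1: "d \<one>\<^bsub>A\<^esub> = \<zero>\<^bsub>A\<^esub>"
  proof -
    have "d \<one>\<^bsub>A\<^esub> = d \<one>\<^bsub>A\<^esub> \<oplus>\<^bsub>A\<^esub> d \<one>\<^bsub>A\<^esub>" using d_mult[of "\<one>\<^bsub>A\<^esub>" "\<one>\<^bsub>A\<^esub>"] dA by simp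
    then show ?thesis using dA[of "\<one>\<^bsub>A\<^esub>"] by (metis A.add.l_cancel_one A.one_closed)
  qed
  have d_cls: "d (cls p) = cls (dop y p)" if p: "p \<in> mpol_in N" for p
    using finite_atLeastAtMost p
  proof (induction rule: mpol_in_induct)
    case (const c)
    have "cls (mpol_const c) \<in> consts" by (auto simp: cls_eq)
    then have "d (cls (mpol_const c) \<otimes>\<^bsub>A\<^esub> \<one>\<^bsub>A\<^esub>) = cls (mpol_const c) \<otimes>\<^bsub>A\<^esub> d \<one>\<^bsub>A\<^esub>" by (rule d_smult) simp
    then show ?case by (simp add: d1 dop_const cls_0)
  next
    case (var i)
    then show ?case by (simp only: y dop_var)
  next
    case (add p q)
    then show ?case by (simp add: cls_add d_add dop_add)
  next
    case (mult p q)
    then show ?case by (simp add: cls_add cls_mult d_mult dop_mult)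
  qed
  have "tangent y" unfolding tangent_def
  proof
    fix i assume i: "i \<in> {1..m}"
    have "d \<zero>\<^bsub>A\<^esub> = d \<zero>\<^bsub>A\<^esub> \<oplus>\<^bsub>A\<^esub> d \<zero>\<^bsub>A\<^esub>" using d_add[of "\<zero>\<^bsub>A\<^esub>" "\<zero>\<^bsub>A\<^esub>"] by simp
    then have "d \<zero>\<^bsub>A\<^esub> = \<zero>\<^bsub>A\<^esub>" using dA[of "\<zero>\<^bsub>A\<^esub>"] by (metis A.add.l_cancel_one A.zero_closed)
    moreover have "cls (f i) = \<zero>\<^bsub>A\<^esub>" using f_Iext[OF i] by (simp add: Iext_def)
    ultimately show "dop y (f i) \<in> Iext" using d_cls[OF f_in[OF i]] by (simp add: Iext_def)
  qed
  moreover from this have "d = der y"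
  proof (intro PiE_ext[OF dE der_extensional])
    fix a assume "a \<in> carrier A"
    then obtain p where p: "p \<in> mpol_in N" "a = cls p" by (rule cls_surj)
    then show "d a = der y a" using d_cls der_cls \<open>tangent y\<close> by simp
  qed
  ultimately show ?thesis by blast
qed

lemma der_eq_iff:
  assumes "tangent y" "tangent z"
  shows "der y = der z \<longleftrightarrow> (\<forall>l\<in>N. y l - z l \<in> Iext)"
proof
  assume eq: "der y = der z"
  show "\<forall>l\<in>N. y l - z l \<in> Iext"
  proof
    fix l assume l: "l \<in> N"
    have "der y (cls (mpol_var l)) = der z (cls (mpol_var l))" by (simp only: eq)
    then have "cls (dop y (mpol_var l)) = cls (dop z (mpol_var l))"
      using assms l by (simp only: der_cls mpol_in_var)
    then show "y l - z l \<in> Iext" by (simp only: dop_var[OF l] cls_eq_iff)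
  qed
next
  assume *: "\<forall>l\<in>N. y l - z l \<in> Iext"
  show "der y = der z"
  proof (rule PiE_ext[OF der_extensional der_extensional])
    fix a assume "a \<in> carrier A"
    then obtain p where p: "p \<in> mpol_in N" "a = cls p" by (rule cls_surj)
    have "dop (\<lambda>l. y l - z l) p \<in> Iext" using * by (intro dop_in) blast
    then show "der y a = der z a" using assms p by (simp add: der_cls cls_eq_iff dop_field_diff)
  qed
qed

section \<open>The module of derivations, computed with lifted values\<close>

abbreviation "DM \<equiv> Der n m f"
abbreviation "FA \<equiv> A.func_space (carrier A)"

lemma DM_eq: "DM = FA\<lparr>carrier := derivations A consts\<rparr>"
  by (simp add: Der_def derivation_module_def)

lemma FA_add_der:
  assumes "tangent y" "tangent z"
  shows "der y \<oplus>\<^bsub>FA\<^esub> der z = der (\<lambda>l. y l + z l)"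
proof (rule PiE_ext[of _ "carrier A" "\<lambda>_. carrier A"])
  show "der y \<oplus>\<^bsub>FA\<^esub> der z \<in> carrier A \<rightarrow>\<^sub>E carrier A"
    using der_extensional[of y] der_extensional[of z] by (auto simp: A.func_space_simps)
  fix a assume a: "a \<in> carrier A"
  then obtain p where p: "p \<in> mpol_in N" "a = cls p" by (rule cls_surj)
  have "(der y \<oplus>\<^bsub>FA\<^esub> der z) a = der y a \<oplus>\<^bsub>A\<^esub> der z a" using a by (rule A.func_space_add_apply)
  also have "\<dots> = der (\<lambda>l. y l + z l) a"
    using p assms by (simp add: der_cls tangent_add dop_field_add cls_add)
  finally show "(der y \<oplus>\<^bsub>FA\<^esub> der z) a = der (\<lambda>l. y l + z l) a" .
qed (rule der_extensional)

lemma FA_smult_der: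
  assumes "tangent y"
  shows "cls c \<odot>\<^bsub>FA\<^esub> der y = der (\<lambda>l. c * y l)"
proof (rule PiE_ext[of _ "carrier A" "\<lambda>_. carrier A"])
  show "cls c \<odot>\<^bsub>FA\<^esub> der y \<in> carrier A \<rightarrow>\<^sub>E carrier A"
    using der_extensional[of y] by (auto simp: A.func_space_simps)
  fix a assume a: "a \<in> carrier A"
  then obtain p where p: "p \<in> mpol_in N" "a = cls p" by (rule cls_surj)
  have "(cls c \<odot>\<^bsub>FA\<^esub> der y) a = cls c \<otimes>\<^bsub>A\<^esub> der y a" using a by (simp add: A.func_space_simps)
  also have "\<dots> = der (\<lambda>l. c * y l) a"
    using p assms by (simp add: der_cls tangent_smult dop_smult cls_mult)
  finally show "(cls c \<odot>\<^bsub>FA\<^esub> der y) a = der (\<lambda>l. c * y l) a" .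
qed (rule der_extensional)

lemma FA_zero_der: "\<zero>\<^bsub>FA\<^esub> = der (\<lambda>_. 0)"
  by (simp add: A.func_space_simps der_def dop_def cls_0)

lemma module_FA: "module A FA"
  by (rule A.func_space_is_module)

lemma submodule_derivations: "submodule A (derivations A consts) FA"
proof (rule submodule.intro)
  show "derivations A consts \<subseteq> carrier FA"
    by (auto simp: derivations_def A.func_space_simps)
  show "\<zero>\<^bsub>FA\<^esub> \<in> derivations A consts" unfolding FA_zero_der by (rule der_in[OF tangent_0])
next
  fix v w assume "v \<in> derivations A consts" "w \<in> derivations A consts"
  then obtain y z where "tangent y" "v = der y" "tangent z" "w = der z" using der_exhaust by meson
  then show "v \<oplus>\<^bsub>FA\<^esub> w \<in> derivations A consts" by (simp add: FA_add_der der_in tangent_add)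
next
  fix c v assume c: "c \<in> carrier A" and "v \<in> derivations A consts"
  then obtain y where y: "tangent y" "v = der y" using der_exhaust by meson
  obtain p where "c = cls p" using c by (rule cls_surj)
  then show "c \<odot>\<^bsub>FA\<^esub> v \<in> derivations A consts" using y by (simp add: FA_smult_der der_in tangent_smult)
qed (rule module_FA)

lemma module_DM: "module A DM"
  unfolding DM_eq by (rule module.submodule_is_module[OF module_FA submodule_derivations])

lemma carrier_DM: "carrier DM = derivations A consts"
  by (simp add: DM_eq)

lemma DM_ops:
  "tangent y \<Longrightarrow> tangent z \<Longrightarrow> der y \<oplus>\<^bsub>DM\<^esub> der z = der (\<lambda>l. y l + z l)"
  "tangent y \<Longrightarrow> cls c \<odot>\<^bsub>DM\<^esub> der y = der (\<lambda>l. c * y l)"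
  "\<zero>\<^bsub>DM\<^esub> = der (\<lambda>_. 0)"
  using FA_add_der[of y z] FA_smult_der[of y c] FA_zero_der by (simp_all add: DM_eq)

lemma DM_combination:
  assumes "finite T" "\<And>s. s \<in> T \<Longrightarrow> tangent (Y s)"
  shows "(\<Oplus>\<^bsub>DM\<^esub>s\<in>T. cls (c s) \<odot>\<^bsub>DM\<^esub> der (Y s)) = der (\<lambda>l. \<Sum>s\<in>T. c s * Y s l)"
  using assms
proof (induction T rule: finite_induct)
  interpret DM: module A DM by (rule module_DM)
  case empty
  show ?case by (simp add: DM_ops(3))
next
  interpret DM: module A DM by (rule module_DM)
  case (insert s T)
  have mem: "cls (c t) \<odot>\<^bsub>DM\<^esub> der (Y t) \<in> carrier DM" if "t \<in> insert s T" for t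
    using insert.prems[OF that] by (simp add: DM_ops(2) carrier_DM der_in tangent_smult)
  have "(\<Oplus>\<^bsub>DM\<^esub>s\<in>insert s T. cls (c s) \<odot>\<^bsub>DM\<^esub> der (Y s)) =
      cls (c s) \<odot>\<^bsub>DM\<^esub> der (Y s) \<oplus>\<^bsub>DM\<^esub> (\<Oplus>\<^bsub>DM\<^esub>s\<in>T. cls (c s) \<odot>\<^bsub>DM\<^esub> der (Y s))"
    using mem insert.hyps by (intro DM.finsum_insert) auto
  also have "\<dots> = der (\<lambda>l. c s * Y s l) \<oplus>\<^bsub>DM\<^esub> der (\<lambda>l. \<Sum>s\<in>T. c s * Y s l)"
    using insert by (simp add: DM_ops(2))
  also have "\<dots> = der (\<lambda>l. c s * Y s l + (\<Sum>s\<in>T. c s * Y s l))"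
    using insert.prems by (intro DM_ops(1) tangent_smult tangent_sum) auto
  finally show ?case using insert.hyps by simp
qed

definition jac_field :: "nat list \<Rightarrow> nat list \<Rightarrow> nat \<Rightarrow> 'k mpol" where
  "jac_field is js l = jac_op f is js (mpol_var l)"

lemma dop_jac_field:
  assumes "set js \<subseteq> N" "length js = Suc (length is)"
  shows "dop (jac_field is js) p = jac_op f is js p"
  unfolding dop_def jac_field_def by (rule jac_op_expand[OF finite_atLeastAtMost assms, symmetric])

text \<open>The operator maps \<open>f i\<close> to a minor of size \<open>r + 1\<close>, which
  vanishes in \<open>A\<close> because the rank is \<open>r\<close>.\<close>

lemma tangent_jac_field:
  assumes "length is = r" "set is \<subseteq> {1..m}" "length js = Suc r" "set js \<subseteq> N"
  shows "tangent (jac_field is js)"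
  unfolding tangent_def
proof
  fix i assume "i \<in> {1..m}"
  then have "mp (is @ [i]) js \<in> Iext" using assms by (intro minor_poly_rank_Suc) auto
  then show "dop (jac_field is js) (f i) \<in> Iext"
    using assms by (simp add: dop_jac_field jac_op_generator)
qed

lemma ring_sign_cls: "ring_sign A k = cls ((-1) ^ k)"
  unfolding ring_sign_def
  by (induction k) (simp_all add: cls_1 cls_mult cls_uminus A.m_comm A.l_minus A.r_minus)

text \<open>Every class has a representative in the polynomial ring, so the prescribed values leave
  at most one map for the definite description; tangency provides a map that has them.\<close>

lemma jacobi_derivation_eq:
  assumes "length is = r" "set is \<subseteq> {1..m}" "length js = Suc r" "set js \<subseteq> N"
  shows "jacobi_derivation n m f is js = der (jac_field is js)"
proof -
  have t: "tangent (jac_field is js)" by (rule tangent_jac_field[OF assms])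
  have form: "(\<Oplus>\<^bsub>A\<^esub>k\<in>{0..length is}. ring_sign A (length is + k) \<otimes>\<^bsub>A\<^esub> minor n m f is (omit k js) \<otimes>\<^bsub>A\<^esub>
      residue_class n m f (mpol_diff (js ! k) p)) = der (jac_field is js) (residue_class n m f p)"
    if p: "p \<in> carrier (poly_ring_n n)" for p
  proof -
    have pN: "p \<in> mpol_in N" using p by (simp add: carrier_poly_ring_n)
    have "der (jac_field is js) (residue_class n m f p) = cls (jac_op f is js p)"
      using der_cls[OF t pN] assms by (simp add: cls_eq pN dop_jac_field)
    also have "\<dots> = (\<Oplus>\<^bsub>A\<^esub>k\<in>{..length is}. cls ((-1) ^ (length is + k) * mp is (omit k js) * mpol_diff (js ! k) p))"
      by (simp only: jac_op_def cls_sum)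
    also have "\<dots> = (\<Oplus>\<^bsub>A\<^esub>k\<in>{0..length is}. ring_sign A (length is + k) \<otimes>\<^bsub>A\<^esub> minor n m f is (omit k js) \<otimes>\<^bsub>A\<^esub>
      residue_class n m f (mpol_diff (js ! k) p))"
      unfolding atMost_atLeast0
    proof (rule A.finsum_cong')
      fix k
      show "cls ((-1) ^ (length is + k) * mp is (omit k js) * mpol_diff (js ! k) p) =
          ring_sign A (length is + k) \<otimes>\<^bsub>A\<^esub> minor n m f is (omit k js) \<otimes>\<^bsub>A\<^esub> residue_class n m f (mpol_diff (js ! k) p)"
        using cls_eq[OF mpol_in_diff_mpol[OF pN]] minor_eq_cls[OF assms(2)]
        by (simp add: cls_mult ring_sign_cls)
    next
      show "(\<lambda>k. ring_sign A (length is + k) \<otimes>\<^bsub>A\<^esub> minor n m f is (omit k js) \<otimes>\<^bsub>A\<^esub> residue_class n m f (mpol_diff (js ! k) p))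
          \<in> {0..length is} \<rightarrow> carrier A"
        using cls_eq[OF mpol_in_diff_mpol[OF pN], symmetric] minor_eq_cls[OF assms(2)]
        by (simp add: ring_sign_cls)
    qed simp
    finally show ?thesis ..
  qed
  show ?thesis unfolding jacobi_derivation_def Let_def
  proof (rule the_equality)
    show "der (jac_field is js) \<in> carrier A \<rightarrow>\<^sub>E carrier A \<and>
      (\<forall>p\<in>carrier (poly_ring_n n). der (jac_field is js) (residue_class n m f p) =
        (\<Oplus>\<^bsub>A\<^esub>k\<in>{0..length is}. ring_sign A (length is + k) \<otimes>\<^bsub>A\<^esub> minor n m f is (omit k js) \<otimes>\<^bsub>A\<^esub>
           residue_class n m f (mpol_diff (js ! k) p)))"
      using form der_extensional by simp
  next
    fix d assume d: "d \<in> carrier A \<rightarrow>\<^sub>E carrier A \<and>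
      (\<forall>p\<in>carrier (poly_ring_n n). d (residue_class n m f p) =
        (\<Oplus>\<^bsub>A\<^esub>k\<in>{0..length is}. ring_sign A (length is + k) \<otimes>\<^bsub>A\<^esub> minor n m f is (omit k js) \<otimes>\<^bsub>A\<^esub>
           residue_class n m f (mpol_diff (js ! k) p)))"
    show "d = der (jac_field is js)"
    proof (rule PiE_ext[OF conjunct1[OF d] der_extensional])
      fix a assume "a \<in> carrier A"
      then obtain p where p: "p \<in> mpol_in N" "a = cls p" by (rule cls_surj)
      then have pc: "p \<in> carrier (poly_ring_n n)" by (simp add: carrier_poly_ring_n)
      have "d (residue_class n m f p) = der (jac_field is js) (residue_class n m f p)"
        using bspec[OF conjunct2[OF d] pc] form[OF pc] by simp
      then show "d a = der (jac_field is js) a" using p by (simp add: cls_eq)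
    qed
  qed
qed

text \<open>Among the variables outside \<open>js\<close>, the derivation moves only variable
  \<open>k\<close>. The new column stands last, at position \<open>r\<close> counted from 0, so the
  sign is \<open>(-1) ^ (r + r)\<close>, which is 1.\<close>

lemma jac_field_append:
  assumes "length is = r" "length js = r" "l \<notin> set js"
  shows "jac_field is (js @ [k]) l = (if k = l then mp is js else 0)"
proof -
  have "{t. t \<le> length is \<and> (js @ [k]) ! t = l} = (if k = l then {r} else {})"
  proof -
    have "(js @ [k]) ! t = l \<longleftrightarrow> t = r \<and> k = l" if "t \<le> r" for t
    proof (cases "t < r")
      case True
      then have "js ! t \<in> set js" using assms(2) by (intro nth_mem) simp
      then have "js ! t \<noteq> l" using assms(3) by auto
      then show ?thesis using True assms(2) by (simp add: nth_append)
    next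
      case False
      then show ?thesis using that assms(2) by (simp add: nth_append)
    qed
    then have "{t. t \<le> r \<and> (js @ [k]) ! t = l} = {t. t \<le> r \<and> (t = r \<and> k = l)}"
      by (intro Collect_cong conj_cong refl)
    also have "\<dots> = (if k = l then {r} else {})" by auto
    finally show ?thesis by (simp only: assms(1))
  qed
  moreover have "omit r (js @ [k]) = js" for k using assms(2) by (simp add: omit_def)
  ultimately show ?thesis
    using assms(1) by (simp add: jac_field_def jac_op_var mult_2 [symmetric] power_mult)
qed

text \<open>
  The difference of the two sides is tangent and has no component outside \<open>js\<close>, hence it
  vanishes because \<open>js\<close> is nonsingular.
\<close>
lemma tangent_expansion:
  assumes y: "tangent y" and "is": "length is = r" "set is \<subseteq> {1..m}" and js: "js \<in> NC" and l: "l \<in> N"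
  shows "mp is js * y l - (\<Sum>k\<in>N - set js. y k * jac_field is (js @ [k]) l) \<in> Iext"
proof -
  define z where "z l = mp is js * y l - (\<Sum>k\<in>N - set js. y k * jac_field is (js @ [k]) l)" for l
  note J = NC_D[OF js]
  have "tangent z" unfolding z_def
    using J "is" y by (intro tangent_diff tangent_smult tangent_sum tangent_jac_field) auto
  \<comment> \<open>At a variable outside \<open>js\<close> only the summand of that variable has a
    component, and it cancels the first term.\<close>
  have z0: "z k = 0" if k: "k \<in> N - set js" for k
  proof -
    have "(\<Sum>i\<in>N - set js. y i * jac_field is (js @ [i]) k) = (\<Sum>i\<in>N - set js. if i = k then y i * mp is js else 0)"
      using J "is" k by (intro sum.cong) (simp_all add: jac_field_append)
    also have "\<dots> = y k * mp is js" using k by (subst sum.delta) auto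
    finally show ?thesis by (simp add: z_def mult.commute)
  qed
  \<comment> \<open>These rows witness that \<open>js\<close> is non-singular; they come with
    \<open>js\<close> and are chosen independently of \<open>is\<close>.\<close>
  obtain is' where is': "length is' = r" "set is' \<subseteq> {1..m}" "mp is' js \<notin> Iext" using J(5) by blast
  define M where "M = mat r r (\<lambda>(a, t). mpol_diff (js ! t) (f (is' ! a)))"
  have Mc: "M \<in> carrier_mat r r" by (simp add: M_def)
  have row: "(\<Sum>t<r. M $$ (a, t) * z (js ! t)) \<in> Iext" if a: "a < r" for a
  proof -
    have "dop z (f (is' ! a)) = (\<Sum>k\<in>set js. mpol_diff k (f (is' ! a)) * z k)"
      unfolding dop_def using J(3) z0 by (intro sum.mono_neutral_right) auto
    also have "\<dots> = (\<Sum>t<r. mpol_diff (js ! t) (f (is' ! a)) * z (js ! t))"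
      using sum.reindex_bij_betw[OF bij_betw_nth[OF J(4) refl refl], of "\<lambda>k. mpol_diff k (f (is' ! a)) * z k"] J(1)
      by simp
    also have "\<dots> = (\<Sum>t<r. M $$ (a, t) * z (js ! t))"
      using a by (intro sum.cong) (simp_all add: M_def)
    finally have "dop z (f (is' ! a)) = (\<Sum>t<r. M $$ (a, t) * z (js ! t))" .
    moreover have "is' ! a \<in> {1..m}" using subsetD[OF is'(2) nth_mem[of a is']] is'(1) a by simp
    then have "dop z (f (is' ! a)) \<in> Iext" using \<open>tangent z\<close> unfolding tangent_def by blast
    ultimately show ?thesis by (simp only:)
  qed
  \<comment> \<open>Tangency along the rows \<open>is'\<close> is a square homogeneous system modulo
    \<open>Iext\<close> for the components in \<open>js\<close>. The adjugate matrix turns it into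
    \<open>det M\<close> times each component, and \<open>det M\<close> is outside
    \<open>Iext\<close>.\<close>
  have zt: "z (js ! t) \<in> Iext" if t: "t < r" for t
  proof -
    have entry: "(\<Sum>a<r. adj_mat M $$ (t, a) * M $$ (a, u)) = (if t = u then det M else 0)" if u: "u < r" for u
    proof -
      have "(adj_mat M * M) $$ (t, u) = (\<Sum>a<r. adj_mat M $$ (t, a) * M $$ (a, u))"
        using Mc adj_mat(1)[OF Mc] t u by (simp add: scalar_prod_def lessThan_atLeast0)
      moreover have "(adj_mat M * M) $$ (t, u) = (if t = u then det M else 0)"
        unfolding adj_mat(3)[OF Mc] using t u by simp
      ultimately show ?thesis by (simp only:)
    qed
    have "(\<Sum>a<r. adj_mat M $$ (t, a) * (\<Sum>u<r. M $$ (a, u) * z (js ! u))) =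
        (\<Sum>a<r. \<Sum>u<r. adj_mat M $$ (t, a) * M $$ (a, u) * z (js ! u))"
      by (simp add: sum_distrib_left mult.assoc)
    also have "\<dots> = (\<Sum>u<r. \<Sum>a<r. adj_mat M $$ (t, a) * M $$ (a, u) * z (js ! u))" by (rule sum.swap)
    also have "\<dots> = (\<Sum>u<r. (if t = u then det M else 0) * z (js ! u))"
      by (intro sum.cong) (simp_all add: entry sum_distrib_right [symmetric])
    also have "\<dots> = (\<Sum>u<r. if u = t then det M * z (js ! u) else 0)" by (intro sum.cong) auto
    also have "\<dots> = det M * z (js ! t)" using t by (subst sum.delta) auto
    finally have "(\<Sum>a<r. adj_mat M $$ (t, a) * (\<Sum>u<r. M $$ (a, u) * z (js ! u))) = det M * z (js ! t)" .
    moreover have "(\<Sum>a<r. adj_mat M $$ (t, a) * (\<Sum>u<r. M $$ (a, u) * z (js ! u))) \<in> Iext"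
      by (intro Iext.sum Iext.mult row) simp
    moreover have "det M = mp is' js" using is'(1) by (simp add: M_def minor_poly_def)
    ultimately have "mp is' js * z (js ! t) \<in> Iext" by (simp only:)
    then show ?thesis using is'(3) Iext.prime by blast
  qed
  show ?thesis
  proof (cases "l \<in> set js")
    case True
    then obtain t where t: "t < length js" "js ! t = l" unfolding in_set_conv_nth by (elim exE conjE)
    then have "z l \<in> Iext" using zt[of t] J(1) by simp
    then show ?thesis by (simp only: z_def)
  next
    case False
    have "z l = 0" by (rule z0[OF DiffI[OF l False]])
    then have "z l \<in> Iext" using Iext.zero by simp
    then show ?thesis by (simp only: z_def)
  qed
qed

end

section \<open>The free module on the symbols, the relations and the presentation map\<close>

context affine_domain
begin

abbreviation "S \<equiv> NR \<times> EC"
abbreviation "F \<equiv> A.func_space S"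

lemma finite_S: "finite S"
proof -
  have "NR \<subseteq> {xs. set xs \<subseteq> {1..m} \<and> length xs = r}" by (auto simp: nonsing_rows_def)
  moreover have "EC \<subseteq> {xs. set xs \<subseteq> N \<and> length xs = r + 1}" by (auto simp: ext_cols_def)
  ultimately show ?thesis
    using finite_lists_length_eq[of "{1..m}" r] finite_lists_length_eq[of N "r + 1"]
    by (meson finite_SigmaI finite_atLeastAtMost finite_subset)
qed

text \<open>Elements of the free module by lifted coefficients. Equality is a congruence modulo
  \<open>Iext\<close> at each symbol.\<close>

definition fe :: "(nat list \<times> nat list \<Rightarrow> 'k mpol) \<Rightarrow> nat list \<times> nat list \<Rightarrow> 'k mpol set" where
  "fe c = (\<lambda>s\<in>S. cls (c s))"

lemma fe_closed: "fe c \<in> carrier F"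
  by (simp add: fe_def A.func_space_simps)

lemma fe_exhaust:
  assumes "x \<in> carrier F"
  shows "\<exists>c. x = fe c"
proof -
  have xE: "x \<in> S \<rightarrow>\<^sub>E carrier A" using assms by (simp only: A.func_space_simps)
  have "\<exists>p. s \<in> S \<longrightarrow> x s = cls p" for s
  proof (cases "s \<in> S")
    case True
    then have "x s \<in> carrier A" by (rule PiE_mem[OF xE])
    then obtain p where "x s = cls p" by (rule cls_surj)
    then show ?thesis by blast
  qed simp
  then have "\<forall>s. \<exists>p. s \<in> S \<longrightarrow> x s = cls p" by blast
  from choice[OF this] obtain c where c: "\<forall>s. s \<in> S \<longrightarrow> x s = cls (c s)" by blast
  have "x = fe c"
  proof (rule PiE_ext[OF xE])
    show "fe c \<in> S \<rightarrow>\<^sub>E carrier A" by (simp add: fe_def)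
    fix s assume s: "s \<in> S"
    have "fe c s = cls (c s)" unfolding fe_def by (rule restrict_apply'[OF s])
    then show "x s = fe c s" using c s by metis
  qed
  then show ?thesis by blast
qed

lemma fe_ops:
  "fe c \<oplus>\<^bsub>F\<^esub> fe d = fe (\<lambda>s. c s + d s)"
  "cls a \<odot>\<^bsub>F\<^esub> fe c = fe (\<lambda>s. a * c s)"
  "\<zero>\<^bsub>F\<^esub> = fe (\<lambda>_. 0)"
  unfolding fe_def A.func_space_simps
  by (rule restrict_ext, simp only: restrict_apply' cls_add cls_mult cls_0)+

lemma fe_uminus: "\<ominus>\<^bsub>F\<^esub> fe c = fe (\<lambda>s. - c s)"
proof -
  have "\<ominus>\<^bsub>F\<^esub> fe c = (\<lambda>v. if v \<in> S then \<ominus>\<^bsub>A\<^esub> fe c v else undefined)"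
    by (rule A.func_space_neg[OF fe_closed])
  also have "\<dots> = fe (\<lambda>s. - c s)"
    by (rule ext) (simp only: fe_def restrict_def cls_uminus if_True cong: if_cong)
  finally show ?thesis .
qed

lemma fe_cong: "(\<And>s. s \<in> S \<Longrightarrow> c s - d s \<in> Iext) \<Longrightarrow> fe c = fe d"
  unfolding fe_def by (rule restrict_ext) (simp add: cls_eq_iff)

lemma module_F: "module A F"
  by (rule A.func_space_is_module)

lemma fe_sum:
  assumes "finite T"
  shows "(\<Oplus>\<^bsub>F\<^esub>t\<in>T. cls (a t) \<odot>\<^bsub>F\<^esub> fe (c t)) = fe (\<lambda>s. \<Sum>t\<in>T. a t * c t s)"
proof -
  define g where "g t = fe (\<lambda>s. a t * c t s)" for t
  have gF: "g \<in> T \<rightarrow> carrier F" unfolding g_def by (rule funcsetI) (rule fe_closed)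
  have "finsum F g T \<in> carrier F"
    by (rule abelian_monoid.finsum_closed[OF _ gF])
      (rule abelian_group.axioms(1)[OF module.axioms(2)[OF module_F]])
  then have "finsum F g T \<in> S \<rightarrow>\<^sub>E carrier A" by (simp only: A.func_space_simps)
  moreover have "fe (\<lambda>s. \<Sum>t\<in>T. a t * c t s) \<in> S \<rightarrow>\<^sub>E carrier A"
    using fe_closed by (simp only: A.func_space_simps)
  ultimately have "finsum F g T = fe (\<lambda>s. \<Sum>t\<in>T. a t * c t s)"
  proof (rule PiE_ext)
    fix s assume s: "s \<in> S"
    have "finsum F g T s = (\<Oplus>\<^bsub>A\<^esub>t\<in>T. g t s)" by (rule A.func_space_finsum[OF assms gF s])
    also have "\<dots> = (\<Oplus>\<^bsub>A\<^esub>t\<in>T. cls (a t * c t s))"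
      unfolding g_def fe_def by (simp only: restrict_apply'[OF s])
    also have "\<dots> = fe (\<lambda>s. \<Sum>t\<in>T. a t * c t s) s"
      unfolding fe_def by (simp only: restrict_apply'[OF s] cls_sum)
    finally show "finsum F g T s = fe (\<lambda>s. \<Sum>t\<in>T. a t * c t s) s" .
  qed
  moreover have "g = (\<lambda>t. cls (a t) \<odot>\<^bsub>F\<^esub> fe (c t))"
    by (rule ext) (simp only: g_def fe_ops(2))
  ultimately show ?thesis by (simp only:)
qed

definition sym :: "nat list \<Rightarrow> nat list \<Rightarrow> nat list \<times> nat list \<Rightarrow> 'k mpol" where
  "sym is js s = (if s = (is, sort js) then signof (sort_perm js) else 0)"

lemma free_gen_eq: "free_gen A S s = fe (\<lambda>x. if x = s then 1 else 0)"
  unfolding free_gen_def fe_def by (rule restrict_ext) (simp add: cls_0 cls_1)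

lemma jacobi_symbol_eq: "jacobi_symbol n m f r is js = fe (sym is js)"
proof -
  have "jacobi_symbol n m f r is js =
      (if evenperm (sort_perm js) then free_gen A S (is, sort js) else \<ominus>\<^bsub>F\<^esub> free_gen A S (is, sort js))"
    by (simp only: jacobi_symbol_def Let_def jacobi_index_def sort_perm_def)
  also have "\<dots> = fe (sym is js)"
    by (cases "evenperm (sort_perm js)")
      (auto simp: free_gen_eq fe_uminus sym_def sign_def Iext.zero intro!: fe_cong)
  finally show ?thesis .
qed

definition rel :: "nat list \<Rightarrow> nat list \<Rightarrow> nat list \<Rightarrow> nat list \<Rightarrow> nat list \<times> nat list \<Rightarrow> 'k mpol" where
  "rel is is' js js' s = mp is js * sym is' js' s -
     (\<Sum>\<nu>\<in>{\<nu>\<in>{0..r}. js' ! \<nu> \<notin> set js}. ((-1) ^ (r + \<nu>) * mp is' (omit \<nu> js')) * sym is (js @ [js' ! \<nu>]) s)"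

lemma jacobi_relation_eq:
  assumes "set is \<subseteq> {1..m}" "set is' \<subseteq> {1..m}"
  shows "jacobi_relation n m f r is is' js js' = fe (rel is is' js js')"
proof -
  let ?T = "{\<nu>\<in>{0..r}. js' ! \<nu> \<notin> set js}"
  have "jacobi_relation n m f r is is' js js' =
      cls (mp is js) \<odot>\<^bsub>F\<^esub> fe (sym is' js') \<ominus>\<^bsub>F\<^esub>
      (\<Oplus>\<^bsub>F\<^esub>\<nu>\<in>?T. cls ((-1) ^ (r + \<nu>) * mp is' (omit \<nu> js')) \<odot>\<^bsub>F\<^esub> fe (sym is (js @ [js' ! \<nu>])))"
    by (simp only: jacobi_relation_def Let_def jacobi_index_def jacobi_symbol_eq
        minor_eq_cls[OF assms(1)] minor_eq_cls[OF assms(2)] ring_sign_cls cls_mult)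
  also have "\<dots> = fe (rel is is' js js')"
    unfolding a_minus_def by (subst fe_sum) (simp_all add: fe_ops fe_uminus rel_def [abs_def])
  finally show ?thesis .
qed

text \<open>Deleting \<open>k\<close> from the sorted tuple gives back the non-singular
  \<open>js\<close>, so the symbols on the right sides of the relations are generators up to
  sign.\<close>

lemma sort_append_EC:
  assumes js: "js \<in> NC" and k: "k \<in> N - set js"
  shows "sort (js @ [k]) \<in> EC" "distinct (js @ [k])"
proof -
  note J = NC_D[OF js]
  show d: "distinct (js @ [k])" using J k by simp
  let ?xs = "sort (js @ [k])"
  have "k \<in> set ?xs" by simp
  then obtain us vs where uv: "?xs = us @ k # vs" by (meson split_list)
  have dxs: "distinct ?xs" using d by simp
  have sxs: "sorted (us @ k # vs)" using sorted_sort[of "js @ [k]"] by (simp only: uv)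
  have dist: "distinct (us @ k # vs)" using dxs by (simp only: uv)
  have "set ?xs = insert k (set js)" by simp
  then have "set (us @ k # vs) = insert k (set js)" by (simp only: uv)
  then have "set (us @ vs) = set js" using dist k by auto
  moreover have "sorted (us @ vs)" using sxs by (auto simp: sorted_append)
  moreover have "distinct (us @ vs)" using dist by auto
  moreover have "sorted js" using J(2) by (simp add: strict_sorted_iff)
  ultimately have "us @ vs = js" using J(4) by (intro sorted_distinct_set_unique) auto
  then have om: "omit (length us) ?xs = js" unfolding uv by (simp add: omit_def)
  have "length us < r + 1" using J(1) \<open>us @ vs = js\<close> by auto
  moreover have "sorted_wrt (<) ?xs" using dxs by (simp add: strict_sorted_iff)
  ultimately show "?xs \<in> EC" using om js J(1,3) k unfolding ext_cols_def by auto
qed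

text \<open>The sign of the sorting permutation enters twice, in the symbol and in the sorted
  columns of the derivation, and cancels. So the symbol of an unsorted tuple maps to the derivation
  of that tuple.\<close>

lemma sum_sym_jac_field:
  assumes "(is, sort js) \<in> S" "distinct js" "length js = Suc r"
  shows "(\<Sum>s\<in>S. sym is js s * jac_field (fst s) (snd s) l) = jac_field is js l"
proof -
  have "is \<in> NR" using assms(1) by simp
  then have len: "length js = Suc (length is)" using assms(3) NR_D by simp
  have "(\<Sum>s\<in>S. sym is js s * jac_field (fst s) (snd s) l) =
      (\<Sum>s\<in>S. if s = (is, sort js) then signof (sort_perm js) * jac_field is (sort js) l else 0)"
    by (intro sum.cong) (auto simp: sym_def)
  also have "\<dots> = signof (sort_perm js) * jac_field is (sort js) l"
    using finite_S assms(1) by (subst sum.delta) auto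
  also have "jac_field is (sort js) l = signof (sort_perm js) * jac_field is js l"
    using jac_op_permute[OF len sort_perm(1)[OF assms(2)], of f "mpol_var l"]
    by (simp add: jac_field_def sort_perm(2)[OF assms(2)])
  finally show ?thesis by (simp only: mult.assoc [symmetric] signof_square mult_1)
qed

lemma sym_sorted: "js \<in> EC \<Longrightarrow> sym is js s = (if s = (is, js) then 1 else 0)"
  using sort_perm_sorted[OF EC_D(2)] by (simp add: sym_def)

text \<open>The coefficients in a relation are the values of the derivation
  \<open>jac_field is' js'\<close> at the variables in \<open>js'\<close>. Hence the right side of
  the relation is the expansion of this derivation along \<open>is\<close> and
  \<open>js\<close>.\<close>

lemma sum_relation_indices:
  assumes "is' \<in> NR" "js' \<in> EC"
  shows "(\<Sum>k\<in>N - set js. jac_field is' js' k * g k) =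
    (\<Sum>\<nu>\<in>{\<nu>\<in>{0..r}. js' ! \<nu> \<notin> set js}. ((-1) ^ (r + \<nu>) * mp is' (omit \<nu> js')) * g (js' ! \<nu>))"
proof -
  have len: "length is' = r" using NR_D[OF assms(1)] by simp
  have "js' ! k \<in> N" if "k \<le> r" for k
    using that EC_D(1)[OF assms(2)] subsetD[OF EC_D(3)[OF assms(2)] nth_mem[of k js']] by simp
  then have "{k. k \<le> r \<and> js' ! k \<in> N - set js} = {\<nu>\<in>{0..r}. js' ! \<nu> \<notin> set js}" by auto
  then show ?thesis
    using sum_jac_op_var[of "N - set js" f is' js' g] unfolding jac_field_def len by simp
qed

text \<open>The lifted presentation map: the value at variable \<open>l\<close> of the combination
  of generators with coefficients \<open>c\<close>.\<close>

definition img :: "(nat list \<times> nat list \<Rightarrow> 'k mpol) \<Rightarrow> nat \<Rightarrow> 'k mpol" where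
  "img c l = (\<Sum>s\<in>S. c s * jac_field (fst s) (snd s) l)"

lemma tangent_S:
  assumes "s \<in> S"
  shows "tangent (jac_field (fst s) (snd s))"
proof -
  have "fst s \<in> NR" "snd s \<in> EC" using assms by auto
  then show ?thesis using NR_D[of "fst s"] EC_D(1,3)[of "snd s"] by (intro tangent_jac_field) simp_all
qed

lemma tangent_img: "tangent (img c)"
  unfolding img_def [abs_def] by (intro tangent_sum tangent_smult tangent_S)

lemma combination_eq:
  "(\<Oplus>\<^bsub>DM\<^esub>s\<in>S. fe c s \<odot>\<^bsub>DM\<^esub> (case s of (is, js) \<Rightarrow> jacobi_derivation n m f is js)) = der (img c)"
proof -
  interpret DM: module A DM by (rule module_DM)
  have "(\<Oplus>\<^bsub>DM\<^esub>s\<in>S. fe c s \<odot>\<^bsub>DM\<^esub> (case s of (is, js) \<Rightarrow> jacobi_derivation n m f is js)) =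
      (\<Oplus>\<^bsub>DM\<^esub>s\<in>S. cls (c s) \<odot>\<^bsub>DM\<^esub> der (jac_field (fst s) (snd s)))"
  proof (rule DM.finsum_cong')
    fix s assume s: "s \<in> S"
    obtain "is" js where ij: "s = (is, js)" by (cases s)
    then have "jacobi_derivation n m f is js = der (jac_field is js)"
      using s NR_D[of "is"] EC_D[of js] by (intro jacobi_derivation_eq) auto
    then show "fe c s \<odot>\<^bsub>DM\<^esub> (case s of (is, js) \<Rightarrow> jacobi_derivation n m f is js) =
        cls (c s) \<odot>\<^bsub>DM\<^esub> der (jac_field (fst s) (snd s))"
      using s by (simp add: ij fe_def)
  next
    show "(\<lambda>s. cls (c s) \<odot>\<^bsub>DM\<^esub> der (jac_field (fst s) (snd s))) \<in> S \<rightarrow> carrier DM"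
    proof (rule funcsetI)
      fix s assume "s \<in> S"
      then have "tangent (jac_field (fst s) (snd s))" by (rule tangent_S)
      then show "cls (c s) \<odot>\<^bsub>DM\<^esub> der (jac_field (fst s) (snd s)) \<in> carrier DM"
        by (simp add: DM_ops(2) carrier_DM der_in tangent_smult)
    qed
  qed simp
  also have "\<dots> = der (\<lambda>l. \<Sum>s\<in>S. c s * jac_field (fst s) (snd s) l)"
    by (rule DM_combination[OF finite_S tangent_S])
  finally show ?thesis by (simp only: img_def [abs_def])
qed

lemma der_img_zero_iff: "der (img c) = \<zero>\<^bsub>DM\<^esub> \<longleftrightarrow> (\<forall>l\<in>N. img c l \<in> Iext)"
  unfolding DM_ops(3) der_eq_iff[OF tangent_img tangent_0] by simp

abbreviation "Rel \<equiv> {jacobi_relation n m f r is is' js js' | is is' js js'.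
   is \<in> NR \<and> is' \<in> NR \<and> js \<in> NC \<and> js' \<in> EC}"

lemma Rel_eq: "x \<in> Rel \<longleftrightarrow> (\<exists>is is' js js'. is \<in> NR \<and> is' \<in> NR \<and> js \<in> NC \<and> js' \<in> EC \<and> x = fe (rel is is' js js'))"
proof -
  have "jacobi_relation n m f r is is' js js' = fe (rel is is' js js')" if "is \<in> NR" "is' \<in> NR" for "is" is' js js'
    using NR_D that by (intro jacobi_relation_eq) auto
  then show ?thesis by (smt (verit, best) mem_Collect_eq)
qed

lemma Rel_closed: "Rel \<subseteq> carrier F"
proof
  fix x assume "x \<in> Rel"
  then obtain c where "x = fe c" unfolding Rel_eq by blast
  then show "x \<in> carrier F" by (simp only: fe_closed)
qed

lemma img_symbols:
  assumes "is \<in> NR" "js \<in> NC"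
  shows "img (\<lambda>s. \<Sum>k\<in>N - set js. y k * sym is (js @ [k]) s) l = (\<Sum>k\<in>N - set js. y k * jac_field is (js @ [k]) l)"
proof -
  have "img (\<lambda>s. \<Sum>k\<in>N - set js. y k * sym is (js @ [k]) s) l =
      (\<Sum>s\<in>S. \<Sum>k\<in>N - set js. y k * (sym is (js @ [k]) s * jac_field (fst s) (snd s) l))"
    by (simp only: img_def sum_distrib_right mult.assoc)
  also have "\<dots> = (\<Sum>k\<in>N - set js. \<Sum>s\<in>S. y k * (sym is (js @ [k]) s * jac_field (fst s) (snd s) l))"
    by (rule sum.swap)
  also have "\<dots> = (\<Sum>k\<in>N - set js. y k * jac_field is (js @ [k]) l)"
  proof (rule sum.cong[OF refl])
    fix k assume k: "k \<in> N - set js"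
    have "(\<Sum>s\<in>S. sym is (js @ [k]) s * jac_field (fst s) (snd s) l) = jac_field is (js @ [k]) l"
      using sort_append_EC[OF assms(2) k] assms NC_D(1) by (intro sum_sym_jac_field) auto
    then show "(\<Sum>s\<in>S. y k * (sym is (js @ [k]) s * jac_field (fst s) (snd s) l)) = y k * jac_field is (js @ [k]) l"
      by (simp only: sum_distrib_left [symmetric])
  qed
  finally show ?thesis .
qed

lemma rel_eq:
  assumes "is' \<in> NR" "js' \<in> EC"
  shows "rel is is' js js' s = mp is js * (if s = (is', js') then 1 else 0) -
    (\<Sum>k\<in>N - set js. jac_field is' js' k * sym is (js @ [k]) s)"
  unfolding rel_def sum_relation_indices[OF assms] by (simp only: sym_sorted[OF assms(2)])

text \<open>This is \<open>tangent_expansion\<close> for the tangent family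
  \<open>jac_field is' js'\<close>.\<close>

lemma img_rel:
  assumes "is \<in> NR" "is' \<in> NR" "js \<in> NC" "js' \<in> EC" "l \<in> N"
  shows "img (rel is is' js js') l \<in> Iext"
proof -
  have "img (rel is is' js js') l =
      (\<Sum>s\<in>S. mp is js * (if s = (is', js') then 1 else 0) * jac_field (fst s) (snd s) l)
      - img (\<lambda>s. \<Sum>k\<in>N - set js. jac_field is' js' k * sym is (js @ [k]) s) l"
    unfolding img_def by (simp only: rel_eq[OF assms(2,4)] left_diff_distrib sum_subtractf)
  also have "(\<Sum>s\<in>S. mp is js * (if s = (is', js') then 1 else 0) * jac_field (fst s) (snd s) l) =
      (\<Sum>s\<in>S. if s = (is', js') then mp is js * jac_field is' js' l else 0)"
    by (intro sum.cong) auto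
  also have "\<dots> = mp is js * jac_field is' js' l"
    using finite_S assms(2,4) by (subst sum.delta) auto
  also have "mp is js * jac_field is' js' l - img (\<lambda>s. \<Sum>k\<in>N - set js. jac_field is' js' k * sym is (js @ [k]) s) l =
      mp is js * jac_field is' js' l - (\<Sum>k\<in>N - set js. jac_field is' js' k * jac_field is (js @ [k]) l)"
    by (simp only: img_symbols[OF assms(1,3)])
  also have "\<dots> \<in> Iext"
    using assms NR_D EC_D by (intro tangent_expansion tangent_jac_field) auto
  finally show ?thesis .
qed

text \<open>The scalars that move \<open>x\<close> into \<open>Y\<close> form an ideal.\<close>
lemma mem_submodule_cover:
  assumes reg: "regular_ring A" and M: "module A M" and Y: "submodule A Y M" and x: "x \<in> carrier M"
    and mem: "\<And>is js. is \<in> NR \<Longrightarrow> js \<in> NC \<Longrightarrow> cls (mp is js) \<odot>\<^bsub>M\<^esub> x \<in> Y"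
  shows "x \<in> Y"
proof -
  interpret M: module A M by (rule M)
  interpret Y: submodule A Y M by (rule Y)
  have "ideal {a \<in> carrier A. a \<odot>\<^bsub>M\<^esub> x \<in> Y} A"
    by (rule A.idealI_mult) (use x in \<open>auto simp: M.smult_l_distr M.smult_assoc1 M.lmult_0\<close>)
  then have "\<one>\<^bsub>A\<^esub> \<in> {a \<in> carrier A. a \<odot>\<^bsub>M\<^esub> x \<in> Y}"
    by (rule nonsing_cover[OF reg]) (use mem in simp)
  then show ?thesis using x by simp
qed

text \<open>Fix \<open>is\<close> and \<open>js\<close> and combine the relations for all symbols
  with the coefficients \<open>c\<close>. The result is \<open>mp is js\<close> times
  \<open>c\<close> minus a sum in which the symbol of \<open>js @ [k]\<close> has the coefficient
  \<open>img c k\<close>. For a syzygy these coefficients lie in \<open>Iext\<close>, so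
  \<open>mp is js\<close> times \<open>c\<close> is a combination of relations.\<close>

lemma span_Rel:
  assumes reg: "regular_ring A"
  shows "{c \<in> carrier F. (\<Oplus>\<^bsub>DM\<^esub>s\<in>S. c s \<odot>\<^bsub>DM\<^esub> (case s of (is, js) \<Rightarrow> jacobi_derivation n m f is js)) = \<zero>\<^bsub>DM\<^esub>}
    = module.span A F Rel" (is "?K = _")
proof
  interpret F: module A F by (rule module_F)
  note RelF = Rel_closed
  have K: "fe c \<in> ?K \<longleftrightarrow> (\<forall>l\<in>N. img c l \<in> Iext)" for c
    by (simp only: mem_Collect_eq fe_closed combination_eq der_img_zero_iff simp_thms)
  have KF: "v \<in> carrier F" if "v \<in> ?K" for v using that by (elim CollectE conjE)
  have "submodule A ?K F"
  proof (rule submodule.intro)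
    show "?K \<subseteq> carrier F" by blast
    have "img (\<lambda>_. 0) l = 0" for l by (simp add: img_def)
    then show "\<zero>\<^bsub>F\<^esub> \<in> ?K" unfolding fe_ops(3) K by (simp add: Iext.zero)
    fix v w assume v: "v \<in> ?K" and w: "w \<in> ?K"
    obtain c where c: "v = fe c" using fe_exhaust[OF KF[OF v]] by blast
    obtain d where d: "w = fe d" using fe_exhaust[OF KF[OF w]] by blast
    have "img (\<lambda>s. c s + d s) l = img c l + img d l" for l
      by (simp add: img_def distrib_right sum.distrib)
    then show "v \<oplus>\<^bsub>F\<^esub> w \<in> ?K" using v w unfolding c d fe_ops K by (simp add: Iext.add)
  next
    fix a v assume a: "a \<in> carrier A" and v: "v \<in> ?K"
    obtain c where c: "v = fe c" using fe_exhaust[OF KF[OF v]] by blast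
    obtain p where p: "a = cls p" using a by (rule cls_surj)
    have "img (\<lambda>s. p * c s) l = p * img c l" for l
      by (simp add: img_def sum_distrib_left mult.assoc)
    then show "a \<odot>\<^bsub>F\<^esub> v \<in> ?K" using v unfolding c p fe_ops K by (simp add: Iext.mult)
  qed (rule module_F)
  moreover have "Rel \<subseteq> ?K"
  proof
    fix x assume "x \<in> Rel"
    then obtain "is" is' js js' where *: "is \<in> NR" "is' \<in> NR" "js \<in> NC" "js' \<in> EC" "x = fe (rel is is' js js')"
      unfolding Rel_eq by blast
    show "x \<in> ?K" unfolding *(5) K using img_rel[OF *(1-4)] by blast
  qed
  ultimately show "F.span Rel \<subseteq> ?K" by (intro F.span_is_subset)
  have spanS: "submodule A (F.span Rel) F" by (rule F.span_is_submodule[OF RelF])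
  interpret sp: submodule A "F.span Rel" F by (rule spanS)
  show "?K \<subseteq> F.span Rel"
  proof
    fix x assume x: "x \<in> ?K"
    have xF: "x \<in> carrier F" by (rule KF[OF x])
    obtain c where c: "x = fe c" using fe_exhaust[OF xF] by blast
    have "\<forall>l\<in>N. img c l \<in> Iext" using x unfolding c K .
    then have ic: "img c l \<in> Iext" if "l \<in> N" for l using that by blast
    show "x \<in> F.span Rel"
    proof (rule mem_submodule_cover[OF reg module_F spanS xF])
      fix "is" js assume "is": "is \<in> NR" and js: "js \<in> NC"
      \<comment> \<open>The relation that rewrites the symbol \<open>t\<close> by symbols with rows
        \<open>is\<close> and columns \<open>js\<close> plus one more.\<close>
      define R where "R t = rel is (fst t) js (snd t)" for t
      have "fe (\<lambda>s. \<Sum>t\<in>T. c t * R t s) \<in> F.span Rel" if "T \<subseteq> S" for T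
        using finite_subset[OF that finite_S] that
      proof (induction T rule: finite_induct)
        case empty
        show ?case unfolding sum.empty fe_ops(3) [symmetric] by (rule sp.zero_closed)
      next
        case (insert t T)
        have tS: "fst t \<in> NR" "snd t \<in> EC" using insert.prems by auto
        have "fe (R t) \<in> Rel" unfolding Rel_eq R_def using "is" js tS by blast
        then have "fe (R t) \<in> F.span Rel" using F.in_own_span[OF RelF] by blast
        then have "cls (c t) \<odot>\<^bsub>F\<^esub> fe (R t) \<in> F.span Rel" by (rule sp.smult_closed[OF cls_closed])
        moreover have "fe (\<lambda>s. \<Sum>t\<in>T. c t * R t s) \<in> F.span Rel"
          using insert.IH insert.prems by blast
        ultimately have "cls (c t) \<odot>\<^bsub>F\<^esub> fe (R t) \<oplus>\<^bsub>F\<^esub> fe (\<lambda>s. \<Sum>t\<in>T. c t * R t s) \<in> F.span Rel"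
          by (rule sp.m_closed)
        then show ?case by (simp only: fe_ops(1,2) sum.insert[OF insert.hyps])
      qed
      then have "fe (\<lambda>s. \<Sum>t\<in>S. c t * R t s) \<in> F.span Rel" by blast
      moreover have "fe (\<lambda>s. mp is js * c s) = fe (\<lambda>s. \<Sum>t\<in>S. c t * R t s)"
      proof (rule fe_cong)
        fix s assume s: "s \<in> S"
        have "(\<Sum>t\<in>S. c t * R t s) =
            (\<Sum>t\<in>S. (if t = s then mp is js * c s else 0)
              - (\<Sum>k\<in>N - set js. c t * jac_field (fst t) (snd t) k * sym is (js @ [k]) s))"
        proof (rule sum.cong[OF refl])
          fix t assume t: "t \<in> S"
          then have "R t s = mp is js * (if s = t then 1 else 0) -
              (\<Sum>k\<in>N - set js. jac_field (fst t) (snd t) k * sym is (js @ [k]) s)"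
            unfolding R_def by (subst rel_eq) auto
          then show "c t * R t s = (if t = s then mp is js * c s else 0)
              - (\<Sum>k\<in>N - set js. c t * jac_field (fst t) (snd t) k * sym is (js @ [k]) s)"
            by (simp add: right_diff_distrib sum_distrib_left mult_ac)
        qed
        also have "\<dots> = (\<Sum>t\<in>S. if t = s then mp is js * c s else 0)
              - (\<Sum>t\<in>S. \<Sum>k\<in>N - set js. c t * jac_field (fst t) (snd t) k * sym is (js @ [k]) s)"
          by (rule sum_subtractf)
        also have "(\<Sum>t\<in>S. if t = s then mp is js * c s else 0) = mp is js * c s"
          using finite_S s by (subst sum.delta) simp_all
        also have "(\<Sum>t\<in>S. \<Sum>k\<in>N - set js. c t * jac_field (fst t) (snd t) k * sym is (js @ [k]) s) =
            (\<Sum>k\<in>N - set js. \<Sum>t\<in>S. c t * jac_field (fst t) (snd t) k * sym is (js @ [k]) s)"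
          by (rule sum.swap)
        also have "\<dots> = (\<Sum>k\<in>N - set js. img c k * sym is (js @ [k]) s)"
          by (simp only: img_def sum_distrib_right)
        finally have "mp is js * c s - (\<Sum>t\<in>S. c t * R t s) = (\<Sum>k\<in>N - set js. img c k * sym is (js @ [k]) s)"
          by simp
        also have "\<dots> \<in> Iext" using ic by (intro Iext.sum Iext.mult_right) blast
        finally show "mp is js * c s - (\<Sum>t\<in>S. c t * R t s) \<in> Iext" .
      qed
      ultimately show "cls (mp is js) \<odot>\<^bsub>F\<^esub> x \<in> F.span Rel" unfolding c fe_ops by (simp only:)
    qed
  qed
qed

lemma combinations_onto:
  assumes reg: "regular_ring A"
  shows "(\<lambda>c. \<Oplus>\<^bsub>DM\<^esub>s\<in>S. c s \<odot>\<^bsub>DM\<^esub> (case s of (is, js) \<Rightarrow> jacobi_derivation n m f is js)) ` carrier F = carrier DM"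
    (is "?\<phi> ` _ = _")
proof -
  interpret DM: module A DM by (rule module_DM)
  have im: "x \<in> ?\<phi> ` carrier F \<longleftrightarrow> (\<exists>c. x = der (img c))" for x
  proof
    assume "x \<in> ?\<phi> ` carrier F"
    then obtain v where v: "x = ?\<phi> v" "v \<in> carrier F" by (rule imageE)
    obtain c where "v = fe c" using fe_exhaust[OF v(2)] by blast
    then show "\<exists>c. x = der (img c)" using v(1) combination_eq by blast
  next
    assume "\<exists>c. x = der (img c)"
    then obtain c where "x = der (img c)" by blast
    then show "x \<in> ?\<phi> ` carrier F" using combination_eq[of c] fe_closed[of c] by (intro image_eqI[of _ _ "fe c"]) simp_all
  qed
  have sub: "submodule A (?\<phi> ` carrier F) DM"
  proof (rule submodule.intro)
    show "?\<phi> ` carrier F \<subseteq> carrier DM"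
    proof
      fix x assume "x \<in> ?\<phi> ` carrier F"
      then obtain c where "x = der (img c)" unfolding im by blast
      then show "x \<in> carrier DM" by (simp only: carrier_DM der_in[OF tangent_img])
    qed
    have "(\<lambda>_. 0) = img (\<lambda>_. 0)" by (rule ext) (simp add: img_def)
    then show "\<zero>\<^bsub>DM\<^esub> \<in> ?\<phi> ` carrier F" unfolding im DM_ops(3) by metis
    fix v w assume v: "v \<in> ?\<phi> ` carrier F" and w: "w \<in> ?\<phi> ` carrier F"
    obtain c where c: "v = der (img c)" using v unfolding im by blast
    obtain d where d: "w = der (img d)" using w unfolding im by blast
    have "(\<lambda>l. img c l + img d l) = img (\<lambda>s. c s + d s)"
      by (rule ext) (simp add: img_def distrib_right sum.distrib)
    then show "v \<oplus>\<^bsub>DM\<^esub> w \<in> ?\<phi> ` carrier F"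
      unfolding im c d DM_ops(1)[OF tangent_img tangent_img] by metis
  next
    fix a v assume a: "a \<in> carrier A" and v: "v \<in> ?\<phi> ` carrier F"
    obtain c where c: "v = der (img c)" using v unfolding im by blast
    obtain p where p: "a = cls p" using a by (rule cls_surj)
    have "(\<lambda>l. p * img c l) = img (\<lambda>s. p * c s)"
      by (rule ext) (simp add: img_def sum_distrib_left mult.assoc)
    then show "a \<odot>\<^bsub>DM\<^esub> v \<in> ?\<phi> ` carrier F"
      unfolding im c p DM_ops(2)[OF tangent_img] by metis
  qed (rule module_DM)
  have "carrier DM \<subseteq> ?\<phi> ` carrier F"
  proof
    fix d assume d: "d \<in> carrier DM"
    obtain y where y: "tangent y" "d = der y" using der_exhaust d unfolding carrier_DM by blast
    show "d \<in> ?\<phi> ` carrier F"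
    proof (rule mem_submodule_cover[OF reg module_DM sub d])
      fix "is" js assume "is": "is \<in> NR" and js: "js \<in> NC"
      \<comment> \<open>The coefficients come from \<open>tangent_expansion\<close>:
        \<open>mp is js\<close> times \<open>y\<close> is the combination of the derivations for
        \<open>js @ [k]\<close> with coefficients \<open>y k\<close>, and the symbols bring these
        derivations into sorted form.\<close>
      define c where "c s = (\<Sum>k\<in>N - set js. y k * sym is (js @ [k]) s)" for s
      have "der (\<lambda>l. mp is js * y l) = der (img c)"
        unfolding der_eq_iff[OF tangent_smult[OF y(1)] tangent_img] c_def img_symbols[OF "is" js]
        using y(1) NR_D[OF "is"] js by (blast intro: tangent_expansion)
      then show "cls (mp is js) \<odot>\<^bsub>DM\<^esub> d \<in> ?\<phi> ` carrier F"
        unfolding im y(2) DM_ops(2)[OF y(1)] by blast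
    qed
  qed
  then show ?thesis using submodule.subset[OF sub] by (intro subset_antisym)
qed

proposition der_presentation:
  assumes "regular_ring A"
  shows "module_presentation A DM S (\<lambda>(is, js). jacobi_derivation n m f is js) Rel"
proof -
  have g: "(\<lambda>(is, js). jacobi_derivation n m f is js) \<in> S \<rightarrow> carrier DM"
  proof (rule funcsetI)
    fix s assume s: "s \<in> S"
    obtain "is" js where ij: "s = (is, js)" by (cases s)
    then have "jacobi_derivation n m f is js = der (jac_field is js)"
      using s NR_D[of "is"] EC_D[of js] by (intro jacobi_derivation_eq) auto
    then show "(case s of (is, js) \<Rightarrow> jacobi_derivation n m f is js) \<in> carrier DM"
      using tangent_S[OF s] by (simp add: ij carrier_DM der_in)
  qed
  show ?thesis
    unfolding module_presentation_def Let_def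
    by (intro conjI finite_S g Rel_closed combinations_onto[OF assms] span_Rel[OF assms])
qed

end

theorem theorem1p1:
  fixes n m r :: nat and f :: "nat \<Rightarrow> 'k::field_char_0 mpol"
  assumes "\<And>i. i \<in> {1..m} \<Longrightarrow> f i \<in> carrier (poly_ring_n n)"
    and "primeideal (gen_ideal n m f) (poly_ring_n n)"
    and "\<not> maximalideal (gen_ideal n m f) (poly_ring_n n)"
    and "r = jacobi_rank n m f"
    and "regular_ring (aff_alg n m f)"
  shows "module_presentation (aff_alg n m f) (Der n m f)
           (nonsing_rows n m f r \<times> ext_cols n m f r)
           (\<lambda>(is, js). jacobi_derivation n m f is js)
           {jacobi_relation n m f r is is' js js' | is is' js js'.
              is \<in> nonsing_rows n m f r \<and> is' \<in> nonsing_rows n m f r \<and>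
              js \<in> nonsing_cols n m f r \<and> js' \<in> ext_cols n m f r}"
proof -
  interpret affine_domain n m f
    using assms(1,2) unfolding carrier_poly_ring_n by (rule affine_domain.intro)
  show ?thesis unfolding assms(4) by (rule der_presentation[OF assms(5)])
qed

end
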